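(* Let $C_{\mathrm a},C_{\mathrm t},C_p>0$ be constants, independent of $h$, such that for all $h\in\mathcal H$: $C_{\mathrm a}^{-1}\|\underline{\boldsymbol v}_h\|_{1,h}^2\le\mathrm a_h(\underline{\boldsymbol v}_h,\underline{\boldsymbol v}_h)\le C_{\mathrm a}\|\underline{\boldsymbol v}_h\|_{1,h}^2$ for all $\underline{\boldsymbol v}_h\in\underline{\boldsymbol U}_h^k$; $|\mathrm t_h(\underline{\boldsymbol v}_h,\underline{\boldsymbol w}_h,\underline{\boldsymbol z}_h)|\le C_{\mathrm t}\|\underline{\boldsymbol v}_h\|_{1,h}\|\underline{\boldsymbol w}_h\|_{1,h}\|\underline{\boldsymbol z}_h\|_{1,h}$ for all $\underline{\boldsymbol v}_h,\underline{\boldsymbol w}_h,\underline{\boldsymbol z}_h\in\underline{\boldsymbol U}_{h,\boldsymbol n}^k$; and $\|\boldsymbol v_h\|_\Omega\le C_p\|\underline{\boldsymbol v}_h\|_{1,h}$ for all $\underline{\boldsymbol v}_h\in\underline{\boldsymbol U}_{h,\boldsymbol n}^k$. If the source terms $\boldsymbol f$ and $\boldsymbol g$ satisfy, for some $\chi\in[0,1)$, $$\Big(\|\boldsymbol f\|_\Omega^2+\|\boldsymbol g\|_\Omega^2\Big)^{1/2}\le\chi\,\frac{\min(\nu_k,\nu_m)^2}{\sqrt2\,C_{\mathrm a}^2C_{\mathrm t}C_p},$$ then the discrete problem (DP) described in the context admits a unique solution $(\underline{\boldsymbol u}_h,\underline{\boldsymbol b}_h,q_h,r_h)\in\boldsymbol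 X_h^k$.
   Context: Setting and meshes. $\Omega\subset\mathbb R^3$ is a bounded polyhedral Lipschitz domain with outer unit normal $\boldsymbol n$; $k\ge0$ is a fixed integer; $\nu_k,\nu_m>0$ are constants; $\boldsymbol f,\boldsymbol g\in L^2(\Omega)^3$ with $\operatorname{div}\boldsymbol g=0$. $\mathcal H\subset(0,\infty)$ is a countable set with $0$ as unique cluster point. For each $h\in\mathcal H$, $\mathcal M_h=(\mathcal T_h,\mathcal F_h)$ is a mesh: $\mathcal T_h$ is a finite collection of disjoint open polyhedra (elements) with $\overline\Omega=\bigcup_{T\in\mathcal T_h}\overline T$, and $\mathcal F_h$ is a finite collection of disjoint planar sets (faces) with $\bigcup_{T}\partial T=\bigcup_F\overline F$; each face lies either in the boundary of exactly two elements, or in $\partial\Omega$ and in the boundary of exactly one element. $h_T$ is the diameter of $T$ and $h=\max_T h_T$; $\mathcal F_T=\{F\in\mathcal F_h:F\subset\partial T\}$; $\boldsymbol n_T$ is the outer unit normal on $\partial T$; $\boldsymbol n_F$ is the unit normal to a face $F$. Mesh regularity: there is $\varrho>0$ such that for all $h\in\mathcal H$ each $T\in\mathcal T_h$ is star-shaped with respect to a ball of radius $r_T\ge\varrho^{-1}h_T$. $\|\cdot\|_X$ and $(\cdot,\cdot)_X$ are the $L^2(X)$-norm and inner product. $X\lesssim Y$ means $X\le CY$ with $C$ independent of $X$, $Y$, $h$ (and of the element considered), and of the data $(\nu_k,\nu_m,\boldsymbol f,\boldsymbol g)$. Discrete spaces. $\mathbb P^l(X)$ is the space of polynomials of total degree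 $\le l$ on $X$ ($X$ an element or a face), and $\mathbb P^k(\mathcal F_T)$ is the space of functions on $\partial T$ whose restriction to each $F\in\mathcal F_T$ is in $\mathbb P^k(F)$. $\underline{\boldsymbol U}_T^k=\mathbb P^k(T)^3\times\mathbb P^k(\mathcal F_T)^3$, with elements $\underline{\boldsymbol v}_T=(\boldsymbol v_T,\boldsymbol v_{\mathcal F_T})$. $\underline{\boldsymbol U}_h^k$ is the set of $\underline{\boldsymbol v}_h=((\boldsymbol v_T)_{T\in\mathcal T_h},(\boldsymbol v_F)_{F\in\mathcal F_h})$ with $\boldsymbol v_T\in\mathbb P^k(T)^3$, $\boldsymbol v_F\in\mathbb P^k(F)^3$; its restriction to $T$ is $\underline{\boldsymbol v}_T=(\boldsymbol v_T,\boldsymbol v_{\mathcal F_T})$ with $(\boldsymbol v_{\mathcal F_T})_{|F}=\boldsymbol v_F$; $\boldsymbol v_h$ is the piecewise polynomial function with $(\boldsymbol v_h)_{|T}=\boldsymbol v_T$. Set $\|\underline{\boldsymbol v}_T\|_{1,T}^2=\|\nabla\boldsymbol v_T\|_T^2+h_T^{-1}\|\boldsymbol v_{\mathcal F_T}-\boldsymbol v_T\|_{\partial T}^2$ and $\|\underline{\boldsymbol v}_h\|_{1,h}^2=\sum_T\|\underline{\boldsymbol v}_T\|_{1,T}^2$. $\underline{\boldsymbol U}_{h,0}^k=\{\underline{\boldsymbol v}_h\in\underline{\boldsymbol U}_h^k:\boldsymbol v_F=\boldsymbol 0\ \forall F\subset\partial\Omega\}$, $\underline{\boldsymbol U}_{h,\boldsymbol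 n}^k=\{\underline{\boldsymbol v}_h\in\underline{\boldsymbol U}_h^k:\boldsymbol v_F\cdot\boldsymbol n_F=0\ \forall F\subset\partial\Omega\}$, $\mathbb P^k_0(\mathcal T_h)=\{z\in L^2(\Omega):z_{|T}\in\mathbb P^k(T)\ \forall T,\ \int_\Omega z=0\}$, $\boldsymbol X_h^k=\underline{\boldsymbol U}_{h,0}^k\times\underline{\boldsymbol U}_{h,\boldsymbol n}^k\times\mathbb P_0^k(\mathcal T_h)\times\mathbb P_0^k(\mathcal T_h)$. The interpolator is $\underline{\boldsymbol I}_T^k\boldsymbol v=(\boldsymbol\pi_T^{0,k}\boldsymbol v,\boldsymbol\pi_{\mathcal F_T}^{0,k}\boldsymbol v)$, the $L^2$-orthogonal projections of $\boldsymbol v$ on $\mathbb P^k(T)^3$ and $\mathbb P^k(\mathcal F_T)^3$. Discrete forms. $\mathrm r_T^{k+1}:\underline{\boldsymbol U}_T^k\to\mathbb P^{k+1}(T)^3$ is defined by $\int_T\nabla\mathrm r_T^{k+1}\underline{\boldsymbol v}_T:\nabla\boldsymbol w=\int_T\nabla\boldsymbol v_T:\nabla\boldsymbol w+\int_{\partial T}(\boldsymbol v_{\mathcal F_T}-\boldsymbol v_T)\cdot(\boldsymbol n_T\cdot\nabla)\boldsymbol w$ for all $\boldsymbol w\in\mathbb P^{k+1}(T)^3$, and $\int_T(\mathrm r_T^{k+1}\underline{\boldsymbol v}_T-\boldsymbol v_T)=\boldsymbol 0$. $\mathrm D_T^k:\underline{\boldsymbol U}_T^k\to\mathbb P^k(T)$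 is defined by $\int_T\mathrm D_T^k\underline{\boldsymbol v}_T\,q=-\int_T\boldsymbol v_T\cdot\nabla q+\int_{\partial T}(\boldsymbol v_{\mathcal F_T}\cdot\boldsymbol n_T)q$ for all $q\in\mathbb P^k(T)$. $\boldsymbol G_T^{2k}:\underline{\boldsymbol U}_T^k\to\mathbb P^{2k}(T)^{3\times3}$ is defined by $\int_T\boldsymbol G_T^{2k}\underline{\boldsymbol v}_T:\boldsymbol\tau=-\int_T\boldsymbol v_T\cdot(\nabla\cdot\boldsymbol\tau)+\int_{\partial T}\boldsymbol v_{\mathcal F_T}\cdot(\boldsymbol\tau\boldsymbol n_T)$ for all $\boldsymbol\tau\in\mathbb P^{2k}(T)^{3\times3}$, and $[(\boldsymbol v\cdot\boldsymbol G_T^{2k})\underline{\boldsymbol w}_T]_i=\sum_{j=1}^3v_j(\boldsymbol G_T^{2k}\underline{\boldsymbol w}_T)_{ij}$. Set $\mathrm a_T(\underline{\boldsymbol u}_T,\underline{\boldsymbol v}_T)=\int_T\nabla\mathrm r_T^{k+1}\underline{\boldsymbol u}_T:\nabla\mathrm r_T^{k+1}\underline{\boldsymbol v}_T+\mathrm s_T(\underline{\boldsymbol u}_T,\underline{\boldsymbol v}_T)$, where $\mathrm s_T$ is a given symmetric positive semi-definite bilinear form on $\underline{\boldsymbol U}_T^k$ such that $\|\underline{\boldsymbol v}_T\|_{1,T}^2\lesssim\mathrm a_T(\underline{\boldsymbol v}_T,\underline{\boldsymbol v}_T)\lesssim\|\underline{\boldsymbol v}_T\|_{1,T}^2$ for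 all $\underline{\boldsymbol v}_T\in\underline{\boldsymbol U}_T^k$ and $\mathrm s_T(\underline{\boldsymbol I}_T^k\boldsymbol v,\underline{\boldsymbol I}_T^k\boldsymbol v)\lesssim[h_T^{k+1}|\boldsymbol v|_{H^{k+2}(T)}]^2$ for all $\boldsymbol v\in H^{k+2}(T)^3$. Set $\mathrm d_T(\underline{\boldsymbol v}_T,q_T)=-\int_T\mathrm D_T^k\underline{\boldsymbol v}_T\,q_T$ and $\mathrm t_T(\underline{\boldsymbol v}_T,\underline{\boldsymbol w}_T,\underline{\boldsymbol z}_T)=\frac12\big(\int_T(\boldsymbol v_T\cdot\boldsymbol G_T^{2k})\underline{\boldsymbol w}_T\cdot\boldsymbol z_T-\int_T(\boldsymbol v_T\cdot\boldsymbol G_T^{2k})\underline{\boldsymbol z}_T\cdot\boldsymbol w_T\big)$. The global forms $\mathrm a_h,\mathrm d_h,\mathrm t_h$ are the sums over $T\in\mathcal T_h$ of $\mathrm a_T,\mathrm d_T,\mathrm t_T$ applied to the restrictions to $T$. Discrete problem (DP): find $(\underline{\boldsymbol u}_h,\underline{\boldsymbol b}_h,q_h,r_h)\in\boldsymbol X_h^k$ such that $\nu_k\mathrm a_h(\underline{\boldsymbol u}_h,\underline{\boldsymbol v}_h)+\mathrm t_h(\underline{\boldsymbol u}_h,\underline{\boldsymbol u}_h,\underline{\boldsymbol v}_h)-\mathrm t_h(\underline{\boldsymbol b}_h,\underline{\boldsymbol b}_h,\underline{\boldsymbol v}_h)+\mathrm d_h(\underline{\boldsymbol v}_h,q_h)=(\boldsymbol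 f,\boldsymbol v_h)_\Omega$ for all $\underline{\boldsymbol v}_h\in\underline{\boldsymbol U}_{h,0}^k$; $\nu_m\mathrm a_h(\underline{\boldsymbol b}_h,\underline{\boldsymbol w}_h)+\mathrm t_h(\underline{\boldsymbol u}_h,\underline{\boldsymbol b}_h,\underline{\boldsymbol w}_h)-\mathrm t_h(\underline{\boldsymbol b}_h,\underline{\boldsymbol u}_h,\underline{\boldsymbol w}_h)+\mathrm d_h(\underline{\boldsymbol w}_h,r_h)=(\boldsymbol g,\boldsymbol w_h)_\Omega$ for all $\underline{\boldsymbol w}_h\in\underline{\boldsymbol U}_{h,\boldsymbol n}^k$; $-\mathrm d_h(\underline{\boldsymbol u}_h,s_h)=0$ and $-\mathrm d_h(\underline{\boldsymbol b}_h,z_h)=0$ for all $s_h,z_h\in\mathbb P_0^k(\mathcal T_h)$. *)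

theory Defs
  imports "HOL-Analysis.Analysis"
begin

section \<open>Domains and meshes\<close>

text \<open>A polyhedron need not be convex, so the library's convex \<open>polyhedron\<close> is not what is
  meant here.\<close>

definition open_polyhedron :: "(real^3) set \<Rightarrow> bool" where
  "open_polyhedron P \<longleftrightarrow>
     P \<noteq> {} \<and> (\<exists>\<Q>. finite \<Q> \<and> (\<forall>Q\<in>\<Q>. polytope Q) \<and> P = interior (\<Union>\<Q>))"

text \<open>Near each boundary point the set is the strict epigraph of a Lipschitz function of
  the variables orthogonal to some direction \<open>e\<close>.\<close>

definition lipschitz_boundary :: "(real^3) set \<Rightarrow> bool" where
  "lipschitz_boundary \<Omega> \<longleftrightarrow>
     (\<forall>x\<in>frontier \<Omega>. \<exists>e r L. \<exists>\<phi> :: real^3 \<Rightarrow> real.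
        norm e = 1 \<and> r > 0 \<and> L-lipschitz_on UNIV \<phi> \<and>
        \<Omega> \<inter> ball x r = {y \<in> ball x r. \<phi> (y - (y \<bullet> e) *\<^sub>R e) < y \<bullet> e})"

definition polyhedral_lipschitz_domain :: "(real^3) set \<Rightarrow> bool" where
  "polyhedral_lipschitz_domain \<Omega> \<longleftrightarrow>
     open \<Omega> \<and> connected \<Omega> \<and> bounded \<Omega> \<and> open_polyhedron \<Omega> \<and> lipschitz_boundary \<Omega>"

text \<open>Like the elements, the faces do not contain their (relative) boundary.\<close>

definition planar_face :: "(real^3) set \<Rightarrow> bool" where
  "planar_face F \<longleftrightarrow> aff_dim F = 2 \<and> openin (top_of_set (affine hull F)) F"

definition polyhedral_mesh :: "(real^3) set \<Rightarrow> (real^3) set set \<Rightarrow> (real^3) set set \<Rightarrow> bool" where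
  "polyhedral_mesh \<Omega> \<T> \<F> \<longleftrightarrow>
     finite \<T> \<and> (\<forall>T\<in>\<T>. open_polyhedron T) \<and> pairwise disjnt \<T> \<and>
     closure \<Omega> = (\<Union>T\<in>\<T>. closure T) \<and>
     finite \<F> \<and> (\<forall>F\<in>\<F>. planar_face F) \<and> pairwise disjnt \<F> \<and>
     (\<Union>T\<in>\<T>. frontier T) = (\<Union>F\<in>\<F>. closure F) \<and>
     (\<forall>F\<in>\<F>. card {T\<in>\<T>. F \<subseteq> frontier T} = 2 \<or>
              F \<subseteq> frontier \<Omega> \<and> card {T\<in>\<T>. F \<subseteq> frontier T} = 1)"

definition star_shaped_wrt_ball :: "(real^3) set \<Rightarrow> real^3 \<Rightarrow> real \<Rightarrow> bool" where
  "star_shaped_wrt_ball T c r \<longleftrightarrow>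
     ball c r \<subseteq> T \<and> (\<forall>y\<in>ball c r. \<forall>x\<in>T. closed_segment y x \<subseteq> T)"

definition faces_of_elt :: "(real^3) set set \<Rightarrow> (real^3) set \<Rightarrow> (real^3) set set" where
  "faces_of_elt \<F> T = {F\<in>\<F>. F \<subseteq> frontier T}"

text \<open>The outer unit normal at a boundary point where \<open>T\<close> is locally a half space.  If
  \<open>T\<close> is open and star-shaped with respect to a ball, this is the case at every point of a
  planar, relatively open subset of its boundary.\<close>

definition outer_normal :: "(real^3) set \<Rightarrow> real^3 \<Rightarrow> real^3" where
  "outer_normal T x =
     (THE n. norm n = 1 \<and> (\<exists>e>0. T \<inter> ball x e = {y \<in> ball x e. (y - x) \<bullet> n < 0}))"

definition face_normal :: "(real^3) set \<Rightarrow> real^3" where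
  "face_normal F = (SOME n. norm n = 1 \<and> (\<forall>x\<in>F. \<forall>y\<in>F. n \<bullet> (x - y) = 0))"


section \<open>Integration\<close>

definition L2 :: "(real^3) set \<Rightarrow> (real^3 \<Rightarrow> 'a::euclidean_space) set" where
  "L2 X = {u. u \<in> borel_measurable (lebesgue_on X) \<and>
              integrable (lebesgue_on X) (\<lambda>x. (norm (u x))\<^sup>2)}"

definition L2_norm :: "(real^3) set \<Rightarrow> (real^3 \<Rightarrow> 'a::euclidean_space) \<Rightarrow> real" where
  "L2_norm X u = sqrt (LINT x|lebesgue_on X. (norm (u x))\<^sup>2)"

definition L2_inner ::
    "(real^3) set \<Rightarrow> (real^3 \<Rightarrow> 'a::euclidean_space) \<Rightarrow> (real^3 \<Rightarrow> 'a) \<Rightarrow> real" where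
  "L2_inner X u v = (LINT x|lebesgue_on X. u x \<bullet> v x)"

text \<open>The area measure on a planar set is the image of the two-dimensional Lebesgue measure
  under an isometric parametrisation of the plane; it does not depend on the choice of the
  latter, since Lebesgue measure is invariant under isometries.\<close>

definition plane_chart :: "(real^3) set \<Rightarrow> real^2 \<Rightarrow> real^3" where
  "plane_chart F =
     (SOME \<phi>. (\<forall>s t. dist (\<phi> s) (\<phi> t) = dist s t) \<and> range \<phi> = affine hull F)"

definition face_integral :: "(real^3) set \<Rightarrow> (real^3 \<Rightarrow> real) \<Rightarrow> real" where
  "face_integral F g =
     (LINT s|lebesgue_on (plane_chart F -` F). g (plane_chart F s))"

text \<open>The integral over \<open>\<partial>T\<close>, which the faces of \<open>T\<close> cover up to their
  relative boundaries.\<close>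

definition bdry_integral :: "(real^3) set set \<Rightarrow> (real^3) set \<Rightarrow> (real^3 \<Rightarrow> real) \<Rightarrow> real" where
  "bdry_integral \<F> T g = (\<Sum>F\<in>faces_of_elt \<F> T. face_integral F g)"


section \<open>Differential operators\<close>

definition pderiv_at :: "3 \<Rightarrow> (real^3 \<Rightarrow> real) \<Rightarrow> real^3 \<Rightarrow> real" where
  "pderiv_at j f x = frechet_derivative f (at x) (axis j 1)"

definition grad :: "(real^3 \<Rightarrow> real) \<Rightarrow> real^3 \<Rightarrow> real^3" where
  "grad f x = (\<chi> j. pderiv_at j f x)"

text \<open>\<open>(grad_vec v x) $ i $ j\<close> is the derivative of \<open>v\<^sub>i\<close> in direction \<open>j\<close>. The inner product
  and the norm of \<open>real^3^3\<close> are those of Frobenius.\<close>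

definition grad_vec :: "(real^3 \<Rightarrow> real^3) \<Rightarrow> real^3 \<Rightarrow> real^3^3" where
  "grad_vec v x = jacobian v (at x)"

definition div_mat :: "(real^3 \<Rightarrow> real^3^3) \<Rightarrow> real^3 \<Rightarrow> real^3" where
  "div_mat \<tau> x = (\<chi> i. \<Sum>j\<in>UNIV. pderiv_at j (\<lambda>y. \<tau> y $ i $ j) x)"


section \<open>Sobolev spaces\<close>

text \<open>Multi-indices are elements of \<open>nat^3\<close>.\<close>

definition mi_order :: "nat^3 \<Rightarrow> nat" where
  "mi_order \<alpha> = (\<Sum>i\<in>UNIV. \<alpha> $ i)"

definition mi_deriv :: "nat^3 \<Rightarrow> (real^3 \<Rightarrow> real) \<Rightarrow> real^3 \<Rightarrow> real" where
  "mi_deriv \<alpha> f =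
     (pderiv_at 1 ^^ (\<alpha> $ 1)) ((pderiv_at 2 ^^ (\<alpha> $ 2)) ((pderiv_at 3 ^^ (\<alpha> $ 3)) f))"

definition test_function :: "(real^3) set \<Rightarrow> (real^3 \<Rightarrow> real) \<Rightarrow> bool" where
  "test_function X \<phi> \<longleftrightarrow>
     (\<forall>js :: 3 list. \<forall>x. foldr pderiv_at js \<phi> differentiable (at x)) \<and>
     (\<exists>K. compact K \<and> K \<subseteq> X \<and> (\<forall>x. x \<notin> K \<longrightarrow> \<phi> x = 0))"

definition weak_deriv ::
    "(real^3) set \<Rightarrow> nat^3 \<Rightarrow> (real^3 \<Rightarrow> real) \<Rightarrow> (real^3 \<Rightarrow> real) \<Rightarrow> bool" where
  "weak_deriv X \<alpha> u g \<longleftrightarrow>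
     (\<forall>\<phi>. test_function X \<phi> \<longrightarrow>
        L2_inner X u (mi_deriv \<alpha> \<phi>) = (-1) ^ mi_order \<alpha> * L2_inner X g \<phi>)"

definition sobolev :: "nat \<Rightarrow> (real^3) set \<Rightarrow> (real^3 \<Rightarrow> real) set" where
  "sobolev m X = {u \<in> L2 X. \<forall>\<alpha>. mi_order \<alpha> \<le> m \<longrightarrow> (\<exists>g \<in> L2 X. weak_deriv X \<alpha> u g)}"

definition sobolev_vec :: "nat \<Rightarrow> (real^3) set \<Rightarrow> (real^3 \<Rightarrow> real^3) set" where
  "sobolev_vec m X = {v. \<forall>i. (\<lambda>x. v x $ i) \<in> sobolev m X}"

definition sobolev_seminorm :: "nat \<Rightarrow> (real^3) set \<Rightarrow> (real^3 \<Rightarrow> real^3) \<Rightarrow> real" where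
  "sobolev_seminorm m X v =
     sqrt (\<Sum>i\<in>UNIV. \<Sum>\<alpha> | mi_order \<alpha> = m.
             (L2_norm X (SOME g. g \<in> L2 X \<and> weak_deriv X \<alpha> (\<lambda>x. v x $ i) g))\<^sup>2)"

definition weakly_div_free :: "(real^3) set \<Rightarrow> (real^3 \<Rightarrow> real^3) \<Rightarrow> bool" where
  "weakly_div_free X g \<longleftrightarrow> (\<forall>\<phi>. test_function X \<phi> \<longrightarrow> L2_inner X g (grad \<phi>) = 0)"


section \<open>Polynomials and discrete spaces\<close>

text \<open>Polynomials on an element are represented by polynomial functions on the whole space:
  as elements are open and nonempty, this is a bijection, and it provides the boundary values
  of polynomials and of their gradients.\<close>

definition poly_fun :: "nat \<Rightarrow> (real^3 \<Rightarrow> real) set" where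
  "poly_fun l =
     {p. \<exists>c. p = (\<lambda>x. \<Sum>\<alpha> | mi_order \<alpha> \<le> l. c \<alpha> * (\<Prod>i\<in>UNIV. (x $ i) ^ (\<alpha> $ i)))}"

definition poly_vec :: "nat \<Rightarrow> (real^3 \<Rightarrow> real^3) set" where
  "poly_vec l = {v. \<forall>i. (\<lambda>x. v x $ i) \<in> poly_fun l}"

definition poly_mat :: "nat \<Rightarrow> (real^3 \<Rightarrow> real^3^3) set" where
  "poly_mat l = {\<tau>. \<forall>i j. (\<lambda>x. \<tau> x $ i $ j) \<in> poly_fun l}"

text \<open>Functions on the union of a set \<open>\<G>\<close> of disjoint faces that are polynomial on each of
  them, extended by \<open>0\<close> to obtain unique representatives. For a single face, \<open>\<G> = {F}\<close>.\<close>

definition poly_faces :: "nat \<Rightarrow> (real^3) set set \<Rightarrow> (real^3 \<Rightarrow> real^3) set" where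
  "poly_faces l \<G> =
     {v. (\<forall>F\<in>\<G>. \<exists>p\<in>poly_vec l. \<forall>x\<in>F. v x = p x) \<and> (\<forall>x. x \<notin> \<Union>\<G> \<longrightarrow> v x = 0)}"

type_synonym local_dofs = "(real^3 \<Rightarrow> real^3) \<times> (real^3 \<Rightarrow> real^3)"

type_synonym global_dofs =
  "((real^3) set \<Rightarrow> real^3 \<Rightarrow> real^3) \<times> ((real^3) set \<Rightarrow> real^3 \<Rightarrow> real^3)"

definition U_loc :: "nat \<Rightarrow> (real^3) set set \<Rightarrow> (real^3) set \<Rightarrow> local_dofs set" where
  "U_loc k \<F> T = poly_vec k \<times> poly_faces k (faces_of_elt \<F> T)"

text \<open>The families are indexed by \<open>\<T>\<close> and \<open>\<F>\<close>; the value \<open>0\<close> at all other indices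
  makes their representation unique.\<close>

definition U_glob :: "nat \<Rightarrow> (real^3) set set \<Rightarrow> (real^3) set set \<Rightarrow> global_dofs set" where
  "U_glob k \<T> \<F> =
     {v. (\<forall>T\<in>\<T>. fst v T \<in> poly_vec k) \<and> (\<forall>T. T \<notin> \<T> \<longrightarrow> fst v T = (\<lambda>x. 0)) \<and>
         (\<forall>F\<in>\<F>. snd v F \<in> poly_faces k {F}) \<and> (\<forall>F. F \<notin> \<F> \<longrightarrow> snd v F = (\<lambda>x. 0))}"

definition U_glob_0 ::
    "nat \<Rightarrow> (real^3) set \<Rightarrow> (real^3) set set \<Rightarrow> (real^3) set set \<Rightarrow> global_dofs set" where
  "U_glob_0 k \<Omega> \<T> \<F> =
     {v \<in> U_glob k \<T> \<F>. \<forall>F\<in>\<F>. F \<subseteq> frontier \<Omega> \<longrightarrow> (\<forall>x\<in>F. snd v F x = 0)}"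

definition U_glob_n ::
    "nat \<Rightarrow> (real^3) set \<Rightarrow> (real^3) set set \<Rightarrow> (real^3) set set \<Rightarrow> global_dofs set" where
  "U_glob_n k \<Omega> \<T> \<F> =
     {v \<in> U_glob k \<T> \<F>.
        \<forall>F\<in>\<F>. F \<subseteq> frontier \<Omega> \<longrightarrow> (\<forall>x\<in>F. snd v F x \<bullet> face_normal F = 0)}"

text \<open>The value \<open>0\<close> outside the elements selects one representative in each
  almost-everywhere class.\<close>

definition P_0 :: "nat \<Rightarrow> (real^3) set \<Rightarrow> (real^3) set set \<Rightarrow> (real^3 \<Rightarrow> real) set" where
  "P_0 k \<Omega> \<T> =
     {z \<in> L2 \<Omega>. (\<forall>T\<in>\<T>. \<exists>p\<in>poly_fun k. \<forall>x\<in>T. z x = p x) \<and>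
                (\<forall>x. x \<notin> \<Union>\<T> \<longrightarrow> z x = 0) \<and> (LINT x|lebesgue_on \<Omega>. z x) = 0}"

definition X_space ::
    "nat \<Rightarrow> (real^3) set \<Rightarrow> (real^3) set set \<Rightarrow> (real^3) set set \<Rightarrow>
     (global_dofs \<times> global_dofs \<times> (real^3 \<Rightarrow> real) \<times> (real^3 \<Rightarrow> real)) set" where
  "X_space k \<Omega> \<T> \<F> = U_glob_0 k \<Omega> \<T> \<F> \<times> U_glob_n k \<Omega> \<T> \<F> \<times> P_0 k \<Omega> \<T> \<times> P_0 k \<Omega> \<T>"

text \<open>Restriction to \<open>T\<close>: as \<open>snd v F\<close> vanishes outside \<open>F\<close> and faces are disjoint, the sum
  equals \<open>snd v F\<close> on each face \<open>F\<close> of \<open>T\<close>.\<close>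

definition restr :: "(real^3) set set \<Rightarrow> global_dofs \<Rightarrow> (real^3) set \<Rightarrow> local_dofs" where
  "restr \<F> v T = (fst v T, \<lambda>x. \<Sum>F\<in>faces_of_elt \<F> T. snd v F x)"

definition piecewise :: "(real^3) set set \<Rightarrow> global_dofs \<Rightarrow> real^3 \<Rightarrow> real^3" where
  "piecewise \<T> v x = (\<Sum>T\<in>\<T>. indicator T x *\<^sub>R fst v T x)"

definition norm1_loc :: "(real^3) set set \<Rightarrow> (real^3) set \<Rightarrow> local_dofs \<Rightarrow> real" where
  "norm1_loc \<F> T v =
     sqrt ((L2_norm T (grad_vec (fst v)))\<^sup>2
           + inverse (diameter T) * bdry_integral \<F> T (\<lambda>x. (norm (snd v x - fst v x))\<^sup>2))"

definition norm1 :: "(real^3) set set \<Rightarrow> (real^3) set set \<Rightarrow> global_dofs \<Rightarrow> real" where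
  "norm1 \<T> \<F> v = sqrt (\<Sum>T\<in>\<T>. (norm1_loc \<F> T (restr \<F> v T))\<^sup>2)"

definition proj_elt :: "nat \<Rightarrow> (real^3) set \<Rightarrow> (real^3 \<Rightarrow> real^3) \<Rightarrow> real^3 \<Rightarrow> real^3" where
  "proj_elt k T v =
     (THE p. p \<in> poly_vec k \<and> (\<forall>w\<in>poly_vec k. L2_inner T (\<lambda>x. p x - v x) w = 0))"

definition proj_bdry ::
    "nat \<Rightarrow> (real^3) set set \<Rightarrow> (real^3) set \<Rightarrow> (real^3 \<Rightarrow> real^3) \<Rightarrow> real^3 \<Rightarrow> real^3" where
  "proj_bdry k \<F> T v =
     (THE p. p \<in> poly_faces k (faces_of_elt \<F> T) \<and>
        (\<forall>w\<in>poly_faces k (faces_of_elt \<F> T). bdry_integral \<F> T (\<lambda>x. (p x - v x) \<bullet> w x) = 0))"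

text \<open>The boundary values of \<open>v\<close> are used pointwise, so this is meant for \<open>v\<close> continuous up
  to the boundary. By Sobolev embedding, every class in \<open>H\<^sup>m(T)\<close> with \<open>m \<ge> 2\<close> has a
  representative of this kind, and its boundary values are the trace.\<close>

definition interp ::
    "nat \<Rightarrow> (real^3) set set \<Rightarrow> (real^3) set \<Rightarrow> (real^3 \<Rightarrow> real^3) \<Rightarrow> local_dofs" where
  "interp k \<F> T v = (proj_elt k T v, proj_bdry k \<F> T v)"


section \<open>Discrete operators and forms\<close>

definition recon ::
    "nat \<Rightarrow> (real^3) set set \<Rightarrow> (real^3) set \<Rightarrow> local_dofs \<Rightarrow> real^3 \<Rightarrow> real^3" where
  "recon k \<F> T v =
     (THE r. r \<in> poly_vec (k + 1) \<and>
        (\<forall>w\<in>poly_vec (k + 1).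
           L2_inner T (grad_vec r) (grad_vec w) =
           L2_inner T (grad_vec (fst v)) (grad_vec w)
           + bdry_integral \<F> T (\<lambda>x. (snd v x - fst v x) \<bullet> (grad_vec w x *v outer_normal T x))) \<and>
        (LINT x|lebesgue_on T. r x - fst v x) = 0)"

definition disc_div ::
    "nat \<Rightarrow> (real^3) set set \<Rightarrow> (real^3) set \<Rightarrow> local_dofs \<Rightarrow> real^3 \<Rightarrow> real" where
  "disc_div k \<F> T v =
     (THE d. d \<in> poly_fun k \<and>
        (\<forall>q\<in>poly_fun k.
           L2_inner T d q =
           - L2_inner T (fst v) (grad q)
           + bdry_integral \<F> T (\<lambda>x. (snd v x \<bullet> outer_normal T x) * q x)))"

definition disc_grad ::
    "nat \<Rightarrow> (real^3) set set \<Rightarrow> (real^3) set \<Rightarrow> local_dofs \<Rightarrow> real^3 \<Rightarrow> real^3^3" where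
  "disc_grad k \<F> T v =
     (THE G. G \<in> poly_mat (2 * k) \<and>
        (\<forall>\<tau>\<in>poly_mat (2 * k).
           L2_inner T G \<tau> =
           - L2_inner T (fst v) (div_mat \<tau>)
           + bdry_integral \<F> T (\<lambda>x. snd v x \<bullet> (\<tau> x *v outer_normal T x))))"

definition lin_comb :: "real \<Rightarrow> local_dofs \<Rightarrow> real \<Rightarrow> local_dofs \<Rightarrow> local_dofs" where
  "lin_comb c u d v =
     (\<lambda>x. c *\<^sub>R fst u x + d *\<^sub>R fst v x, \<lambda>x. c *\<^sub>R snd u x + d *\<^sub>R snd v x)"

text \<open>Linearity in the second argument follows from symmetry.\<close>

definition sym_psd_bilinear ::
    "local_dofs set \<Rightarrow> (local_dofs \<Rightarrow> local_dofs \<Rightarrow> real) \<Rightarrow> bool" where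
  "sym_psd_bilinear U s \<longleftrightarrow>
     (\<forall>u\<in>U. \<forall>v\<in>U. \<forall>w\<in>U. \<forall>c d. s (lin_comb c u d v) w = c * s u w + d * s v w) \<and>
     (\<forall>u\<in>U. \<forall>v\<in>U. s u v = s v u) \<and> (\<forall>v\<in>U. 0 \<le> s v v)"

definition a_loc ::
    "nat \<Rightarrow> (real^3) set set \<Rightarrow> (local_dofs \<Rightarrow> local_dofs \<Rightarrow> real) \<Rightarrow>
     (real^3) set \<Rightarrow> local_dofs \<Rightarrow> local_dofs \<Rightarrow> real" where
  "a_loc k \<F> s T u v =
     L2_inner T (grad_vec (recon k \<F> T u)) (grad_vec (recon k \<F> T v)) + s u v"

definition d_loc ::
    "nat \<Rightarrow> (real^3) set set \<Rightarrow> (real^3) set \<Rightarrow> local_dofs \<Rightarrow> (real^3 \<Rightarrow> real) \<Rightarrow> real" where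
  "d_loc k \<F> T v q = - L2_inner T (disc_div k \<F> T v) q"

definition t_loc ::
    "nat \<Rightarrow> (real^3) set set \<Rightarrow> (real^3) set \<Rightarrow>
     local_dofs \<Rightarrow> local_dofs \<Rightarrow> local_dofs \<Rightarrow> real" where
  "t_loc k \<F> T v w z =
     1/2 * (L2_inner T (\<lambda>x. disc_grad k \<F> T w x *v fst v x) (fst z)
            - L2_inner T (\<lambda>x. disc_grad k \<F> T z x *v fst v x) (fst w))"

definition a_form ::
    "nat \<Rightarrow> (real^3) set set \<Rightarrow> (real^3) set set \<Rightarrow>
     ((real^3) set \<Rightarrow> local_dofs \<Rightarrow> local_dofs \<Rightarrow> real) \<Rightarrow>
     global_dofs \<Rightarrow> global_dofs \<Rightarrow> real" where
  "a_form k \<T> \<F> s u v = (\<Sum>T\<in>\<T>. a_loc k \<F> (s T) T (restr \<F> u T) (restr \<F> v T))"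

definition d_form ::
    "nat \<Rightarrow> (real^3) set set \<Rightarrow> (real^3) set set \<Rightarrow> global_dofs \<Rightarrow> (real^3 \<Rightarrow> real) \<Rightarrow> real" where
  "d_form k \<T> \<F> v q = (\<Sum>T\<in>\<T>. d_loc k \<F> T (restr \<F> v T) q)"

definition t_form ::
    "nat \<Rightarrow> (real^3) set set \<Rightarrow> (real^3) set set \<Rightarrow>
     global_dofs \<Rightarrow> global_dofs \<Rightarrow> global_dofs \<Rightarrow> real" where
  "t_form k \<T> \<F> v w z =
     (\<Sum>T\<in>\<T>. t_loc k \<F> T (restr \<F> v T) (restr \<F> w T) (restr \<F> z T))"


section \<open>The discrete problem\<close>

definition solves_DP ::
    "nat \<Rightarrow> (real^3) set \<Rightarrow> (real^3) set set \<Rightarrow> (real^3) set set \<Rightarrow>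
     ((real^3) set \<Rightarrow> local_dofs \<Rightarrow> local_dofs \<Rightarrow> real) \<Rightarrow>
     real \<Rightarrow> real \<Rightarrow> (real^3 \<Rightarrow> real^3) \<Rightarrow> (real^3 \<Rightarrow> real^3) \<Rightarrow>
     global_dofs \<times> global_dofs \<times> (real^3 \<Rightarrow> real) \<times> (real^3 \<Rightarrow> real) \<Rightarrow> bool" where
  "solves_DP k \<Omega> \<T> \<F> s \<nu>\<^sub>k \<nu>\<^sub>m f g = (\<lambda>(u, b, q, r).
     (\<forall>v \<in> U_glob_0 k \<Omega> \<T> \<F>.
        \<nu>\<^sub>k * a_form k \<T> \<F> s u v + t_form k \<T> \<F> u u v - t_form k \<T> \<F> b b v
          + d_form k \<T> \<F> v q = L2_inner \<Omega> f (piecewise \<T> v)) \<and>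
     (\<forall>w \<in> U_glob_n k \<Omega> \<T> \<F>.
        \<nu>\<^sub>m * a_form k \<T> \<F> s b w + t_form k \<T> \<F> u b w - t_form k \<T> \<F> b u w
          + d_form k \<T> \<F> w r = L2_inner \<Omega> g (piecewise \<T> w)) \<and>
     (\<forall>p \<in> P_0 k \<Omega> \<T>. - d_form k \<T> \<F> u p = 0) \<and>
     (\<forall>z \<in> P_0 k \<Omega> \<T>. - d_form k \<T> \<F> b z = 0))"

end

theory Submission
  imports Defs "HOL-Library.Function_Algebras"
begin

text \<open>On one mesh the problem is finite-dimensional. Eliminate the pressures first: on the subspace
  of pairs \<open>x = (u, b)\<close> with vanishing discrete divergences, the two momentum equations read
  \<open>B x z + \<tau> x x z = L z\<close>, where \<open>B\<close> collects the two viscous terms and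
  \<open>\<tau> x y z = t(u, y\<^sub>1, z\<^sub>1) - t(b, y\<^sub>2, z\<^sub>1) + t(u, y\<^sub>2, z\<^sub>2) - t(b, y\<^sub>1, z\<^sub>2)\<close> the four convective
  ones. Since \<open>t\<close> is skew-symmetric in its last two arguments, the coupling terms cancel in
  pairs and \<open>\<tau> x y y = 0\<close>. For a frozen convecting pair \<open>x\<close> the problem is therefore linear and
  coercive with the constant \<open>\<nu> = min \<nu>\<^sub>k \<nu>\<^sub>m\<close>; let \<open>\<Phi> x\<close> be its solution. Testing with
  the solution bounds \<open>\<Phi> x\<close> by \<open>\<Lambda> / \<nu>\<close>, and testing the difference of two such problems
  with the difference of their solutions shows that \<open>\<Phi>\<close> is Lipschitz with the constant
  \<open>M * \<Lambda> / \<nu>\<^sup>2\<close>, where \<open>M\<close> bounds \<open>\<tau>\<close> and \<open>\<Lambda>\<close> bounds \<open>L\<close>. All this is measured in the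
  norm given by \<open>a\<^sub>h\<close> itself. It turns the assumed bounds into \<open>M = sqrt 2 * C\<^sub>t * (sqrt C\<^sub>a)^3\<close>
  and \<open>\<Lambda> = C\<^sub>p * sqrt C\<^sub>a * \<parallel>(f, g)\<parallel>\<close>, so that the smallness assumption says precisely that
  \<open>\<Phi>\<close> is a contraction. Its fixed points are the solutions: existence and uniqueness of
  \<open>(u, b)\<close> come together (\<open>skew_quadratic_solution\<close>).

  The residual of the momentum equations vanishes on the kernel of the constraints, hence it is
  the action of some multiplier, and the multiplier is unique if the pressure form has no kernel
  (\<open>multiplier_exists\<close>). Let then \<open>d(v, q) = 0\<close> for all \<open>v\<close> that vanish on the boundary. Taking
  for \<open>v\<close> the gradient of \<open>q\<close> in one element and \<open>0\<close> elsewhere makes \<open>q\<close> piecewise constant;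
  taking the normal on one interior face makes the values on both sides of that face equal. A
  connected domain is connected through the interior faces of its mesh (\<open>mesh_face_connected\<close>),
  so \<open>q\<close> is constant, and it is \<open>0\<close> because its mean is (\<open>pressure_determined\<close>).

  The geometric facts behind this hold pointwise. An element that is star-shaped with respect to a
  ball is a half space near each point of each of its faces, so its outer normal is constant on
  a face and opposite to that of the neighbour. The relative boundary of a face may have positive
  area, but it is nowhere dense in the plane of the face; this is enough to move a segment off it.

  The local operators are given as the unique objects with a certain property. They are Riesz
  representatives with respect to a definite form on a space of polynomials, which is why they
  exist and are linear (\<open>solution_operator_linear\<close>).\<close>

section \<open>Linear algebra on finite-dimensional subspaces\<close>

text \<open>With the pointwise structure on functions, all discrete spaces are subspaces of one real
  vector space each, whatever their dimension.\<close>

instantiation "fun" :: (type, real_vector) real_vector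
begin

definition scaleR_fun_def: "c *\<^sub>R f = (\<lambda>x. c *\<^sub>R f x)"

instance
  by standard (simp_all add: scaleR_fun_def fun_eq_iff algebra_simps)

end

lemma scaleR_fun_apply [simp]: "(c *\<^sub>R f) x = c *\<^sub>R f x"
  by (simp add: scaleR_fun_def)

lemma sum_fun_apply: "(\<Sum>i\<in>I. f i) x = (\<Sum>i\<in>I. f i x)"
  by (induction I rule: infinite_finite_induct) auto

text \<open>The spaces here live in function spaces, so the dimension theory of Euclidean spaces does not
  apply to them.\<close>

definition finite_dim :: "'a::real_vector set \<Rightarrow> bool" where
  "finite_dim V \<longleftrightarrow> (\<exists>S. finite S \<and> V \<subseteq> span S)"

definition lin_on :: "'a::real_vector set \<Rightarrow> ('a \<Rightarrow> real) \<Rightarrow> bool" where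
  "lin_on V L \<longleftrightarrow> (\<forall>x\<in>V. \<forall>y\<in>V. \<forall>c d. L (c *\<^sub>R x + d *\<^sub>R y) = c * L x + d * L y)"

definition bilinear_on ::
    "'a::real_vector set \<Rightarrow> 'b::real_vector set \<Rightarrow> ('a \<Rightarrow> 'b \<Rightarrow> real) \<Rightarrow> bool" where
  "bilinear_on V W B \<longleftrightarrow> (\<forall>y\<in>W. lin_on V (\<lambda>x. B x y)) \<and> (\<forall>x\<in>V. lin_on W (B x))"

lemma lin_on_comb: "lin_on V L \<Longrightarrow> x \<in> V \<Longrightarrow> y \<in> V \<Longrightarrow> L (c *\<^sub>R x + d *\<^sub>R y) = c * L x + d * L y"
  by (simp add: lin_on_def)

lemma lin_on_add: "lin_on V L \<Longrightarrow> x \<in> V \<Longrightarrow> y \<in> V \<Longrightarrow> L (x + y) = L x + L y"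
  using lin_on_comb[of V L x y 1 1] by simp

lemma lin_on_diff: "lin_on V L \<Longrightarrow> x \<in> V \<Longrightarrow> y \<in> V \<Longrightarrow> L (x - y) = L x - L y"
  using lin_on_comb[of V L x y 1 "-1"] by simp

lemma lin_on_scale: "lin_on V L \<Longrightarrow> x \<in> V \<Longrightarrow> L (c *\<^sub>R x) = c * L x"
  using lin_on_comb[of V L x x c 0] by simp

lemma lin_on_zero: "lin_on V L \<Longrightarrow> x \<in> V \<Longrightarrow> L 0 = 0"
  using lin_on_comb[of V L x x 0 0] by simp

lemma lin_on_mono: "lin_on V L \<Longrightarrow> W \<subseteq> V \<Longrightarrow> lin_on W L"
  unfolding lin_on_def by blast

lemma bilinear_onD1: "bilinear_on V W B \<Longrightarrow> y \<in> W \<Longrightarrow> lin_on V (\<lambda>x. B x y)"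
  and bilinear_onD2: "bilinear_on V W B \<Longrightarrow> x \<in> V \<Longrightarrow> lin_on W (B x)"
  by (simp_all add: bilinear_on_def)

lemma bilinear_on_mono:
  "bilinear_on V W B \<Longrightarrow> V' \<subseteq> V \<Longrightarrow> W' \<subseteq> W \<Longrightarrow> bilinear_on V' W' B"
  unfolding bilinear_on_def lin_on_def by blast

lemma lin_on_plus: "lin_on V L \<Longrightarrow> lin_on V M \<Longrightarrow> lin_on V (\<lambda>x. L x + M x)"
  and lin_on_minus: "lin_on V L \<Longrightarrow> lin_on V M \<Longrightarrow> lin_on V (\<lambda>x. L x - M x)"
  and lin_on_cmult: "lin_on V L \<Longrightarrow> lin_on V (\<lambda>x. a * L x)"
  and lin_on_uminus: "lin_on V L \<Longrightarrow> lin_on V (\<lambda>x. - L x)"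
  by (auto simp: lin_on_def algebra_simps)

lemma lin_on_sum: "(\<And>i. i \<in> I \<Longrightarrow> lin_on V (L i)) \<Longrightarrow> lin_on V (\<lambda>x. \<Sum>i\<in>I. L i x)"
  by (simp add: lin_on_def sum.distrib sum_distrib_left)

lemma finite_dim_mono: "finite_dim W \<Longrightarrow> V \<subseteq> W \<Longrightarrow> finite_dim V"
  unfolding finite_dim_def by blast

lemma finite_dim_linear_image:
  assumes "finite_dim W" "linear f"
  shows "finite_dim (f ` W)"
proof -
  obtain S where "finite S" "W \<subseteq> span S"
    using assms(1) by (auto simp: finite_dim_def)
  then have "finite (f ` S)" "f ` W \<subseteq> span (f ` S)"
    using assms(2) by (auto simp: linear_span_image)
  then show ?thesis
    unfolding finite_dim_def by blast
qed

lemma finite_dim_sum: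
  assumes "finite I" "\<And>i. i \<in> I \<Longrightarrow> finite_dim (W i)"
    and "\<And>v. v \<in> V \<Longrightarrow> \<exists>g. v = (\<Sum>i\<in>I. g i) \<and> (\<forall>i\<in>I. g i \<in> W i)"
  shows "finite_dim V"
proof -
  obtain S where S: "\<And>i. i \<in> I \<Longrightarrow> finite (S i) \<and> W i \<subseteq> span (S i)"
    using assms(2) unfolding finite_dim_def by metis
  have "V \<subseteq> span (\<Union>i\<in>I. S i)"
  proof
    fix v assume "v \<in> V"
    then obtain g where g: "v = (\<Sum>i\<in>I. g i)" "\<forall>i\<in>I. g i \<in> W i"
      using assms(3) by blast
    have "g i \<in> span (\<Union>i\<in>I. S i)" if "i \<in> I" for i
    proof -
      have "g i \<in> span (S i)" using that g(2) S by blast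
      then show ?thesis using span_mono[of "S i" "\<Union>i\<in>I. S i"] that by blast
    qed
    then show "v \<in> span (\<Union>i\<in>I. S i)"
      unfolding g(1) by (rule span_sum)
  qed
  then show ?thesis
    unfolding finite_dim_def using assms(1) S by blast
qed

lemma finite_dim_Times:
  assumes "finite_dim V" "finite_dim W"
  shows "finite_dim (V \<times> W)"
proof -
  have "linear (\<lambda>x. (x, 0))" "linear (\<lambda>x. (0, x))"
    by (auto intro!: linearI)
  then have *: "finite_dim ((\<lambda>x. (x, 0)) ` V)" "finite_dim ((\<lambda>x. (0, x)) ` W)"
    using assms by (auto intro: finite_dim_linear_image)
  show ?thesis
  proof (rule finite_dim_sum[of "UNIV :: bool set"
        "\<lambda>i. if i then (\<lambda>x. (x, 0)) ` V else (\<lambda>x. (0, x)) ` W"])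
    fix v assume "v \<in> V \<times> W"
    then obtain x y where v: "v = (x, y)" "x \<in> V" "y \<in> W" by auto
    show "\<exists>g. v = (\<Sum>i\<in>UNIV. g i) \<and>
        (\<forall>i\<in>UNIV. g i \<in> (if i then (\<lambda>x. (x, 0)) ` V else (\<lambda>x. (0, x)) ` W))"
      by (rule exI[of _ "\<lambda>i. if i then (x, 0) else (0, y)"]) (use v in \<open>auto simp: UNIV_bool\<close>)
  qed (use * in auto)
qed

lemma subspace_Times: "subspace V \<Longrightarrow> subspace W \<Longrightarrow> subspace (V \<times> W)"
  by (auto simp: subspace_def zero_prod_def)

lemma lin_on_fst: "lin_on V L \<Longrightarrow> lin_on (V \<times> W) (\<lambda>x. L (fst x))"
  and lin_on_snd: "lin_on W M \<Longrightarrow> lin_on (V \<times> W) (\<lambda>x. M (snd x))"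
  by (auto simp: lin_on_def)

text \<open>The degrees of freedom are families over the elements and over the faces; this is the dimension
  count for such a family.\<close>

lemma finite_dim_family:
  fixes W :: "'i \<Rightarrow> 'a::real_vector set"
  assumes "finite I" "\<And>i. i \<in> I \<Longrightarrow> finite_dim (W i)"
  shows "finite_dim {a. (\<forall>i\<in>I. a i \<in> W i) \<and> (\<forall>i. i \<notin> I \<longrightarrow> a i = 0)}"
proof (rule finite_dim_sum[OF assms(1)])
  show "finite_dim ((\<lambda>p j. if j = i then p else 0) ` W i)" if "i \<in> I" for i
    using assms(2)[OF that] by (intro finite_dim_linear_image linearI) (auto simp: fun_eq_iff)
  fix a assume a: "a \<in> {a. (\<forall>i\<in>I. a i \<in> W i) \<and> (\<forall>i. i \<notin> I \<longrightarrow> a i = 0)}"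
  have "a j = (\<Sum>i\<in>I. (if j = i then a i else 0))" for j
    using a assms(1) by (simp add: sum.delta')
  then have "a = (\<Sum>i\<in>I. (\<lambda>j. if j = i then a i else 0))"
    by (simp add: fun_eq_iff[of a] sum_fun_apply)
  moreover have "(\<lambda>j. if j = i then a i else 0) \<in> (\<lambda>p j. if j = i then p else 0) ` W i" if "i \<in> I" for i
    using a that by blast
  ultimately show "\<exists>g. a = (\<Sum>i\<in>I. g i) \<and> (\<forall>i\<in>I. g i \<in> (\<lambda>p j. if j = i then p else 0) ` W i)"
    by (intro exI[of _ "\<lambda>i j. if j = i then a i else 0"]) blast
qed

lemma finite_dim_eq_span:
  assumes "subspace V" "finite_dim V"
  shows "\<exists>S. finite S \<and> V = span S"
proof -
  obtain T where T: "finite T" "V \<subseteq> span T"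
    using assms(2) by (auto simp: finite_dim_def)
  obtain S where S: "S \<subseteq> V" "independent S" "V \<subseteq> span S"
    using basis_exists by metis
  have "finite S"
    using independent_span_bound[OF T(1) S(2)] S(1) T(2) by blast
  moreover have "V = span S"
    using S assms(1) span_minimal by blast
  ultimately show ?thesis by blast
qed

text \<open>Gaussian elimination, one spanning vector at a time. Subtracting from the new vector \<open>e\<close> its
  \<open>B\<close>-projection \<open>p\<close> onto the old span leaves a vector \<open>e'\<close> on which \<open>B\<close> does not vanish, and a
  multiple of \<open>e'\<close> corrects the old solution in the direction \<open>e\<close> alone.\<close>

lemma anisotropic_solvable_span:
  assumes "finite S" "bilinear_on (span S) (span S) B"
    and "\<And>y. y \<in> span S \<Longrightarrow> B y y = 0 \<Longrightarrow> y = 0"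
    and "lin_on (span S) L"
  shows "\<exists>y\<in>span S. \<forall>z\<in>span S. B y z = L z"
  using assms
proof (induction S arbitrary: L rule: finite_induct)
  case empty
  have "B 0 0 = L 0"
    using lin_on_zero[OF bilinear_onD2[OF empty(1)], of 0 0] lin_on_zero[OF empty(3), of 0] by simp
  then show ?case by simp
next
  case (insert e S)
  let ?W = "span (insert e S)"
  have sub: "span S \<subseteq> ?W"
    by (rule span_mono) auto
  have e: "e \<in> ?W"
    by (simp add: span_base)
  note bil = bilinear_on_mono[OF insert.prems(1) sub sub]
  have solve: "\<exists>y\<in>span S. \<forall>z\<in>span S. B y z = M z" if "lin_on (span S) M" for M
    by (rule insert.IH[OF bil _ that]) (use insert.prems(2) sub in blast)
  obtain p where p: "p \<in> span S" "\<And>z. z \<in> span S \<Longrightarrow> B p z = B e z"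
    using solve[of "B e"] lin_on_mono[OF bilinear_onD2[OF insert.prems(1) e] sub] by blast
  obtain y where y: "y \<in> span S" "\<And>z. z \<in> span S \<Longrightarrow> B y z = L z"
    using solve[of L] lin_on_mono[OF insert.prems(3) sub] by blast
  show ?case
  proof (cases "e \<in> span S")
    case True
    then have "?W = span S"
      by (simp add: span_redundant)
    then show ?thesis using y by auto
  next
    case False
    define e' where "e' = e - p"
    have e': "e' \<in> ?W" "e' \<noteq> 0"
      using e p(1) sub False by (auto simp: e'_def span_diff)
    note l1 = bilinear_onD1[OF insert.prems(1)] and l2 = bilinear_onD2[OF insert.prems(1)]
    have orth: "B e' z = 0" if "z \<in> span S" for z
      using lin_on_diff[OF l1, of z e p] that sub p e by (auto simp: e'_def)
    have "B e' e = B e' e'"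
      using lin_on_diff[OF l2[OF e'(1)], of e p] e p(1) sub orth[OF p(1)] by (auto simp: e'_def)
    then have ne: "B e' e \<noteq> 0"
      using insert.prems(2)[OF e'(1)] e'(2) by auto
    \<comment> \<open>The one remaining equation, \<open>B (y + c *\<^sub>R e') e = L e\<close>, determines \<open>c\<close>.\<close>
    define c where "c = (L e - B y e) / B e' e"
    have yW: "y \<in> ?W" using y(1) sub by blast
    have "B (y + c *\<^sub>R e') z = L z" if z: "z \<in> ?W" for z
    proof -
      obtain k where k: "z - k *\<^sub>R e \<in> span S"
        using z by (auto simp: span_breakdown_eq)
      define z' where "z' = z - k *\<^sub>R e"
      have z': "z' \<in> span S" "z' \<in> ?W" "z = 1 *\<^sub>R z' + k *\<^sub>R e"
        using k sub by (auto simp: z'_def)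
      have "B (y + c *\<^sub>R e') z = B y z + c * B e' z"
        using lin_on_comb[OF l1[OF z] yW e'(1), of 1 c] by simp
      also have "B y z = B y z' + k * B y e"
        using lin_on_comb[OF l2[OF yW] z'(2) e, of 1 k] by (simp add: z'_def)
      also have "B e' z = B e' z' + k * B e' e"
        using lin_on_comb[OF l2[OF e'(1)] z'(2) e, of 1 k] by (simp add: z'_def)
      also have "B y z' + k * B y e + c * (B e' z' + k * B e' e) = L z' + k * L e"
        using ne y(2)[OF z'(1)] orth[OF z'(1)] by (simp add: c_def field_simps)
      also have "\<dots> = L z"
        using lin_on_comb[OF insert.prems(3) z'(2) e, of 1 k] by (simp add: z'_def)
      finally show ?thesis .
    qed
    moreover have "y + c *\<^sub>R e' \<in> ?W"
      using yW e'(1) by (simp add: span_add span_scale)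
    ultimately show ?thesis by blast
  qed
qed

text \<open>The Lax--Milgram lemma in finite dimension.\<close>

lemma anisotropic_solvable:
  assumes "subspace V" "finite_dim V" "bilinear_on V V B"
    and aniso: "\<And>y. y \<in> V \<Longrightarrow> B y y = 0 \<Longrightarrow> y = 0"
    and "lin_on V L"
  shows "\<exists>!y. y \<in> V \<and> (\<forall>z\<in>V. B y z = L z)"
proof -
  obtain S where S: "finite S" "V = span S"
    using finite_dim_eq_span assms(1,2) by blast
  have "\<exists>y\<in>V. \<forall>z\<in>V. B y z = L z"
    using anisotropic_solvable_span[of S B L] S assms by simp
  moreover have "y = y'" if "y \<in> V" "\<forall>z\<in>V. B y z = L z" "y' \<in> V" "\<forall>z\<in>V. B y' z = L z" for y y'
  proof -
    have d: "y - y' \<in> V"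
      using that assms(1) by (simp add: subspace_diff)
    then have "B (y - y') (y - y') = 0"
      using lin_on_diff[OF bilinear_onD1[OF assms(3) d] that(1,3)] that by simp
    then show ?thesis using aniso[OF d] by simp
  qed
  ultimately show ?thesis by blast
qed

text \<open>Every operator that is defined by testing against a space \<open>V\<close> falls under this lemma; \<open>l\<close> is
  the right-hand side of its defining equation.\<close>

lemma solution_operator_linear:
  assumes V: "subspace V" "finite_dim V" "bilinear_on V V B"
    and aniso: "\<And>y. y \<in> V \<Longrightarrow> B y y = 0 \<Longrightarrow> y = 0"
    and U: "subspace U" and l: "bilinear_on U V l"
    and R: "\<And>v. v \<in> U \<Longrightarrow> R v = (THE r. r \<in> V \<and> (\<forall>z\<in>V. B r z = l v z))"
  shows "v \<in> U \<Longrightarrow> R v \<in> V"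
    and "v \<in> U \<Longrightarrow> z \<in> V \<Longrightarrow> B (R v) z = l v z"
    and "v \<in> U \<Longrightarrow> w \<in> U \<Longrightarrow> R (c *\<^sub>R v + d *\<^sub>R w) = c *\<^sub>R R v + d *\<^sub>R R w"
proof -
  have ex: "\<exists>!r. r \<in> V \<and> (\<forall>z\<in>V. B r z = l v z)" if "v \<in> U" for v
    by (rule anisotropic_solvable[OF V aniso bilinear_onD2[OF l that]])
  have spec: "R v \<in> V \<and> (\<forall>z\<in>V. B (R v) z = l v z)" if "v \<in> U" for v
    unfolding R[OF that] by (rule theI'[OF ex[OF that]])
  then show "v \<in> U \<Longrightarrow> R v \<in> V" "v \<in> U \<Longrightarrow> z \<in> V \<Longrightarrow> B (R v) z = l v z" by auto
  assume vw: "v \<in> U" "w \<in> U"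
  have comb: "c *\<^sub>R v + d *\<^sub>R w \<in> U" using vw U by (simp add: subspace_add subspace_scale)
  have in_V: "c *\<^sub>R R v + d *\<^sub>R R w \<in> V"
    using spec vw V(1) by (simp add: subspace_add subspace_scale)
  have "B (c *\<^sub>R R v + d *\<^sub>R R w) z = l (c *\<^sub>R v + d *\<^sub>R w) z" if "z \<in> V" for z
    using lin_on_comb[OF bilinear_onD1[OF V(3) that], of "R v" "R w" c d]
      lin_on_comb[OF bilinear_onD1[OF l that] vw, of c d] spec vw that by simp
  then show "R (c *\<^sub>R v + d *\<^sub>R w) = c *\<^sub>R R v + d *\<^sub>R R w"
    using ex[OF comb] spec[OF comb] in_V by blast
qed

section \<open>Finite-dimensional inner product spaces\<close>

text \<open>An inner product on a subspace that carries no norm of its own. The instances that matter are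
  the viscous form on the pairs of velocity and magnetic field, and its restriction to the
  divergence-free ones.\<close>

locale inner_product_on =
  fixes V :: "'a::real_vector set" and P :: "'a \<Rightarrow> 'a \<Rightarrow> real"
  assumes sub: "subspace V" and fin: "finite_dim V" and bil: "bilinear_on V V P"
    and sym: "\<And>x y. x \<in> V \<Longrightarrow> y \<in> V \<Longrightarrow> P x y = P y x"
    and pos: "\<And>x. x \<in> V \<Longrightarrow> x \<noteq> 0 \<Longrightarrow> P x x > 0"
begin

definition N :: "'a \<Rightarrow> real" where "N x = sqrt (P x x)"

lemma P_zero: "P 0 0 = 0"
  using lin_on_zero[OF bilinear_onD1[OF bil], of 0 0] sub by (simp add: subspace_0)

lemma nonneg: "x \<in> V \<Longrightarrow> P x x \<ge> 0"
  using pos[of x] P_zero by (cases "x = 0") auto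

lemma N_nonneg: "x \<in> V \<Longrightarrow> N x \<ge> 0"
  by (simp add: N_def nonneg)

lemma N_square: "x \<in> V \<Longrightarrow> (N x)\<^sup>2 = P x x"
  by (simp add: N_def nonneg)

lemma N_eq_0: "x \<in> V \<Longrightarrow> N x = 0 \<Longrightarrow> x = 0"
  using pos[of x] by (force simp: N_def)

lemma riesz: "lin_on V L \<Longrightarrow> \<exists>!y. y \<in> V \<and> (\<forall>z\<in>V. P y z = L z)"
  by (rule anisotropic_solvable[OF sub fin bil]) (use pos in force)

lemma Cauchy_Schwarz:
  assumes x: "x \<in> V" and y: "y \<in> V"
  shows "\<bar>P x y\<bar> \<le> N x * N y"
proof (cases "y = 0")
  case True
  then show ?thesis
    using lin_on_scale[OF bilinear_onD2[OF bil x] y, of 0] by (simp add: N_def P_zero)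
next
  case False
  \<comment> \<open>With this \<open>t\<close>, \<open>t *\<^sub>R y\<close> is the orthogonal projection of \<open>x\<close> onto \<open>y\<close>.\<close>
  define t where "t = P x y / P y y"
  have py: "P y y > 0" using pos y False by simp
  have w: "x - t *\<^sub>R y \<in> V" and ty: "t *\<^sub>R y \<in> V"
    using x y sub by (simp_all add: subspace_diff subspace_scale)
  have "0 \<le> P (x - t *\<^sub>R y) (x - t *\<^sub>R y)"
    by (rule nonneg[OF w])
  also have "\<dots> = P x (x - t *\<^sub>R y) - t * P y (x - t *\<^sub>R y)"
    using lin_on_diff[OF bilinear_onD1[OF bil w] x ty] lin_on_scale[OF bilinear_onD1[OF bil w] y]
    by simp
  also have "\<dots> = P x x - t * P x y - t * (P x y - t * P y y)"
    using lin_on_diff[OF bilinear_onD2[OF bil x] x ty] lin_on_scale[OF bilinear_onD2[OF bil x] y]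
      lin_on_diff[OF bilinear_onD2[OF bil y] x ty] lin_on_scale[OF bilinear_onD2[OF bil y] y]
      sym[OF x y]
    by simp
  also have "\<dots> = P x x - (P x y)\<^sup>2 / P y y"
    using py by (simp add: t_def field_simps power2_eq_square)
  finally have "(P x y)\<^sup>2 \<le> P x x * P y y"
    using py by (simp add: field_simps)
  then have "sqrt ((P x y)\<^sup>2) \<le> sqrt (P x x * P y y)"
    using real_sqrt_le_iff by blast
  then show ?thesis
    by (simp add: N_def real_sqrt_mult)
qed

lemma triangle:
  assumes x: "x \<in> V" and y: "y \<in> V"
  shows "N (x + y) \<le> N x + N y"
proof -
  have xy: "x + y \<in> V" using sub x y by (simp add: subspace_add)
  have "P (x + y) (x + y) = P x x + 2 * P x y + P y y"
    using lin_on_add[OF bilinear_onD1[OF bil xy] x y] lin_on_add[OF bilinear_onD2[OF bil x] x y]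
      lin_on_add[OF bilinear_onD2[OF bil y] x y] sym[OF x y] by simp
  then have "(N (x + y))\<^sup>2 \<le> (N x + N y)\<^sup>2"
    using Cauchy_Schwarz[OF x y] N_square[OF x] N_square[OF y] N_square[OF xy]
    by (simp add: power2_sum)
  then show ?thesis
    using N_nonneg x y by (meson add_nonneg_nonneg power2_le_imp_le)
qed

lemma N_minus_commute: "x \<in> V \<Longrightarrow> y \<in> V \<Longrightarrow> N (x - y) = N (y - x)"
proof -
  assume xy: "x \<in> V" "y \<in> V"
  then have d: "x - y \<in> V" and m: "(-1) *\<^sub>R (x - y) \<in> V"
    using sub by (simp_all add: subspace_diff subspace_neg)
  have "P ((-1) *\<^sub>R (x - y)) ((-1) *\<^sub>R (x - y)) = P (x - y) (x - y)"
    using lin_on_scale[OF bilinear_onD1[OF bil m] d, of "-1"] lin_on_scale[OF bilinear_onD2[OF bil d] d, of "-1"]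
    by simp
  then show ?thesis by (simp add: N_def)
qed

text \<open>A Cauchy sequence converges weakly, since its inner products with a fixed vector are Cauchy in
  \<open>\<real>\<close> and the Riesz lemma represents their limits by a vector \<open>x\<close>. The distance to \<open>x\<close> is
  then controlled by the Cauchy condition, because
  \<open>\<parallel>X\<^sub>n - x\<parallel>\<^sup>2 = lim\<^sub>m \<langle>X\<^sub>n - X\<^sub>m, X\<^sub>n - x\<rangle>\<close>. No basis has to be chosen.\<close>

lemma complete:
  assumes X: "\<And>n. X n \<in> V"
    and cauchy: "\<And>e. e > 0 \<Longrightarrow> \<exists>M. \<forall>m\<ge>M. \<forall>n\<ge>M. N (X m - X n) \<le> e"
  shows "\<exists>x\<in>V. (\<lambda>n. N (X n - x)) \<longlonglongrightarrow> 0"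
proof -
  have conv: "convergent (\<lambda>n. P (X n) z)" if z: "z \<in> V" for z
  proof -
    have "Cauchy (\<lambda>n. P (X n) z)"
    proof (rule metric_CauchyI)
      fix e :: real assume e: "e > 0"
      define K where "K = N z + 1"
      have K: "K > 0" "N z \<le> K"
        using N_nonneg[OF z] by (simp_all add: K_def)
      obtain M where M: "\<forall>m\<ge>M. \<forall>n\<ge>M. N (X m - X n) \<le> e / 2 / (K)"
        using cauchy[of "e / 2 / (K)"] e K by (auto simp: field_simps)
      have "dist (P (X m) z) (P (X n) z) < e" if mn: "m \<ge> M" "n \<ge> M" for m n
      proof -
        have d: "X m - X n \<in> V" using X sub by (simp add: subspace_diff)
        have "dist (P (X m) z) (P (X n) z) = \<bar>P (X m - X n) z\<bar>"
          using lin_on_diff[OF bilinear_onD1[OF bil z] X X] by (simp add: dist_real_def)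
        also have "\<dots> \<le> N (X m - X n) * N z"
          by (rule Cauchy_Schwarz[OF d z])
        also have "\<dots> \<le> e / 2 / (K) * (K)"
          using M mn N_nonneg[OF d] N_nonneg[OF z] e K by (intro mult_mono) auto
        also have "\<dots> = e / 2" using K by simp
        also have "\<dots> < e" using e by simp
        finally show ?thesis .
      qed
      then show "\<exists>M. \<forall>m\<ge>M. \<forall>n\<ge>M. dist (P (X m) z) (P (X n) z) < e" by blast
    qed
    then show ?thesis by (simp add: Cauchy_convergent_iff)
  qed
  define L where "L z = lim (\<lambda>n. P (X n) z)" for z
  have L: "(\<lambda>n. P (X n) z) \<longlonglongrightarrow> L z" if "z \<in> V" for z
    using conv[OF that] by (simp add: L_def convergent_LIMSEQ_iff)
  have "lin_on V L"
    unfolding lin_on_def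
  proof (intro ballI allI)
    fix y z :: 'a and c d :: real assume yz: "y \<in> V" "z \<in> V"
    then have w: "c *\<^sub>R y + d *\<^sub>R z \<in> V"
      using sub by (simp add: subspace_add subspace_scale)
    have "(\<lambda>n. P (X n) (c *\<^sub>R y + d *\<^sub>R z)) = (\<lambda>n. c * P (X n) y + d * P (X n) z)"
      using lin_on_comb[OF bilinear_onD2[OF bil X] yz] by simp
    moreover have "(\<lambda>n. c * P (X n) y + d * P (X n) z) \<longlonglongrightarrow> c * L y + d * L z"
      by (intro tendsto_intros L yz)
    ultimately show "L (c *\<^sub>R y + d *\<^sub>R z) = c * L y + d * L z"
      using L[OF w] LIMSEQ_unique by metis
  qed
  then obtain x where x: "x \<in> V" "\<And>z. z \<in> V \<Longrightarrow> P x z = L z"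
    using riesz by blast
  have close: "N (X n - x) \<le> e" if M: "\<forall>m\<ge>M. \<forall>n\<ge>M. N (X m - X n) \<le> e" and n: "n \<ge> M" for n M e
  proof (cases "N (X n - x) = 0")
    case True
    have "0 \<le> N (X n - X n)" using X sub by (intro N_nonneg) (simp add: subspace_0)
    then show ?thesis using M n True by force
  next
    case False
    have d: "X n - x \<in> V" using X x sub by (simp add: subspace_diff)
    have "(\<lambda>m. P (X n) (X n - x) - P (X m) (X n - x)) \<longlonglongrightarrow> P (X n) (X n - x) - P x (X n - x)"
      using x(2)[OF d] L[OF d] by (intro tendsto_intros) auto
    also have "P (X n) (X n - x) - P x (X n - x) = (N (X n - x))\<^sup>2"
      using lin_on_diff[OF bilinear_onD1[OF bil d] X x(1)] N_square[OF d] by simp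
    finally have lim: "(\<lambda>m. P (X n) (X n - x) - P (X m) (X n - x)) \<longlonglongrightarrow> (N (X n - x))\<^sup>2" .
    have "P (X n) (X n - x) - P (X m) (X n - x) \<le> e * N (X n - x)" if "m \<ge> M" for m
    proof -
      have d2: "X n - X m \<in> V" using X sub by (simp add: subspace_diff)
      have "P (X n) (X n - x) - P (X m) (X n - x) = P (X n - X m) (X n - x)"
        using lin_on_diff[OF bilinear_onD1[OF bil d] X X] by simp
      also have "\<dots> \<le> N (X n - X m) * N (X n - x)"
        using Cauchy_Schwarz[OF d2 d] by simp
      also have "\<dots> \<le> e * N (X n - x)"
        using M n that N_nonneg[OF d] by (intro mult_right_mono) auto
      finally show ?thesis .
    qed
    then have "(N (X n - x))\<^sup>2 \<le> e * N (X n - x)"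
      by (intro LIMSEQ_le_const2[OF lim]) blast
    moreover have "N (X n - x) > 0" using False N_nonneg[OF d] by simp
    ultimately show ?thesis by (simp add: power2_eq_square)
  qed
  have "(\<lambda>n. N (X n - x)) \<longlonglongrightarrow> 0"
  proof (rule LIMSEQ_I)
    fix r :: real assume "r > 0"
    then obtain M where M: "\<forall>m\<ge>M. \<forall>n\<ge>M. N (X m - X n) \<le> r / 2"
      using cauchy[of "r / 2"] by auto
    have "norm (N (X n - x) - 0) < r" if "n \<ge> M" for n
    proof -
      have "X n - x \<in> V" using X x sub by (simp add: subspace_diff)
      then show ?thesis using close[OF M that] N_nonneg \<open>r > 0\<close> by fastforce
    qed
    then show "\<exists>M. \<forall>n\<ge>M. norm (N (X n - x) - 0) < r" by blast
  qed
  then show ?thesis using x(1) by blast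
qed

text \<open>Banach's theorem for the norm \<open>N\<close>, by Picard iteration from \<open>0\<close>.\<close>

lemma contraction_fixed_point:
  assumes Phi: "\<And>x. x \<in> V \<Longrightarrow> \<Phi> x \<in> V"
    and c: "0 \<le> c" "c < 1"
    and contr: "\<And>x y. x \<in> V \<Longrightarrow> y \<in> V \<Longrightarrow> N (\<Phi> x - \<Phi> y) \<le> c * N (x - y)"
  shows "\<exists>!x. x \<in> V \<and> \<Phi> x = x"
proof -
  define X where "X n = (\<Phi> ^^ n) 0" for n
  have X: "X n \<in> V" for n
    by (induction n) (use sub Phi in \<open>auto simp: X_def subspace_0\<close>)
  have dV: "x - y \<in> V" if "x \<in> V" "y \<in> V" for x y
    using sub that by (simp add: subspace_diff)
  define D where "D = N (X 1 - X 0)"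
  have D0: "D \<ge> 0" by (simp add: D_def N_nonneg dV X)
  have step: "N (X (Suc n) - X n) \<le> D * c ^ n" for n
  proof (induction n)
    case (Suc n)
    have "N (X (Suc (Suc n)) - X (Suc n)) \<le> c * N (X (Suc n) - X n)"
      using contr[OF X X, of "Suc n" n] by (simp add: X_def)
    also have "\<dots> \<le> c * (D * c ^ n)" using Suc c by (intro mult_left_mono)
    finally show ?case by (simp add: algebra_simps)
  qed (simp add: D_def)
  have tail: "N (X (n + j) - X n) \<le> D * c ^ n / (1 - c)" for n j
  proof -
    have "N (X (n + j) - X n) \<le> (\<Sum>i<j. D * c ^ (n + i))"
    proof (induction j)
      case 0
      then show ?case by (simp add: N_def P_zero)
    next
      case (Suc j)
      have "X (n + Suc j) - X n = (X (Suc (n + j)) - X (n + j)) + (X (n + j) - X n)" by simp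
      then have "N (X (n + Suc j) - X n) \<le> N (X (Suc (n + j)) - X (n + j)) + N (X (n + j) - X n)"
        using triangle[OF dV[OF X X] dV[OF X X]] by metis
      then show ?case using step[of "n + j"] Suc by simp
    qed
    also have "\<dots> = D * c ^ n * (\<Sum>i<j. c ^ i)"
      by (simp add: sum_distrib_left power_add mult.assoc)
    also have "(\<Sum>i<j. c ^ i) \<le> 1 / (1 - c)"
      using c by (simp add: sum_gp_strict divide_right_mono)
    finally show ?thesis using D0 c by (simp add: mult_left_mono)
  qed
  have "\<exists>M. \<forall>m\<ge>M. \<forall>n\<ge>M. N (X m - X n) \<le> e" if e: "e > 0" for e
  proof -
    have "(\<lambda>n. D * c ^ n / (1 - c)) \<longlonglongrightarrow> D * 0 / (1 - c)"
      using c by (intro tendsto_intros LIMSEQ_realpow_zero) auto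
    from order_tendstoD(2)[OF this, of e] e
    obtain M where M: "\<And>n. n \<ge> M \<Longrightarrow> D * c ^ n / (1 - c) < e"
      unfolding eventually_sequentially by auto
    have *: "N (X m - X n) \<le> e" if "M \<le> n" "n \<le> m" for m n
      using tail[of n "m - n"] M[OF that(1)] that by force
    have "N (X m - X n) \<le> e" if "m \<ge> M" "n \<ge> M" for m n
      using *[of m n] *[of n m] that N_minus_commute[OF X X, of m n] by linarith
    then show ?thesis by blast
  qed
  then obtain x where x: "x \<in> V" and lim: "(\<lambda>n. N (X n - x)) \<longlonglongrightarrow> 0"
    using complete[of X] X by blast
  have "N (\<Phi> x - x) \<le> 0"
  proof (rule LIMSEQ_le_const)
    show "(\<lambda>n. c * N (X n - x) + N (X (Suc n) - x)) \<longlonglongrightarrow> 0"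
      using tendsto_add[OF tendsto_mult_left[OF lim, of c] LIMSEQ_Suc[OF lim]] by simp
    have "N (\<Phi> x - x) \<le> c * N (X n - x) + N (X (Suc n) - x)" for n
    proof -
      have s: "X (Suc n) = \<Phi> (X n)" by (simp add: X_def)
      have "N (\<Phi> x - x) = N ((\<Phi> x - \<Phi> (X n)) + (X (Suc n) - x))"
        by (simp add: s)
      also have "\<dots> \<le> N (\<Phi> x - \<Phi> (X n)) + N (X (Suc n) - x)"
        by (rule triangle) (auto intro!: dV Phi X x)
      also have "N (\<Phi> x - \<Phi> (X n)) \<le> c * N (x - X n)"
        by (rule contr[OF x X])
      finally show ?thesis using N_minus_commute[OF x X] by simp
    qed
    then show "\<exists>M. \<forall>n\<ge>M. N (\<Phi> x - x) \<le> c * N (X n - x) + N (X (Suc n) - x)" by blast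
  qed
  then have fp: "\<Phi> x = x"
    using N_eq_0[OF dV[OF Phi[OF x] x]] N_nonneg[OF dV[OF Phi[OF x] x]] by auto
  moreover have "y = x" if y: "y \<in> V" "\<Phi> y = y" for y
  proof -
    have "N (y - x) \<le> c * N (y - x)" using contr[OF y(1) x] y fp by simp
    then have "(1 - c) * N (y - x) \<le> 0" by (simp add: algebra_simps)
    then have "N (y - x) = 0"
      using N_nonneg[OF dV[OF y(1) x]] c(2) by (simp add: mult_le_0_iff)
    then show ?thesis using N_eq_0[OF dV[OF y(1) x]] by simp
  qed
  ultimately show ?thesis using x by blast
qed

text \<open>The fixed point argument for the stationary Navier--Stokes structure. Skewness makes the
  problem linearised at an arbitrary \<open>x\<close> as coercive as its linear part. So \<open>\<Phi>\<close> is defined and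
  bounded on all of \<open>V\<close>, and the contraction estimate is not restricted to a ball.\<close>

lemma skew_quadratic_solution:
  assumes B: "bilinear_on V V B" and nu: "\<nu> > 0"
    and coer: "\<And>x. x \<in> V \<Longrightarrow> \<nu> * P x x \<le> B x x"
    and t_bil: "\<And>x. x \<in> V \<Longrightarrow> bilinear_on V V (\<tau> x)"
    and t_lin: "\<And>y z. y \<in> V \<Longrightarrow> z \<in> V \<Longrightarrow> lin_on V (\<lambda>x. \<tau> x y z)"
    and skew: "\<And>x y. x \<in> V \<Longrightarrow> y \<in> V \<Longrightarrow> \<tau> x y y = 0"
    and t_bound: "\<And>x y z. x \<in> V \<Longrightarrow> y \<in> V \<Longrightarrow> z \<in> V \<Longrightarrow> \<bar>\<tau> x y z\<bar> \<le> M * N x * N y * N z"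
    and L: "lin_on V L" and L_bound: "\<And>z. z \<in> V \<Longrightarrow> \<bar>L z\<bar> \<le> \<Lambda> * N z"
    and M: "M \<ge> 0" and Lam: "\<Lambda> \<ge> 0" and chi: "0 \<le> c" "c < 1" and small: "M * \<Lambda> \<le> c * \<nu>\<^sup>2"
  shows "\<exists>!x. x \<in> V \<and> (\<forall>z\<in>V. B x z + \<tau> x x z = L z)"
proof -
  have ex: "\<exists>!y. y \<in> V \<and> (\<forall>z\<in>V. B y z + \<tau> x y z = L z)" if x: "x \<in> V" for x
  proof (rule anisotropic_solvable[OF sub fin _ _ L])
    show "bilinear_on V V (\<lambda>y z. B y z + \<tau> x y z)"
      using B t_bil[OF x] by (auto simp: bilinear_on_def intro!: lin_on_plus)
    show "y = 0" if "y \<in> V" "B y y + \<tau> x y y = 0" for y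
    proof (rule ccontr)
      assume "y \<noteq> 0"
      then have "0 < \<nu> * P y y" using pos[OF that(1)] nu by simp
      then show False using coer[OF that(1)] that(2) skew[OF x that(1)] by simp
    qed
  qed
  define \<Phi> where "\<Phi> x = (THE y. y \<in> V \<and> (\<forall>z\<in>V. B y z + \<tau> x y z = L z))" for x
  have Phi: "\<Phi> x \<in> V" "\<And>z. z \<in> V \<Longrightarrow> B (\<Phi> x) z + \<tau> x (\<Phi> x) z = L z" if "x \<in> V" for x
    using theI'[OF ex[OF that], folded \<Phi>_def] by auto
  have Phi_iff: "\<Phi> x = x \<longleftrightarrow> (\<forall>z\<in>V. B x z + \<tau> x x z = L z)" if "x \<in> V" for x
    using Phi[OF that] ex[OF that] that by metis
  have bound: "N (\<Phi> x) * \<nu> \<le> \<Lambda>" if x: "x \<in> V" for x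
  proof (cases "N (\<Phi> x) = 0")
    case True
    then show ?thesis using Lam by simp
  next
    case False
    then have pos: "N (\<Phi> x) > 0" using N_nonneg[OF Phi(1)[OF x]] by simp
    have "\<nu> * (N (\<Phi> x))\<^sup>2 \<le> B (\<Phi> x) (\<Phi> x)"
      using coer[OF Phi(1)[OF x]] N_square[OF Phi(1)[OF x]] by simp
    also have "\<dots> = L (\<Phi> x)"
      using Phi(2)[OF x Phi(1)[OF x]] skew[OF x Phi(1)[OF x]] by simp
    also have "\<dots> \<le> \<Lambda> * N (\<Phi> x)"
      using L_bound[OF Phi(1)[OF x]] by simp
    finally have "(N (\<Phi> x) * \<nu>) * N (\<Phi> x) \<le> \<Lambda> * N (\<Phi> x)" by (simp add: power2_eq_square algebra_simps)
    then show ?thesis using pos by (simp add: mult.commute)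
  qed
  have "N (\<Phi> x - \<Phi> x') \<le> c * N (x - x')" if x: "x \<in> V" "x' \<in> V" for x x'
  proof -
    define y y' d where "y = \<Phi> x" and "y' = \<Phi> x'" and "d = \<Phi> x - \<Phi> x'"
    have V: "y \<in> V" "y' \<in> V" "d \<in> V" "x - x' \<in> V"
      using Phi(1) x sub by (auto simp: y_def y'_def d_def subspace_diff)
    \<comment> \<open>The difference of the two linearised equations, with the convective term split as
      \<open>\<tau> x y - \<tau> x' y' = \<tau> x (y - y') + \<tau> (x - x') y'\<close>.\<close>
    have "B d d + \<tau> x d d + \<tau> (x - x') y' d = 0"
    proof -
      have "B d d = B y d - B y' d"
        using lin_on_diff[OF bilinear_onD1[OF B V(3)] V(1,2)] by (simp add: d_def y_def y'_def)
      moreover have "\<tau> x d d = \<tau> x y d - \<tau> x y' d"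
        using lin_on_diff[OF bilinear_onD1[OF t_bil[OF x(1)] V(3)] V(1,2)] by (simp add: d_def y_def y'_def)
      moreover have "\<tau> (x - x') y' d = \<tau> x y' d - \<tau> x' y' d"
        using lin_on_diff[OF t_lin[OF V(2,3)] x] .
      ultimately show ?thesis
        using Phi(2)[OF x(1) V(3)] Phi(2)[OF x(2) V(3)] by (simp add: y_def y'_def)
    qed
    then have "\<nu> * (N d)\<^sup>2 \<le> \<bar>\<tau> (x - x') y' d\<bar>"
      using coer[OF V(3)] skew[OF x(1) V(3)] N_square[OF V(3)] by simp
    also have "\<dots> \<le> M * N (x - x') * N y' * N d"
      by (rule t_bound[OF V(4,2,3)])
    finally have "\<nu> * (\<nu> * (N d)\<^sup>2) \<le> \<nu> * (M * N (x - x') * N y' * N d)"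
      using nu by (intro mult_left_mono) auto
    also have "\<dots> = (M * N (x - x') * N d) * (N y' * \<nu>)" by simp
    also have "\<dots> \<le> (M * N (x - x') * N d) * \<Lambda>"
      using bound[OF x(2)] M N_nonneg V by (intro mult_left_mono) (auto simp: y'_def)
    also have "\<dots> = (M * \<Lambda>) * (N (x - x') * N d)" by simp
    also have "\<dots> \<le> (c * \<nu>\<^sup>2) * (N (x - x') * N d)"
      using small N_nonneg V by (intro mult_right_mono) auto
    finally have "\<nu>\<^sup>2 * (N d * N d) \<le> \<nu>\<^sup>2 * (c * N (x - x') * N d)"
      by (simp add: power2_eq_square algebra_simps)
    then have *: "N d * N d \<le> c * N (x - x') * N d"
      using nu by (simp add: mult_le_cancel_left_pos)
    show ?thesis
    proof (cases "N d = 0")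
      case True
      then show ?thesis using chi N_nonneg[OF V(4)] by (simp add: d_def)
    next
      case False
      then show ?thesis using * N_nonneg[OF V(3)] by (simp add: d_def)
    qed
  qed
  then have "\<exists>!x. x \<in> V \<and> \<Phi> x = x"
    by (intro contraction_fixed_point[OF Phi(1) chi])
  then show ?thesis using Phi_iff by (simp cong: conj_cong)
qed

text \<open>The closed range theorem in finite dimension. With \<open>\<delta> q\<close> the Riesz representative of
  \<open>D(\<cdot>, q)\<close> and \<open>\<rho>\<close> that of \<open>R\<close>, project \<open>\<rho>\<close> orthogonally onto the range of \<open>\<delta>\<close>. Injectivity of \<open>\<delta>\<close> makes the normal equations for this projection solvable in \<open>Q\<close>. The
  difference is orthogonal to the range, that is, in the kernel of all constraints, where \<open>R\<close>
  vanishes; so the difference is orthogonal to \<open>\<rho>\<close> as well and must be \<open>0\<close>.\<close>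

lemma multiplier_exists:
  assumes Q: "subspace Q" "finite_dim Q" and D: "bilinear_on V Q D"
    and inj: "\<And>q. q \<in> Q \<Longrightarrow> (\<And>v. v \<in> V \<Longrightarrow> D v q = 0) \<Longrightarrow> q = 0"
    and R: "lin_on V R" and kernel: "\<And>v. v \<in> V \<Longrightarrow> (\<And>q. q \<in> Q \<Longrightarrow> D v q = 0) \<Longrightarrow> R v = 0"
  shows "\<exists>!q. q \<in> Q \<and> (\<forall>v\<in>V. D v q = R v)"
proof -
  have "\<forall>q\<in>Q. \<exists>y\<in>V. \<forall>v\<in>V. P y v = D v q"
    using riesz bilinear_onD1[OF D] by blast
  then obtain \<delta> where delta: "\<And>q. q \<in> Q \<Longrightarrow> \<delta> q \<in> V" "\<And>q v. q \<in> Q \<Longrightarrow> v \<in> V \<Longrightarrow> P (\<delta> q) v = D v q"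
    by metis
  obtain \<rho> where rho: "\<rho> \<in> V" "\<And>v. v \<in> V \<Longrightarrow> P \<rho> v = R v"
    using riesz[OF R] by blast
  have Pd: "P x (\<delta> q) = D x q" if "x \<in> V" "q \<in> Q" for x q
    using delta that sym by metis
  have "\<exists>!q. q \<in> Q \<and> (\<forall>q'\<in>Q. D (\<delta> q) q' = D \<rho> q')"
  proof (rule anisotropic_solvable[OF Q, where B = "\<lambda>q q'. D (\<delta> q) q'"])
    show "bilinear_on Q Q (\<lambda>q q'. D (\<delta> q) q')"
      unfolding bilinear_on_def
    proof (intro conjI ballI)
      fix q assume q: "q \<in> Q"
      then show "lin_on Q (D (\<delta> q))" using D delta by (simp add: bilinear_on_def)
      have "D (\<delta> p) q = D (\<delta> q) p" if "p \<in> Q" for p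
        using Pd delta q that sym by metis
      then show "lin_on Q (\<lambda>p. D (\<delta> p) q)"
        using bilinear_onD2[OF D delta(1)[OF q]] Q(1)
        by (simp add: lin_on_def subspace_add subspace_scale)
    qed
    show "q = 0" if q: "q \<in> Q" "D (\<delta> q) q = 0" for q
    proof (rule inj[OF q(1)])
      have "P (\<delta> q) (\<delta> q) = 0" using Pd delta q by simp
      then have "\<delta> q = 0" using pos delta(1)[OF q(1)] by force
      then show "D v q = 0" if "v \<in> V" for v
        using delta(2)[OF q(1) that] lin_on_zero[OF bilinear_onD1[OF bil that] that] by simp
    qed
    show "lin_on Q (D \<rho>)" using D rho by (simp add: bilinear_on_def)
  qed
  then obtain q where q: "q \<in> Q" "\<And>q'. q' \<in> Q \<Longrightarrow> D (\<delta> q) q' = D \<rho> q'" by blast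
  define e where "e = \<rho> - \<delta> q"
  have e: "e \<in> V" using rho delta q sub by (simp add: e_def subspace_diff)
  have ker: "D e q' = 0" if "q' \<in> Q" for q'
    using lin_on_diff[OF bilinear_onD1[OF D that] rho(1) delta(1)[OF q(1)]] q(2)[OF that]
    by (simp add: e_def)
  have "P e e = R e - D e q"
    using lin_on_diff[OF bilinear_onD1[OF bil e] rho(1) delta(1)[OF q(1)]] rho(2)[OF e] delta(2)[OF q(1) e]
    by (simp add: e_def)
  then have "P e e = 0" using kernel[OF e ker] ker[OF q(1)] by simp
  then have "e = 0" using pos[OF e] by force
  then have "D v q = R v" if "v \<in> V" for v
    using delta(2)[OF q(1) that] rho(2)[OF that] by (simp add: e_def)
  moreover have "p = q" if p: "p \<in> Q" "\<forall>v\<in>V. D v p = R v" for p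
  proof -
    have "p - q \<in> Q" using Q p q by (simp add: subspace_diff)
    then have "p - q = 0"
      using lin_on_diff[OF bilinear_onD2[OF D] p(1) q(1)] p(2) calculation
      by (intro inj) auto
    then show ?thesis by simp
  qed
  ultimately show ?thesis using q(1) by blast
qed

text \<open>Solve on the kernel of the constraints, then recover the multiplier from the residual.\<close>

theorem mixed_skew_quadratic_solution:
  assumes B: "bilinear_on V V B" and nu: "\<nu> > 0"
    and coer: "\<And>x. x \<in> V \<Longrightarrow> \<nu> * P x x \<le> B x x"
    and t_bil: "\<And>x. x \<in> V \<Longrightarrow> bilinear_on V V (\<tau> x)"
    and t_lin: "\<And>y z. y \<in> V \<Longrightarrow> z \<in> V \<Longrightarrow> lin_on V (\<lambda>x. \<tau> x y z)"
    and skew: "\<And>x y. x \<in> V \<Longrightarrow> y \<in> V \<Longrightarrow> \<tau> x y y = 0"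
    and t_bound: "\<And>x y z. x \<in> V \<Longrightarrow> y \<in> V \<Longrightarrow> z \<in> V \<Longrightarrow> \<bar>\<tau> x y z\<bar> \<le> M * N x * N y * N z"
    and L: "lin_on V L" and L_bound: "\<And>z. z \<in> V \<Longrightarrow> \<bar>L z\<bar> \<le> \<Lambda> * N z"
    and M: "M \<ge> 0" and Lam: "\<Lambda> \<ge> 0" and chi: "0 \<le> c" "c < 1" and small: "M * \<Lambda> \<le> c * \<nu>\<^sup>2"
    and Q: "subspace Q" "finite_dim Q" and D: "bilinear_on V Q D"
    and inj: "\<And>q. q \<in> Q \<Longrightarrow> (\<And>v. v \<in> V \<Longrightarrow> D v q = 0) \<Longrightarrow> q = 0"
  shows "\<exists>!(x, q). x \<in> V \<and> q \<in> Q \<and> (\<forall>v\<in>V. B x v + \<tau> x x v + D v q = L v) \<and> (\<forall>p\<in>Q. D x p = 0)"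
proof -
  define Z where "Z = {v \<in> V. \<forall>q\<in>Q. D v q = 0}"
  have ZV: "Z \<subseteq> V" by (auto simp: Z_def)
  have "subspace Z"
    unfolding subspace_def Z_def
    using sub lin_on_zero[OF bilinear_onD1[OF D] subspace_0[OF sub]] lin_on_add[OF bilinear_onD1[OF D]]
      lin_on_scale[OF bilinear_onD1[OF D]]
    by (auto simp: subspace_0 subspace_add subspace_scale)
  then interpret Z: inner_product_on Z P
    using finite_dim_mono[OF fin ZV] bilinear_on_mono[OF bil ZV ZV] sym pos ZV
    by unfold_locales auto
  have Zsol: "\<exists>!x. x \<in> Z \<and> (\<forall>z\<in>Z. B x z + \<tau> x x z = L z)"
  proof (rule Z.skew_quadratic_solution[where B = B and \<tau> = \<tau> and L = L and \<nu> = \<nu> and M = M and \<Lambda> = \<Lambda> and c = c])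
    show "\<bar>\<tau> x y z\<bar> \<le> M * N x * N y * N z" if "x \<in> Z" "y \<in> Z" "z \<in> Z" for x y z
      by (intro t_bound subsetD[OF ZV] that)
    show "\<bar>L z\<bar> \<le> \<Lambda> * N z" if "z \<in> Z" for z
      by (intro L_bound subsetD[OF ZV] that)
    show "bilinear_on Z Z (\<tau> x)" if "x \<in> Z" for x
      by (intro bilinear_on_mono[OF t_bil ZV ZV] subsetD[OF ZV] that)
    show "lin_on Z (\<lambda>x. \<tau> x y z)" if "y \<in> Z" "z \<in> Z" for y z
      by (intro lin_on_mono[OF t_lin ZV] subsetD[OF ZV] that)
    show "bilinear_on Z Z B" "lin_on Z L"
      using bilinear_on_mono[OF B ZV ZV] lin_on_mono[OF L ZV] by auto
    show "\<nu> * P x x \<le> B x x" if "x \<in> Z" for x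
      by (intro coer subsetD[OF ZV] that)
    show "\<tau> x y y = 0" if "x \<in> Z" "y \<in> Z" for x y
      by (intro skew subsetD[OF ZV] that)
  qed (fact nu M Lam chi small)+
  have mult: "\<exists>!q. q \<in> Q \<and> (\<forall>v\<in>V. D v q = L v - B x v - \<tau> x x v)"
    if x: "x \<in> Z" "\<forall>z\<in>Z. B x z + \<tau> x x z = L z" for x
  proof (rule multiplier_exists[OF Q D])
    show "q = 0" if "q \<in> Q" "\<And>v. v \<in> V \<Longrightarrow> D v q = 0" for q
      by (rule inj[OF that])
    have "x \<in> V" using x ZV by blast
    then show "lin_on V (\<lambda>v. L v - B x v - \<tau> x x v)"
      using L B t_bil by (intro lin_on_minus) (auto simp: bilinear_on_def)
    show "L v - B x v - \<tau> x x v = 0" if "v \<in> V" "\<And>q. q \<in> Q \<Longrightarrow> D v q = 0" for v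
    proof -
      have "v \<in> Z" using that by (simp add: Z_def)
      then show ?thesis using x(2) by (simp add: algebra_simps)
    qed
  qed
  obtain x where x: "x \<in> Z" "\<forall>z\<in>Z. B x z + \<tau> x x z = L z" using Zsol by blast
  obtain q where q: "q \<in> Q" "\<forall>v\<in>V. D v q = L v - B x v - \<tau> x x v" using mult[OF x] by blast
  show ?thesis
  proof (rule ex1I[of _ "(x, q)"])
    have "B x v + \<tau> x x v + D v q = L v" if "v \<in> V" for v
      using q(2) that by simp
    then show "case (x, q) of (x, q) \<Rightarrow>
        x \<in> V \<and> q \<in> Q \<and> (\<forall>v\<in>V. B x v + \<tau> x x v + D v q = L v) \<and> (\<forall>p\<in>Q. D x p = 0)"
      using x(1) q(1) by (simp add: Z_def)
    fix yp assume *: "case yp of (x, q) \<Rightarrow>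
        x \<in> V \<and> q \<in> Q \<and> (\<forall>v\<in>V. B x v + \<tau> x x v + D v q = L v) \<and> (\<forall>p\<in>Q. D x p = 0)"
    obtain y p where [simp]: "yp = (y, p)" by fastforce
    have yp: "y \<in> V" "p \<in> Q" "\<And>v. v \<in> V \<Longrightarrow> B y v + \<tau> y y v + D v p = L v" "\<forall>p\<in>Q. D y p = 0"
      using * by auto
    have y: "y \<in> Z" using yp by (simp add: Z_def)
    moreover have "B y z + \<tau> y y z = L z" if "z \<in> Z" for z
      using yp(3)[of z] that yp(2) by (simp add: Z_def)
    ultimately have [simp]: "y = x" using Zsol x by blast
    have "D v p = L v - B x v - \<tau> x x v" if "v \<in> V" for v
      using yp(3)[OF that] by simp
    then have "p = q" using mult[OF x] q yp(2) by blast
    then show "yp = (x, q)" by simp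
  qed
qed

end

section \<open>Elements, faces and normals\<close>

lemma open_polyhedron_open: "open_polyhedron P \<Longrightarrow> open P"
  by (auto simp: open_polyhedron_def)

lemma open_polyhedron_nonempty: "open_polyhedron P \<Longrightarrow> P \<noteq> {}"
  by (simp add: open_polyhedron_def)

text \<open>The interior of a closed set is a regular open set. This excludes slits, and it is what puts
  the elements inside \<open>\<Omega>\<close> rather than merely inside its closure.\<close>

lemma open_polyhedron_interior_closure:
  assumes "open_polyhedron P"
  shows "interior (closure P) \<subseteq> P"
proof -
  obtain \<Q> where Q: "finite \<Q>" "\<forall>Q\<in>\<Q>. polytope Q" "P = interior (\<Union>\<Q>)"
    using assms by (auto simp: open_polyhedron_def)
  have "closed (\<Union>\<Q>)"
    using Q by (intro closed_Union) (auto intro: compact_imp_closed polytope_imp_compact)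
  then have "closure P \<subseteq> \<Union>\<Q>"
    using Q(3) by (simp add: closure_minimal interior_subset)
  then show ?thesis
    unfolding Q(3) by (rule interior_mono)
qed

lemma mesh_element_subset:
  assumes "polyhedral_lipschitz_domain \<Omega>" "polyhedral_mesh \<Omega> \<T> \<F>" "T \<in> \<T>"
  shows "T \<subseteq> \<Omega>"
proof -
  have "T \<subseteq> closure \<Omega>"
    using assms(2,3) closure_subset[of T] by (auto simp: polyhedral_mesh_def)
  moreover have "open T"
    using assms(2,3) by (auto simp: polyhedral_mesh_def open_polyhedron_open)
  ultimately have "T \<subseteq> interior (closure \<Omega>)"
    by (simp add: interior_maximal)
  then show ?thesis
    using open_polyhedron_interior_closure[of \<Omega>] assms(1)
    by (auto simp: polyhedral_lipschitz_domain_def)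
qed

lemma diameter_open_pos:
  fixes T :: "(real^3) set"
  assumes "open T" "T \<noteq> {}" "bounded T"
  shows "diameter T > 0"
proof -
  obtain x e where x: "x \<in> T" "e > 0" "ball x e \<subseteq> T"
    using assms by (meson all_not_in_conv openE)
  obtain y where y: "y \<in> ball x e" "y \<noteq> x"
  proof
    have "norm (axis 1 1 :: real^3) = 1" by simp
    then show "x + (e / 2) *\<^sub>R axis 1 1 \<in> ball x e" "x + (e / 2) *\<^sub>R axis 1 1 \<noteq> x"
      using x(2) by (auto simp: dist_norm axis_eq_0_iff)
  qed
  then have "dist x y \<le> diameter T"
    using x assms(3) by (intro diameter_bounded_bound) auto
  then show ?thesis using y(2) by (metis dist_pos_lt order_less_le_trans)
qed

text \<open>Star-shapedness reaches boundary points \<open>x\<close>: replacing \<open>x\<close> by a nearby \<open>x'\<close> in \<open>T\<close> and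
  shifting \<open>y\<close> within the ball by the amount that compensates for it leads to the same point of the
  segment.\<close>

lemma star_shaped_closure:
  assumes star: "star_shaped_wrt_ball T c r" and x: "x \<in> closure T" and y: "y \<in> ball c r"
    and t: "0 < t" "t \<le> 1"
  shows "x + t *\<^sub>R (y - x) \<in> T"
proof -
  obtain d where d: "d > 0" "ball y d \<subseteq> ball c r"
    using y open_ball by (meson openE)
  define \<delta> where "\<delta> = t * d"
  have "\<delta> > 0" using t d by (simp add: \<delta>_def)
  then obtain x' where x': "x' \<in> T" "dist x' x < \<delta>"
    using x by (meson closure_approachable)
  \<comment> \<open>With this choice \<open>(1 - t) *\<^sub>R x' + t *\<^sub>R y' = (1 - t) *\<^sub>R x + t *\<^sub>R y\<close>.\<close>
  define y' where "y' = y + ((1 - t) / t) *\<^sub>R (x - x')"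
  have "dist y y' = (1 - t) / t * dist x' x"
    using t by (simp add: y'_def dist_norm norm_minus_commute)
  also have "\<dots> \<le> 1 / t * dist x' x"
    using t by (intro mult_right_mono) (auto simp: divide_right_mono)
  also have "\<dots> < d"
    using x' t by (simp add: \<delta>_def field_simps)
  finally have "y' \<in> ball c r" using d by auto
  then have "closed_segment y' x' \<subseteq> T"
    using star x' by (auto simp: star_shaped_wrt_ball_def)
  moreover have "x + t *\<^sub>R (y - x) = (1 - (1 - t)) *\<^sub>R y' + (1 - t) *\<^sub>R x'"
  proof -
    have "t *\<^sub>R y' = t *\<^sub>R y + (1 - t) *\<^sub>R (x - x')"
      using t by (simp add: y'_def scaleR_add_right)
    then show ?thesis by (simp add: algebra_simps)
  qed
  then have "x + t *\<^sub>R (y - x) \<in> closed_segment y' x'"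
    unfolding closed_segment_def using t by (intro CollectI exI[of _ "1 - t"]) auto
  ultimately show ?thesis by blast
qed

text \<open>The condition under which \<open>outer_normal\<close> is well-defined.\<close>

definition half_space_near :: "(real^3) set \<Rightarrow> real^3 \<Rightarrow> real^3 \<Rightarrow> bool" where
  "half_space_near T x n \<longleftrightarrow>
     norm n = 1 \<and> (\<exists>e>0. T \<inter> ball x e = {y \<in> ball x e. (y - x) \<bullet> n < 0})"

text \<open>Otherwise the point obtained from \<open>x\<close> by a small step along \<open>-(n + n')\<close> lies in both sets.\<close>

lemma half_space_near_disjoint:
  assumes "half_space_near T x n" "half_space_near T' x n'" "T \<inter> T' = {}"
  shows "n' = - n"
proof (rule ccontr)
  assume ne: "n' \<noteq> - n"
  obtain e e' where e: "e > 0" "T \<inter> ball x e = {y \<in> ball x e. (y - x) \<bullet> n < 0}"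
    and e': "e' > 0" "T' \<inter> ball x e' = {y \<in> ball x e'. (y - x) \<bullet> n' < 0}"
    using assms by (auto simp: half_space_near_def)
  have nn: "n \<bullet> n = 1" "n' \<bullet> n' = 1"
    using assms by (simp_all add: half_space_near_def dot_square_norm)
  have "n + n' \<noteq> 0"
    using ne by (metis add.inverse_unique)
  then have "0 < (n + n') \<bullet> (n + n')"
    by simp
  then have pos: "1 + n \<bullet> n' > 0"
    using nn by (simp add: algebra_simps inner_commute)
  define t where "t = min e e' / 4"
  have t: "t > 0" "2 * t < e" "2 * t < e'"
    using e(1) e'(1) by (auto simp: t_def min_def field_simps)
  define y where "y = x - t *\<^sub>R (n + n')"
  have "norm (n + n') \<le> 2"
    using norm_triangle_ineq[of n n'] assms by (simp add: half_space_near_def)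
  then have "dist x y \<le> t * 2"
    using t by (simp add: y_def dist_norm)
  then have "y \<in> ball x e" "y \<in> ball x e'" using t by auto
  moreover have "(y - x) \<bullet> n < 0" "(y - x) \<bullet> n' < 0"
  proof -
    have "(y - x) \<bullet> n = - (t * (1 + n \<bullet> n'))" "(y - x) \<bullet> n' = - (t * (1 + n \<bullet> n'))"
      using nn by (simp_all add: y_def algebra_simps inner_commute)
    then show "(y - x) \<bullet> n < 0" "(y - x) \<bullet> n' < 0"
      using t pos by simp_all
  qed
  ultimately have "y \<in> T" "y \<in> T'"
    using e(2) e'(2) by blast+
  then show False using assms(3) by blast
qed

text \<open>The complementary half space is disjoint from \<open>T\<close>, so uniqueness follows from the previous
  lemma.\<close>

lemma half_space_near_unique:
  assumes "half_space_near T x n" "half_space_near T x n'"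
  shows "n = n'"
proof -
  obtain e where e: "e > 0" "T \<inter> ball x e = {y \<in> ball x e. (y - x) \<bullet> n < 0}"
    using assms by (auto simp: half_space_near_def)
  define S where "S = {y. (y - x) \<bullet> (- n) < 0}"
  have "y \<notin> T" if "y \<in> S" "y \<in> ball x e" for y
    using e(2) that by (force simp: S_def)
  then have "(S - T) \<inter> ball x e = {y \<in> ball x e. (y - x) \<bullet> (- n) < 0}"
    by (auto simp: S_def)
  then have "half_space_near (S - T) x (- n)"
    unfolding half_space_near_def using assms(1) e(1) by (auto simp: half_space_near_def)
  then have "- n = - n'"
    by (rule half_space_near_disjoint[OF assms(2)]) auto
  then show ?thesis by simp
qed

lemma outer_normal_eqI: "half_space_near T x n \<Longrightarrow> outer_normal T x = n"
  unfolding outer_normal_def using half_space_near_unique[of T x]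
  by (intro the_equality) (auto simp: half_space_near_def)

lemma planar_face_plane:
  assumes "planar_face F"
  obtains a b where "a \<noteq> 0" "affine hull F = {x. a \<bullet> x = b}"
proof -
  have "aff_dim F = int DIM(real^3) - 1"
    using assms by (simp add: planar_face_def)
  then show ?thesis
    using that aff_dim_eq_hyperplane[of F] by auto
qed

lemma planar_face_nonempty: "planar_face F \<Longrightarrow> F \<noteq> {}"
  using aff_dim_empty by (force simp: planar_face_def)

lemma planar_face_relative_ball:
  assumes "planar_face F" "x \<in> F"
  obtains e where "e > 0" "ball x e \<inter> affine hull F \<subseteq> F"
  using assms unfolding planar_face_def openin_contains_ball by blast

text \<open>The centre \<open>c\<close> is off the plane of the face, for otherwise the segment from a point of the face
  to \<open>c\<close> would run inside the face and inside \<open>T\<close>. Project from \<open>c\<close> onto the plane: points near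
  \<open>x \<in> F\<close> are projected into \<open>F\<close>, hence outside \<open>T\<close> but in its closure. A point on the side of
  \<open>c\<close> lies between \<open>c\<close> and its projection, so it belongs to \<open>T\<close>; a point of \<open>T\<close> in or beyond the
  plane would have its projection in \<open>T\<close> by star-shapedness.\<close>

lemma star_shaped_face_normal:
  assumes T: "open T" and star: "star_shaped_wrt_ball T c r" and r: "r > 0"
    and F: "planar_face F" "F \<subseteq> frontier T"
  shows "\<exists>n. (\<forall>x\<in>F. half_space_near T x n) \<and> (\<exists>b. affine hull F = {x. n \<bullet> x = b})"
proof -
  have FT: "x \<notin> T" "x \<in> closure T" if "x \<in> F" for x
    using that F(2) T by (auto simp: frontier_def interior_open)
  obtain a b where ab: "a \<noteq> 0" "affine hull F = {x. a \<bullet> x = b}"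
    using planar_face_plane[OF F(1)] .
  have hull: "x \<in> affine hull F" if "x \<in> F" for x
    using that by (rule hull_inc)
  have off: "c \<notin> affine hull F"
  proof
    assume c: "c \<in> affine hull F"
    obtain x where x: "x \<in> F" using planar_face_nonempty[OF F(1)] by blast
    obtain e where e: "e > 0" "ball x e \<inter> affine hull F \<subseteq> F"
      using planar_face_relative_ball[OF F(1) x] .
    \<comment> \<open>So small that the point \<open>x + t *\<^sub>R (c - x)\<close> stays within \<open>e\<close> of \<open>x\<close>; the \<open>1\<close> avoids a
      division by \<open>0\<close>.\<close>
    define t where "t = min 1 (e / (2 * (norm (c - x) + 1)))"
    have pos: "norm (c - x) + 1 > 0" by (simp add: add_nonneg_pos)
    then have t: "0 < t" "t \<le> 1" using e(1) by (auto simp: t_def)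
    have "t * norm (c - x) \<le> e / (2 * (norm (c - x) + 1)) * (norm (c - x) + 1)"
      using e(1) by (intro mult_mono) (auto simp: t_def)
    also have "\<dots> = e / 2" using pos by (simp add: field_simps)
    also have "\<dots> < e" using e(1) by simp
    finally have "x + t *\<^sub>R (c - x) \<in> ball x e" using t by (simp add: dist_norm)
    moreover have "a \<bullet> x = b" "a \<bullet> c = b" using c hull[OF x] ab by auto
    then have "x + t *\<^sub>R (c - x) \<in> affine hull F"
      using ab(2) by (simp add: algebra_simps)
    ultimately have "x + t *\<^sub>R (c - x) \<in> F" using e(2) by blast
    moreover have "x + t *\<^sub>R (c - x) \<in> T"
      using star_shaped_closure[OF star FT(2)[OF x] _ t] r by simp
    ultimately show False using FT by blast
  qed
  define n where "n = (if a \<bullet> c < b then a /\<^sub>R norm a else - a /\<^sub>R norm a)"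
  define \<beta> where "\<beta> = (if a \<bullet> c < b then b / norm a else - b / norm a)"
  have n1: "norm n = 1" using ab(1) by (simp add: n_def)
  have n_hull: "affine hull F = {x. n \<bullet> x = \<beta>}"
    using ab by (auto simp: n_def \<beta>_def divide_inverse_commute)
  have "a \<bullet> c \<noteq> b" using off ab by simp
  then have nc: "n \<bullet> c < \<beta>"
    using ab(1) by (auto simp: n_def \<beta>_def divide_inverse_commute mult_less_cancel_left_pos)
  have "half_space_near T x n" if x: "x \<in> F" for x
  proof -
    obtain e where e: "e > 0" "ball x e \<inter> affine hull F \<subseteq> F"
      using planar_face_relative_ball[OF F(1) x] .
    have nx: "n \<bullet> x = \<beta>" using hull[OF x] n_hull by simp
    \<comment> \<open>The central projection from \<open>c\<close> onto the plane of the face, which fixes \<open>x\<close>.\<close>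
    define g where "g y = c + ((\<beta> - n \<bullet> c) / (n \<bullet> (y - c))) *\<^sub>R (y - c)" for y
    have ne: "n \<bullet> (x - c) \<noteq> 0" using nx nc by (simp add: inner_diff_right)
    have gx: "g x = x" using nx nc by (simp add: g_def inner_diff_right)
    have "isCont g x" unfolding g_def using ne by (intro continuous_intros) auto
    then have "(g \<longlongrightarrow> x) (at x)" using gx by (simp add: isCont_def)
    moreover have "((\<lambda>y. n \<bullet> (y - c)) \<longlongrightarrow> n \<bullet> (x - c)) (at x)"
      by (intro tendsto_intros)
    moreover have "n \<bullet> (x - c) > 0" using nx nc by (simp add: inner_diff_right)
    ultimately have "\<forall>\<^sub>F y in at x. dist (g y) x < e \<and> n \<bullet> (y - c) > 0"
      using e(1) by (intro eventually_conj tendstoD order_tendstoD)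
    then obtain d where d: "d > 0" "\<And>y. y \<noteq> x \<Longrightarrow> dist y x < d \<Longrightarrow> dist (g y) x < e \<and> n \<bullet> (y - c) > 0"
      unfolding eventually_at by auto
    have gy: "g y \<in> F" "n \<bullet> (y - c) > 0" if "y \<in> ball x d" for y
    proof -
      have *: "dist (g y) x < e \<and> n \<bullet> (y - c) > 0"
        using d(2)[of y] that gx e(1) \<open>n \<bullet> (x - c) > 0\<close>
        by (cases "y = x") (auto simp: dist_commute)
      then show "n \<bullet> (y - c) > 0" by simp
      then have "n \<bullet> g y = \<beta>" by (simp add: g_def inner_add_right)
      then show "g y \<in> F" using e(2) n_hull * by (auto simp: dist_commute)
    qed
    have "y \<in> T \<longleftrightarrow> (y - x) \<bullet> n < 0" if y: "y \<in> ball x d" for y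
    proof -
      define u where "u = n \<bullet> (y - c)"
      define \<delta> where "\<delta> = \<beta> - n \<bullet> c"
      have u: "u > 0" "\<delta> > 0" using gy(2)[OF y] nc by (simp_all add: u_def \<delta>_def)
      have ux: "(y - x) \<bullet> n = u - \<delta>"
        using nx by (simp add: u_def \<delta>_def inner_diff_left inner_diff_right inner_commute)
      have g: "g y = c + (\<delta> / u) *\<^sub>R (y - c)" by (simp add: g_def u_def \<delta>_def)
      show ?thesis
      proof
        assume "(y - x) \<bullet> n < 0"
        then have "u / \<delta> < 1" "u / \<delta> > 0" using u ux by auto
        then have "g y + (1 - u / \<delta>) *\<^sub>R (c - g y) \<in> T"
          using star_shaped_closure[OF star FT(2)[OF gy(1)[OF y]], of c "1 - u / \<delta>"] r by simp
        also have "g y + (1 - u / \<delta>) *\<^sub>R (c - g y) = c + (u / \<delta>) *\<^sub>R (g y - c)"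
          by (simp add: algebra_simps)
        also have "\<dots> = y" using u by (simp add: g)
        finally show "y \<in> T" .
      next
        assume yT: "y \<in> T"
        show "(y - x) \<bullet> n < 0"
        proof (rule ccontr)
          assume "\<not> (y - x) \<bullet> n < 0"
          then have s: "0 \<le> \<delta> / u" "\<delta> / u \<le> 1" using u ux by auto
          have "c \<in> ball c r" using r by simp
          then have "closed_segment c y \<subseteq> T"
            using star yT by (auto simp: star_shaped_wrt_ball_def)
          moreover have "g y = (1 - \<delta> / u) *\<^sub>R c + (\<delta> / u) *\<^sub>R y"
            unfolding g by (simp add: algebra_simps)
          ultimately have "g y \<in> T" using s by (force simp: closed_segment_def)
          then show False using FT(1)[OF gy(1)[OF y]] by simp
        qed
      qed
    qed
    then show ?thesis
      unfolding half_space_near_def using n1 d(1) by (auto intro!: exI[of _ d])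
  qed
  then show ?thesis using n_hull by blast
qed

text \<open>Two opposite half balls leave room for a part of a plane only.\<close>

lemma no_third_element_at_face:
  assumes half: "half_space_near T1 x n" "half_space_near T2 x (- n)"
    and T: "open T" "x \<in> closure T" and dis: "disjnt T T1" "disjnt T T2"
  shows False
proof -
  obtain e e' where e: "e > 0" "T1 \<inter> ball x e = {y \<in> ball x e. (y - x) \<bullet> n < 0}"
    and e': "e' > 0" "T2 \<inter> ball x e' = {y \<in> ball x e'. (y - x) \<bullet> (- n) < 0}"
    using half by (auto simp: half_space_near_def)
  define d where "d = min e e'"
  have d: "d > 0" using e e' by (simp add: d_def)
  have sub: "ball x d \<subseteq> ball x e" "ball x d \<subseteq> ball x e'" by (auto simp: d_def)
  have "T \<inter> ball x d \<subseteq> {y. n \<bullet> y = n \<bullet> x}"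
  proof
    fix y assume y: "y \<in> T \<inter> ball x d"
    then have "y \<notin> T1" "y \<notin> T2" using dis by (auto simp: disjnt_iff)
    then have "\<not> (y - x) \<bullet> n < 0" "\<not> (y - x) \<bullet> (- n) < 0"
      using e(2) e'(2) y sub by blast+
    then show "y \<in> {y. n \<bullet> y = n \<bullet> x}" by (simp add: inner_diff_right inner_commute)
  qed
  moreover have "n \<noteq> 0" using half by (auto simp: half_space_near_def)
  ultimately have "interior (T \<inter> ball x d) = {}"
    using interior_mono interior_hyperplane[of n "n \<bullet> x"] by blast
  moreover have "interior (T \<inter> ball x d) = T \<inter> ball x d"
    using T by (simp add: interior_open open_Int)
  moreover have "T \<inter> ball x d \<noteq> {}"
  proof -
    obtain y where "y \<in> T" "dist y x < d" using T(2) d by (meson closure_approachable)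
    then show ?thesis by (auto simp: dist_commute)
  qed
  ultimately show False by simp
qed

section \<open>Connectedness of a mesh through its faces\<close>

text \<open>The points that cannot be seen from \<open>a\<close> when \<open>N\<close> is opaque.\<close>

definition shadow :: "'a::euclidean_space \<Rightarrow> 'a set \<Rightarrow> 'a set" where
  "shadow a N = {b. \<exists>t\<in>{0..1}. a + t *\<^sub>R (b - a) \<in> N}"

text \<open>The shadow is the projection of a closed set along the compact parameter interval \<open>{0..1}\<close>.\<close>

lemma closed_shadow:
  assumes "closed N"
  shows "closed (shadow a N)"
proof -
  have "closed ((\<lambda>p::real \<times> 'a. a + fst p *\<^sub>R (snd p - a)) -` N)"
    using assms by (intro continuous_closed_vimage) (auto intro!: continuous_intros)
  then have "closed {p::real \<times> 'a. a + fst p *\<^sub>R (snd p - a) \<in> N}"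
    by (simp add: vimage_def)
  from closed_compact_projection[OF compact_Icc this, of 0 1] show ?thesis
    by (simp add: shadow_def Bex_def)
qed

text \<open>Central projection from \<open>a\<close> would map a ball in the shadow onto a relatively open subset of
  the plane contained in \<open>N\<close>.\<close>

lemma interior_shadow_empty:
  fixes n :: "'a::euclidean_space"
  assumes plane: "N \<subseteq> {x. n \<bullet> x = \<beta>}" and a: "n \<bullet> a \<noteq> \<beta>"
    and thin: "\<And>x e. x \<in> N \<Longrightarrow> e > 0 \<Longrightarrow> \<exists>z. n \<bullet> z = \<beta> \<and> z \<notin> N \<and> dist z x < e"
  shows "interior (shadow a N) = {}"
proof (rule ccontr)
  assume "interior (shadow a N) \<noteq> {}"
  then obtain b e where e: "e > 0" "ball b e \<subseteq> shadow a N"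
    by (meson all_not_in_conv mem_interior)
  then have "b \<in> shadow a N" by (simp add: subset_eq)
  then obtain t where t: "0 \<le> t" "t \<le> 1" "a + t *\<^sub>R (b - a) \<in> N"
    by (auto simp: shadow_def)
  define x where "x = a + t *\<^sub>R (b - a)"
  have "n \<bullet> x = \<beta>" using plane t(3) by (auto simp: x_def)
  then have "t \<noteq> 0" using a by (auto simp: x_def)
  then have t0: "t > 0" using t by simp
  obtain z where z: "n \<bullet> z = \<beta>" "z \<notin> N" "dist z x < t * e"
    using thin[of x "t * e"] t t0 e(1) by (auto simp: x_def)
  \<comment> \<open>The point near \<open>b\<close> whose central projection onto the plane is \<open>z\<close> instead of \<open>x\<close>.\<close>
  define b' where "b' = a + (1 / t) *\<^sub>R (z - a)"
  have "b' - b = (1 / t) *\<^sub>R (z - x)"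
    using t0 by (simp add: b'_def x_def algebra_simps)
  then have "dist b b' = dist z x / t"
    using t0 by (simp add: dist_norm norm_minus_commute)
  also have "\<dots> < e" using z(3) t0 by (simp add: field_simps)
  finally have "b' \<in> shadow a N" using e(2) by auto
  then obtain s where s: "a + s *\<^sub>R (b' - a) \<in> N" by (auto simp: shadow_def)
  have eq: "a + s *\<^sub>R (b' - a) = a + (s / t) *\<^sub>R (z - a)"
    by (simp add: b'_def)
  then have "n \<bullet> (a + (s / t) *\<^sub>R (z - a)) = \<beta>" using s plane by auto
  then have "(s / t - 1) * (\<beta> - n \<bullet> a) = 0"
    using z(1) by (simp add: inner_add_right inner_diff_right algebra_simps)
  then have "s / t = 1" using a by simp
  then show False using s z(2) unfolding eq by simp
qed

text \<open>A face is relatively open and dense in its closure, whence the relative boundary is closed and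
  contains no relatively open subset of the plane.\<close>

lemma planar_face_rel_frontier:
  assumes "planar_face F"
  shows "closed (closure F - F)" "closure F - F \<subseteq> affine hull F"
    "\<And>x e. x \<in> closure F - F \<Longrightarrow> e > 0 \<Longrightarrow> \<exists>z\<in>affine hull F. z \<notin> closure F - F \<and> dist z x < e"
proof -
  have cl: "closure F \<subseteq> affine hull F"
    by (simp add: closure_minimal hull_subset)
  then show "closure F - F \<subseteq> affine hull F" by blast
  obtain S where S: "open S" "F = affine hull F \<inter> S"
    using assms by (auto simp: planar_face_def openin_open)
  then have "closure F - F = closure F - S" using cl by blast
  then show "closed (closure F - F)" using S(1) by (simp add: closed_Diff)
  fix x and e :: real assume "x \<in> closure F - F" "e > 0"
  then obtain z where "z \<in> F" "dist z x < e" by (meson DiffD1 closure_approachable)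
  then show "\<exists>z\<in>affine hull F. z \<notin> closure F - F \<and> dist z x < e"
    by (meson Diff_iff hull_inc)
qed

lemma interior_finite_Union_empty:
  assumes "finite I" "\<And>i. i \<in> I \<Longrightarrow> closed (S i)" "\<And>i. i \<in> I \<Longrightarrow> interior (S i) = {}"
  shows "interior (\<Union>i\<in>I. S i) = {}" and "closed (\<Union>i\<in>I. S i)"
proof -
  show "closed (\<Union>i\<in>I. S i)" using assms by blast
  show "interior (\<Union>i\<in>I. S i) = {}"
    using assms
  proof (induction I rule: finite_induct)
    case (insert i I)
    have "interior (S i \<union> (\<Union>i\<in>I. S i)) = interior (S i)"
      using insert by (intro interior_closed_Un_empty_interior) auto
    then show ?case using insert by simp
  qed simp
qed

lemma open_avoids_empty_interior:
  assumes "open S" "S \<noteq> {}" "interior U = {}"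
  obtains x where "x \<in> S" "x \<notin> U"
  using assms interior_maximal[of S U] by blast

lemma segment_meets_both:
  fixes a b :: "'a::euclidean_space"
  assumes "closed A" "closed B" "closed_segment a b \<subseteq> A \<union> B" "a \<in> A" "b \<in> B"
  shows "\<exists>y\<in>closed_segment a b. y \<in> A \<and> y \<in> B"
  using connected_segment(1)[of a b] assms unfolding connected_closed by (metis Int_iff disjoint_iff ends_in_segment)

text \<open>Let \<open>A\<close> and \<open>B\<close> be the unions of the closed elements where \<open>\<phi>\<close> has, and has not, the value
  taken on \<open>T\<close>. If \<open>\<phi>\<close> were not constant, connectedness of \<open>\<Omega>\<close> would give a point \<open>x\<close> of both
  sets, and near \<open>x\<close> there would be an element \<open>Ta\<close> of the first and \<open>Tb\<close> of the second kind. Choose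
  a point \<open>a\<close> of \<open>Ta\<close> off all face planes, and a point \<open>b\<close> of \<open>Tb\<close> that is not in the shadow of any
  relative face boundary. The segment from \<open>a\<close> to \<open>b\<close> passes from \<open>A\<close> to \<open>B\<close> at some \<open>y\<close>, which
  lies on the mesh skeleton but on no relative face boundary; so \<open>y\<close> is in a face. Near \<open>y\<close>
  there are only the two elements that share this face, on which \<open>\<phi>\<close> takes the same value.\<close>

theorem mesh_face_connected:
  assumes domain: "polyhedral_lipschitz_domain \<Omega>" and mesh: "polyhedral_mesh \<Omega> \<T> \<F>"
    and star: "\<And>T. T \<in> \<T> \<Longrightarrow> \<exists>c r. r > 0 \<and> star_shaped_wrt_ball T c r"
    and faces: "\<And>F T T'. F \<in> \<F> \<Longrightarrow> \<not> F \<subseteq> frontier \<Omega> \<Longrightarrow> T \<in> \<T> \<Longrightarrow> T' \<in> \<T> \<Longrightarrow> T \<noteq> T' \<Longrightarrow>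
       {S\<in>\<T>. F \<subseteq> frontier S} = {T, T'} \<Longrightarrow> \<phi> T = \<phi> T'"
    and T: "T \<in> \<T>" "T' \<in> \<T>"
  shows "\<phi> T = \<phi> T'"
proof (rule ccontr)
  assume neq: "\<phi> T \<noteq> \<phi> T'"
  have m: "finite \<T>" "\<And>S. S \<in> \<T> \<Longrightarrow> open S" "\<And>S. S \<in> \<T> \<Longrightarrow> S \<noteq> {}" "pairwise disjnt \<T>"
    "closure \<Omega> = (\<Union>T\<in>\<T>. closure T)" "finite \<F>" "\<And>F. F \<in> \<F> \<Longrightarrow> planar_face F"
    "(\<Union>T\<in>\<T>. frontier T) = (\<Union>F\<in>\<F>. closure F)"
    "\<And>F. F \<in> \<F> \<Longrightarrow> \<not> F \<subseteq> frontier \<Omega> \<Longrightarrow> card {T\<in>\<T>. F \<subseteq> frontier T} = 2"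
    using mesh by (auto simp: polyhedral_mesh_def open_polyhedron_open open_polyhedron_nonempty)
  have Om: "open \<Omega>" "connected \<Omega>" using domain by (auto simp: polyhedral_lipschitz_domain_def)
  note sub = mesh_element_subset[OF domain mesh]
  define A where "A = (\<Union>S\<in>{S\<in>\<T>. \<phi> S = \<phi> T}. closure S)"
  define B where "B = (\<Union>S\<in>{S\<in>\<T>. \<phi> S \<noteq> \<phi> T}. closure S)"
  have closed: "closed A" "closed B" using m(1) by (auto simp: A_def B_def)
  have "closure \<Omega> \<subseteq> A \<union> B" unfolding m(5) A_def B_def by blast
  then have cover: "\<Omega> \<subseteq> A \<union> B" using closure_subset by blast
  have TA: "S \<subseteq> A" if "S \<in> \<T>" "\<phi> S = \<phi> T" for S
    using that closure_subset[of S] by (auto simp: A_def)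
  have TB: "S \<subseteq> B" if "S \<in> \<T>" "\<phi> S \<noteq> \<phi> T" for S
    using that closure_subset[of S] by (auto simp: B_def)
  have "A \<inter> \<Omega> \<noteq> {}"
    using m(3)[OF T(1)] sub[OF T(1)] TA[OF T(1)] by blast
  moreover have "B \<inter> \<Omega> \<noteq> {}"
    using m(3)[OF T(2)] sub[OF T(2)] TB[OF T(2)] neq by fastforce
  ultimately
  obtain x where x: "x \<in> A" "x \<in> B" "x \<in> \<Omega>"
    using Om(2) closed cover unfolding connected_closed by blast
  obtain Ta Tb where Ta: "Ta \<in> \<T>" "\<phi> Ta = \<phi> T" "x \<in> closure Ta"
    and Tb: "Tb \<in> \<T>" "\<phi> Tb \<noteq> \<phi> T" "x \<in> closure Tb"
    using x by (auto simp: A_def B_def)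
  obtain e where e: "e > 0" "ball x e \<subseteq> \<Omega>" using x(3) Om(1) by (meson openE)
  have meets: "S \<inter> ball x e \<noteq> {}" if "x \<in> closure S" for S
  proof -
    obtain y where "y \<in> S" "dist y x < e" using \<open>x \<in> closure S\<close> e(1) by (meson closure_approachable)
    then show ?thesis by (auto simp: dist_commute)
  qed
  have "interior (\<Union>F\<in>\<F>. affine hull F) = {}"
  proof (rule interior_finite_Union_empty[OF m(6)])
    fix F assume "F \<in> \<F>"
    then obtain a b where "a \<noteq> 0" "affine hull F = {x. a \<bullet> x = b}"
      using planar_face_plane m(7) by metis
    then show "interior (affine hull F) = {}" by simp
  qed simp
  from open_avoids_empty_interior[OF open_Int[OF m(2)[OF Ta(1)] open_ball] meets[OF Ta(3)] this]
  obtain a where a: "a \<in> Ta" "a \<in> ball x e" "a \<notin> (\<Union>F\<in>\<F>. affine hull F)"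
    by blast
  then have a3: "a \<notin> affine hull F" if "F \<in> \<F>" for F using that by blast
  have "interior (\<Union>F\<in>\<F>. shadow a (closure F - F)) = {}"
  proof (rule interior_finite_Union_empty[OF m(6)])
    fix F assume F: "F \<in> \<F>"
    note rf = planar_face_rel_frontier[OF m(7)[OF F]]
    show "closed (shadow a (closure F - F))" by (rule closed_shadow[OF rf(1)])
    obtain n b where "n \<noteq> 0" and n: "affine hull F = {x. n \<bullet> x = b}"
      using planar_face_plane[OF m(7)[OF F]] .
    show "interior (shadow a (closure F - F)) = {}"
      by (rule interior_shadow_empty[of _ n b]) (use rf(2,3) a3[OF F] in \<open>auto simp: n\<close>)
  qed
  from open_avoids_empty_interior[OF open_Int[OF m(2)[OF Tb(1)] open_ball] meets[OF Tb(3)] this]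
  obtain b where b: "b \<in> Tb" "b \<in> ball x e" "b \<notin> (\<Union>F\<in>\<F>. shadow a (closure F - F))"
    by blast
  have seg: "closed_segment a b \<subseteq> \<Omega>"
    using closed_segment_subset[OF a(2) b(2) convex_ball] e(2) by blast
  obtain y where y: "y \<in> closed_segment a b" "y \<in> A" "y \<in> B"
    using segment_meets_both[OF closed, of a b] seg cover a(1) b(1) TA[OF Ta(1,2)] TB[OF Tb(1,2)]
    by blast
  obtain S S' where S: "S \<in> \<T>" "\<phi> S = \<phi> T" "y \<in> closure S"
    and S': "S' \<in> \<T>" "\<phi> S' \<noteq> \<phi> T" "y \<in> closure S'"
    using y by (auto simp: A_def B_def)
  then have "S \<noteq> S'" by auto
  then have "S \<inter> S' = {}" using pairwiseD[OF m(4) S(1) S'(1)] by (simp add: disjnt_def)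
  then have "y \<notin> S" using S'(3) m(2)[OF S(1)] open_Int_closure_eq_empty by blast
  then have "y \<in> frontier S" using S m(2) by (simp add: frontier_def interior_open)
  then obtain F where F: "F \<in> \<F>" "y \<in> closure F" using m(8) S(1) by blast
  have "y \<notin> closure F - F"
  proof
    assume "y \<in> closure F - F"
    moreover obtain u where "0 \<le> u" "u \<le> 1" "y = (1 - u) *\<^sub>R a + u *\<^sub>R b"
      using y(1) by (auto simp: closed_segment_def)
    ultimately have "b \<in> shadow a (closure F - F)"
      by (auto simp: shadow_def algebra_simps intro!: bexI[of _ u])
    then show False using b(3) F(1) by blast
  qed
  then have yF: "y \<in> F" using F(2) by blast
  have "y \<in> \<Omega>" using y(1) seg by blast
  then have nb: "\<not> F \<subseteq> frontier \<Omega>" using yF Om(1) by (auto simp: frontier_def interior_open)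
  obtain S1 S2 where S12: "S1 \<noteq> S2" "{S\<in>\<T>. F \<subseteq> frontier S} = {S1, S2}"
    using m(9)[OF F(1) nb] by (auto simp: card_2_iff)
  then have in12: "S1 \<in> \<T>" "S2 \<in> \<T>" "F \<subseteq> frontier S1" "F \<subseteq> frontier S2" by auto
  have dis: "disjnt S1 S2" using in12 S12(1) m(4) by (simp add: pairwise_def)
  have half: "\<exists>n. half_space_near R y n" if R: "R \<in> \<T>" "F \<subseteq> frontier R" for R
  proof -
    obtain c r where "r > 0" "star_shaped_wrt_ball R c r" using star[OF R(1)] by blast
    from star_shaped_face_normal[OF m(2)[OF R(1)] this(2,1) m(7)[OF F(1)] R(2)] yF
    show ?thesis by blast
  qed
  obtain n1 n2 where n12: "half_space_near S1 y n1" "half_space_near S2 y n2"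
    using half[OF in12(1,3)] half[OF in12(2,4)] by blast
  then have n2: "n2 = - n1"
    using half_space_near_disjoint[OF n12] dis by (auto simp: disjnt_def)
  have *: "R = S1 \<or> R = S2" if "R \<in> \<T>" "y \<in> closure R" for R
  proof (rule ccontr)
    assume "\<not> (R = S1 \<or> R = S2)"
    then have "disjnt R S1" "disjnt R S2"
      using pairwiseD[OF m(4) that(1) in12(1)] pairwiseD[OF m(4) that(1) in12(2)] by auto
    then show False
      using no_third_element_at_face[OF n12(1) _ m(2)[OF that(1)] that(2)] n12(2)
        n2 by blast
  qed
  have "\<phi> S1 = \<phi> S2" using faces[OF F(1) nb in12(1,2) S12] .
  then show False using *[OF S(1,3)] *[OF S'(1,3)] S(2) S'(2) by auto
qed

section \<open>Charts of planar faces\<close>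

text \<open>The direction space of the plane is a two-dimensional subspace, hence isometric to \<open>\<real>\<^sup>2\<close>.\<close>

lemma plane_chart:
  assumes "planar_face F"
  shows "\<forall>s t. dist (plane_chart F s) (plane_chart F t) = dist s t" "range (plane_chart F) = affine hull F"
proof -
  obtain x0 where x0: "x0 \<in> affine hull F"
    using planar_face_nonempty[OF assms] hull_subset[of F affine] by blast
  define S where "S = (\<lambda>x. x - x0) ` (affine hull F)"
  have S: "subspace S" unfolding S_def
    using x0 by (intro affine_diffs_subspace_subtract) auto
  have "int (dim S) = 2"
    unfolding S_def using aff_dim_dim_affine_diffs[of "affine hull F" x0] x0 assms
    by (simp add: planar_face_def)
  then have "dim (UNIV :: (real^2) set) = dim S" by simp
  then obtain f :: "real^2 \<Rightarrow> real^3" where f: "linear f" "f ` UNIV = S" "\<And>x. norm (f x) = norm x"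
    using isometry_subspaces[OF subspace_UNIV S] by (metis UNIV_I)
  have "(\<forall>s t. dist (x0 + f s) (x0 + f t) = dist s t) \<and> range (\<lambda>s. x0 + f s) = affine hull F"
  proof
    show "\<forall>s t. dist (x0 + f s) (x0 + f t) = dist s t"
      using f(3) by (metis add_diff_cancel_left dist_norm f(1) linear_diff)
    have "range (\<lambda>s. x0 + f s) = (\<lambda>x. x0 + x) ` S" using f(2) by auto
    also have "\<dots> = affine hull F" by (auto simp: S_def image_iff)
    finally show "range (\<lambda>s. x0 + f s) = affine hull F" .
  qed
  then have "\<exists>\<phi> :: real^2 \<Rightarrow> real^3. (\<forall>s t. dist (\<phi> s) (\<phi> t) = dist s t) \<and> range \<phi> = affine hull F"
    by (intro exI)
  from someI_ex[OF this, folded plane_chart_def]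
  show "\<forall>s t. dist (plane_chart F s) (plane_chart F t) = dist s t"
    and "range (plane_chart F) = affine hull F"
    by (rule conjunct1, rule conjunct2)
qed

lemma plane_chart_continuous:
  assumes "planar_face F"
  shows "continuous_on UNIV (plane_chart F)"
proof -
  have "1-lipschitz_on UNIV (plane_chart F)"
    by (rule lipschitz_onI) (simp_all add: plane_chart(1)[OF assms, rule_format])
  then show ?thesis by (rule lipschitz_on_continuous_on)
qed

lemma plane_chart_domain:
  assumes F: "planar_face F" and bdd: "bounded F"
  shows "open (plane_chart F -` F)" "plane_chart F -` F \<noteq> {}" "bounded (plane_chart F -` F)"
    "plane_chart F ` (plane_chart F -` F) = F"
proof -
  note ch = plane_chart[OF F]
  obtain S where S: "open S" "F = affine hull F \<inter> S"
    using F by (auto simp: planar_face_def openin_open)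
  then have "plane_chart F -` F = plane_chart F -` S" using ch(2) by blast
  then show "open (plane_chart F -` F)"
    using plane_chart_continuous[OF F] S(1) by (simp add: open_vimage)
  have F_range: "F \<subseteq> range (plane_chart F)" using ch(2) hull_subset by metis
  then show "plane_chart F -` F \<noteq> {}" using planar_face_nonempty[OF F] by blast
  show "plane_chart F ` (plane_chart F -` F) = F" using F_range by auto
  show "bounded (plane_chart F -` F)"
  proof (cases "plane_chart F -` F = {}")
    case False
    then obtain s0 where s0: "plane_chart F s0 \<in> F" by blast
    obtain e where "\<forall>y\<in>F. dist (plane_chart F s0) y \<le> e" using bdd s0 bounded_any_center by metis
    then show ?thesis unfolding bounded_def using ch(1) by (metis vimageE)
  qed simp
qed

section \<open>Integrals of continuous functions\<close>

lemma integrable_continuous_bounded_open: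
  fixes f :: "'a::euclidean_space \<Rightarrow> 'b::euclidean_space"
  assumes "open T" "bounded T" "continuous_on UNIV f"
  shows "integrable (lebesgue_on T) f"
proof -
  obtain a b where ab: "T \<subseteq> cbox a b"
    using bounded_subset_cbox_symmetric assms(2) by metis
  have "f absolutely_integrable_on cbox a b"
    using assms(3) by (intro absolutely_integrable_continuous) (auto intro: continuous_on_subset)
  then have "f absolutely_integrable_on T"
    by (rule set_integrable_subset) (use ab assms(1) in auto)
  then show ?thesis
    using assms(1) by (simp add: absolutely_integrable_imp_integrable)
qed

text \<open>The set where \<open>f\<close> is positive is open, and nonempty open sets are not negligible.\<close>

lemma integral_continuous_eq_0:
  fixes f :: "'a::euclidean_space \<Rightarrow> real"
  assumes T: "open T" "bounded T" and f: "continuous_on UNIV f" "\<And>x. x \<in> T \<Longrightarrow> f x \<ge> 0"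
    and zero: "(LINT x|lebesgue_on T. f x) = 0" and x: "x \<in> T"
  shows "f x = 0"
proof -
  have "AE x in lebesgue_on T. 0 \<le> f x"
    using f(2) by (intro AE_I2) simp
  then have "AE x in lebesgue_on T. f x = 0"
    using zero integral_nonneg_eq_0_iff_AE[OF integrable_continuous_bounded_open[OF T f(1)]] by simp
  then have "AE x in lebesgue. x \<in> T \<longrightarrow> f x = 0"
    using T(1) by (simp add: AE_restrict_space_iff)
  then obtain N where N: "{x \<in> space lebesgue. \<not> (x \<in> T \<longrightarrow> f x = 0)} \<subseteq> N"
      "emeasure lebesgue N = 0" "N \<in> sets lebesgue"
    by (rule AE_E)
  then have "negligible N"
    by (simp add: negligible_iff_null_sets null_sets_def)
  then have "negligible (T \<inter> f -` (- {0}))"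
    by (rule negligible_subset) (use N(1) in auto)
  moreover have "open (T \<inter> f -` (- {0}))"
    using T(1) f(1) by (intro open_Int open_vimage) auto
  ultimately have "T \<inter> f -` (- {0}) = {}"
    using open_not_negligible by blast
  then show ?thesis using x by auto
qed

lemma lin_on_integral:
  fixes G :: "'v::real_vector \<Rightarrow> 'a \<Rightarrow> real"
  assumes "\<And>v. v \<in> V \<Longrightarrow> integrable M (G v)"
    and "\<And>v w c d x. v \<in> V \<Longrightarrow> w \<in> V \<Longrightarrow> x \<in> space M \<Longrightarrow>
        G (c *\<^sub>R v + d *\<^sub>R w) x = c * G v x + d * G w x"
  shows "lin_on V (\<lambda>v. LINT x|M. G v x)"
  unfolding lin_on_def
proof (intro ballI allI)
  fix v w c d assume vw: "v \<in> V" "w \<in> V"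
  have "(LINT x|M. G (c *\<^sub>R v + d *\<^sub>R w) x) = (LINT x|M. c * G v x + d * G w x)"
    by (intro Bochner_Integration.integral_cong refl assms(2) vw)
  also have "\<dots> = c * (LINT x|M. G v x) + d * (LINT x|M. G w x)"
    using assms(1) vw by simp
  finally show "(LINT x|M. G (c *\<^sub>R v + d *\<^sub>R w) x) = c * (LINT x|M. G v x) + d * (LINT x|M. G w x)" .
qed

text \<open>Continuity up to the boundary of the face, which makes a function integrable over a bounded
  face. Traces of polynomials and the outer normal are of this kind.\<close>

definition face_cont :: "(real^3) set \<Rightarrow> (real^3 \<Rightarrow> 'b::topological_space) \<Rightarrow> bool" where
  "face_cont F g \<longleftrightarrow> (\<exists>p. continuous_on UNIV p \<and> (\<forall>x\<in>F. g x = p x))"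

lemma face_cont_continuous: "continuous_on UNIV g \<Longrightarrow> face_cont F g"
  by (auto simp: face_cont_def)

lemma face_cont_const_on: "(\<And>x. x \<in> F \<Longrightarrow> g x = n) \<Longrightarrow> face_cont F g"
  unfolding face_cont_def by (intro exI[of _ "\<lambda>_. n"]) auto

lemma face_cont_compose2:
  assumes "face_cont F g" "face_cont F h" "continuous_on UNIV (\<lambda>p. H (fst p) (snd p))"
  shows "face_cont F (\<lambda>x. H (g x) (h x))"
proof -
  obtain p q where "continuous_on UNIV p" "continuous_on UNIV q"
    and eq: "\<And>x. x \<in> F \<Longrightarrow> g x = p x" "\<And>x. x \<in> F \<Longrightarrow> h x = q x"
    using assms(1,2) by (auto simp: face_cont_def)
  then have "continuous_on UNIV (\<lambda>x. (p x, q x))" by (intro continuous_intros)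
  then have "continuous_on UNIV (\<lambda>x. H (p x) (q x))"
    using continuous_on_compose2[OF assms(3), of UNIV "\<lambda>x. (p x, q x)"] by simp
  then show ?thesis using eq by (auto simp: face_cont_def)
qed

lemma face_cont_mult: "face_cont F g \<Longrightarrow> face_cont F h \<Longrightarrow> face_cont F (\<lambda>x. g x * h x :: real)"
  by (rule face_cont_compose2[where H = "\<lambda>a b. a * b"], assumption, assumption, intro continuous_intros)

lemma face_cont_inner: "face_cont F v \<Longrightarrow> face_cont F w \<Longrightarrow> face_cont F (\<lambda>x. v x \<bullet> (w x :: 'b::real_inner))"
  by (rule face_cont_compose2[where H = "\<lambda>a b. a \<bullet> b"], assumption, assumption, intro continuous_intros)

lemma face_cont_diff: "face_cont F v \<Longrightarrow> face_cont F w \<Longrightarrow> face_cont F (\<lambda>x. v x - (w x :: 'b::real_normed_vector))"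
  by (rule face_cont_compose2[where H = "\<lambda>a b. a - b"], assumption, assumption, intro continuous_intros)

lemma face_cont_matrix_vector:
  fixes A :: "real^3 \<Rightarrow> real^3^3"
  shows "face_cont F A \<Longrightarrow> face_cont F v \<Longrightarrow> face_cont F (\<lambda>x. A x *v v x)"
  by (rule face_cont_compose2[where H = "\<lambda>A b. A *v b"], assumption, assumption)
    (unfold matrix_vector_mult_def, intro continuous_intros)

lemma face_integrable:
  assumes F: "planar_face F" "bounded F" and g: "face_cont F (g :: _ \<Rightarrow> real)"
  shows "integrable (lebesgue_on (plane_chart F -` F)) (\<lambda>s. g (plane_chart F s))"
proof -
  obtain p where p: "continuous_on UNIV p" "\<And>x. x \<in> F \<Longrightarrow> g x = p x"
    using g by (auto simp: face_cont_def)
  have "continuous_on UNIV (\<lambda>s. p (plane_chart F s))"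
    using continuous_on_compose2[OF p(1) plane_chart_continuous[OF F(1)]] by simp
  then have "integrable (lebesgue_on (plane_chart F -` F)) (\<lambda>s. p (plane_chart F s))"
    by (rule integrable_continuous_bounded_open[OF plane_chart_domain(1,3)[OF F]])
  then show ?thesis
    using p(2) by (subst Bochner_Integration.integrable_cong[OF refl]) auto
qed

lemma face_integral_nonneg:
  assumes "\<And>x. x \<in> F \<Longrightarrow> 0 \<le> g x"
  shows "0 \<le> face_integral F g"
  unfolding face_integral_def by (rule Bochner_Integration.integral_nonneg) (simp add: assms)

lemma face_integral_eq_0:
  assumes F: "planar_face F" "bounded F" and g: "face_cont F g" "\<And>x. x \<in> F \<Longrightarrow> 0 \<le> g x"
    and zero: "face_integral F g = 0" and x: "x \<in> F"
  shows "g x = 0"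
proof -
  obtain p where p: "continuous_on UNIV p" "\<And>x. x \<in> F \<Longrightarrow> g x = p x"
    using g by (auto simp: face_cont_def)
  have "x \<in> plane_chart F ` (plane_chart F -` F)"
    using plane_chart_domain(4)[OF F] x by simp
  then obtain s where s: "s \<in> plane_chart F -` F" "plane_chart F s = x"
    by (elim imageE) simp
  have "p (plane_chart F s) = 0"
  proof (rule integral_continuous_eq_0[OF plane_chart_domain(1,3)[OF F] _ _ _ s(1)])
    show "continuous_on UNIV (\<lambda>s. p (plane_chart F s))"
      using continuous_on_compose2[OF p(1) plane_chart_continuous[OF F(1)]] by simp
    show "0 \<le> p (plane_chart F s)" if "s \<in> plane_chart F -` F" for s
      using that p(2) g(2) by (metis vimageE)
    have "(LINT s|lebesgue_on (plane_chart F -` F). p (plane_chart F s)) = face_integral F g"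
      unfolding face_integral_def using p(2) by (intro Bochner_Integration.integral_cong) auto
    then show "(LINT s|lebesgue_on (plane_chart F -` F). p (plane_chart F s)) = 0"
      using zero by simp
  qed
  then show ?thesis using p(2)[OF x] s(2) by simp
qed

lemma lin_on_face_integral:
  assumes F: "planar_face F" "bounded F"
    and "\<And>v. v \<in> V \<Longrightarrow> face_cont F (G v)"
    and lin: "\<And>v w c d x. v \<in> V \<Longrightarrow> w \<in> V \<Longrightarrow> x \<in> F \<Longrightarrow>
        G (c *\<^sub>R v + d *\<^sub>R w) x = c * G v x + d * G w x"
  shows "lin_on V (\<lambda>v. face_integral F (G v))"
  unfolding face_integral_def
proof (rule lin_on_integral)
  show "integrable (lebesgue_on (plane_chart F -` F)) (\<lambda>s. G v (plane_chart F s))" if "v \<in> V" for v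
    using that by (intro face_integrable assms)
  show "G (c *\<^sub>R v + d *\<^sub>R w) (plane_chart F x) = c * G v (plane_chart F x) + d * G w (plane_chart F x)"
    if "v \<in> V" "w \<in> V" "x \<in> space (lebesgue_on (plane_chart F -` F))" for v w c d x
    using that by (intro lin) auto
qed

section \<open>Scalar polynomials\<close>

lemma prod_UNIV_3: "(\<Prod>i\<in>(UNIV::3 set). f i) = f 1 * f 2 * f 3"
  unfolding UNIV_3 by (simp add: mult.assoc)

lemma finite_mi_order_le: "finite {\<alpha>. mi_order \<alpha> \<le> l}"
proof -
  have "{\<alpha>. mi_order \<alpha> \<le> l} \<subseteq> (\<lambda>f. \<chi> i. f i) ` (UNIV \<rightarrow>\<^sub>E {..l})"
  proof
    fix \<alpha> :: "nat^3" assume "\<alpha> \<in> {\<alpha>. mi_order \<alpha> \<le> l}"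
    then have "\<alpha> $ i \<le> l" for i
      using member_le_sum[of i UNIV "\<lambda>i. \<alpha> $ i"] by (simp add: mi_order_def)
    then show "\<alpha> \<in> (\<lambda>f. \<chi> i. f i) ` (UNIV \<rightarrow>\<^sub>E {..l})"
      by (intro image_eqI[of _ _ "\<lambda>i. \<alpha> $ i"]) auto
  qed
  then show ?thesis by (rule finite_subset) (intro finite_imageI finite_PiE; simp)
qed

text \<open>The monomials with explicit exponents, for which derivatives can be written down without
  updating a multi-index.\<close>

definition monomial3 :: "nat \<Rightarrow> nat \<Rightarrow> nat \<Rightarrow> real^3 \<Rightarrow> real" where
  "monomial3 a b c = (\<lambda>x. x $ 1 ^ a * x $ 2 ^ b * x $ 3 ^ c)"

lemma subspace_poly_fun: "subspace (poly_fun l)"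
  unfolding subspace_def
proof (intro conjI ballI allI)
  show "0 \<in> poly_fun l"
    unfolding poly_fun_def by (intro CollectI exI[of _ "\<lambda>_. 0"]) (simp add: fun_eq_iff)
  fix p assume "p \<in> poly_fun l"
  then obtain c where c: "p = (\<lambda>x. \<Sum>\<alpha> | mi_order \<alpha> \<le> l. c \<alpha> * (\<Prod>i\<in>UNIV. (x $ i) ^ (\<alpha> $ i)))"
    by (auto simp: poly_fun_def)
  show "a *\<^sub>R p \<in> poly_fun l" for a
    unfolding poly_fun_def c
    by (intro CollectI exI[of _ "\<lambda>\<alpha>. a * c \<alpha>"]) (simp add: fun_eq_iff sum_distrib_left mult.assoc)
  fix q assume "q \<in> poly_fun l"
  then obtain d where d: "q = (\<lambda>x. \<Sum>\<alpha> | mi_order \<alpha> \<le> l. d \<alpha> * (\<Prod>i\<in>UNIV. (x $ i) ^ (\<alpha> $ i)))"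
    by (auto simp: poly_fun_def)
  show "p + q \<in> poly_fun l"
    unfolding poly_fun_def c d
    by (intro CollectI exI[of _ "\<lambda>\<alpha>. c \<alpha> + d \<alpha>"]) (simp add: fun_eq_iff sum.distrib distrib_right)
qed

lemma monomial3_in_poly_fun: "a + b + c \<le> l \<Longrightarrow> monomial3 a b c \<in> poly_fun l"
  unfolding poly_fun_def monomial3_def
proof (intro CollectI exI[of _ "\<lambda>\<alpha>. if \<alpha> = vector [a, b, c] then 1 else 0"] ext)
  fix x :: "real^3" assume "a + b + c \<le> l"
  then have *: "vector [a, b, c] \<in> {\<alpha>. mi_order \<alpha> \<le> l}"
    by (simp add: mi_order_def sum_3)
  show "x $ 1 ^ a * x $ 2 ^ b * x $ 3 ^ c =
      (\<Sum>\<alpha> | mi_order \<alpha> \<le> l. (if \<alpha> = vector [a, b, c] then 1 else 0) * (\<Prod>i\<in>UNIV. x $ i ^ (\<alpha> $ i)))"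
    using * finite_mi_order_le[of l]
    by (simp add: if_distrib[of "\<lambda>t. t * _"] prod_UNIV_3 mult.assoc cong: if_cong)
qed

text \<open>An induction principle: a property that is linear in the polynomial needs to be checked on
  monomials only.\<close>

lemma poly_fun_subset_subspace:
  assumes W: "subspace W" and mono: "\<And>a b c. a + b + c \<le> l \<Longrightarrow> monomial3 a b c \<in> W"
  shows "poly_fun l \<subseteq> W"
proof
  fix p assume "p \<in> poly_fun l"
  then obtain c where "p = (\<lambda>x. \<Sum>\<alpha> | mi_order \<alpha> \<le> l. c \<alpha> * (\<Prod>i\<in>UNIV. (x $ i) ^ (\<alpha> $ i)))"
    by (auto simp: poly_fun_def)
  then have "p = (\<Sum>\<alpha> | mi_order \<alpha> \<le> l. c \<alpha> *\<^sub>R monomial3 (\<alpha> $ 1) (\<alpha> $ 2) (\<alpha> $ 3))"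
    by (intro ext) (simp add: monomial3_def prod_UNIV_3 mult.assoc sum_fun_apply)
  moreover have "\<dots> \<in> W"
    using mono by (intro subspace_sum[OF W] subspace_scale[OF W]) (auto simp: mi_order_def sum_3)
  ultimately show "p \<in> W" by simp
qed

lemma finite_dim_poly_fun: "finite_dim (poly_fun l)"
  unfolding finite_dim_def
proof (rule exI, rule conjI)
  let ?S = "(\<lambda>(a, b, c). monomial3 a b c) ` ({..l} \<times> {..l} \<times> {..l})"
  show "finite ?S" by simp
  show "poly_fun l \<subseteq> span ?S"
  proof (rule poly_fun_subset_subspace)
    show "monomial3 a b c \<in> span ?S" if "a + b + c \<le> l" for a b c
      by (rule span_base, rule image_eqI[of _ _ "(a, b, c)"]) (use that in auto)
  qed simp
qed

lemma poly_fun_continuous: "p \<in> poly_fun l \<Longrightarrow> continuous_on UNIV p"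
proof -
  assume p: "p \<in> poly_fun l"
  have "subspace {p :: real^3 \<Rightarrow> real. continuous_on UNIV p}"
    by (auto simp: subspace_def zero_fun_def plus_fun_def scaleR_fun_def intro!: continuous_intros)
  then have "poly_fun l \<subseteq> {p. continuous_on UNIV p}"
    by (rule poly_fun_subset_subspace) (auto simp: monomial3_def intro!: continuous_intros)
  then show ?thesis using p by blast
qed

lemma pderiv_at_eqI: "(p has_derivative D) (at x) \<Longrightarrow> pderiv_at j p x = D (axis j 1)"
  using frechet_derivative_at[of p D x] by (simp add: pderiv_at_def)

lemma pderiv_at_comb:
  assumes "p differentiable (at x)" "q differentiable (at x)"
  shows "pderiv_at j (\<lambda>y. c * p y + d * q y) x = c * pderiv_at j p x + d * pderiv_at j q x"
proof -
  obtain D E where D: "(p has_derivative D) (at x)" and E: "(q has_derivative E) (at x)"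
    using assms by (auto simp: differentiable_def)
  have "((\<lambda>y. c * p y + d * q y) has_derivative (\<lambda>h. c * D h + d * E h)) (at x)"
    by (intro derivative_intros D E)
  from pderiv_at_eqI[OF this] show ?thesis
    by (simp add: pderiv_at_eqI[OF D] pderiv_at_eqI[OF E])
qed

lemma monomial3_has_derivative:
  "(monomial3 a b c has_derivative (\<lambda>h. h $ 1 * (a * monomial3 (a - 1) b c x) +
      h $ 2 * (b * monomial3 a (b - 1) c x) + h $ 3 * (c * monomial3 a b (c - 1) x))) (at x)"
proof -
  have nth: "((\<lambda>x :: real^3. x $ i) has_derivative (\<lambda>h. h $ i)) (at x)" for i
    by (rule bounded_linear_imp_has_derivative[OF bounded_linear_vec_nth])
  note * = has_derivative_mult[OF has_derivative_mult[OF has_derivative_power[OF nth[of 1]]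
    has_derivative_power[OF nth[of 2]]] has_derivative_power[OF nth[of 3]], of a b c]
  show ?thesis
    unfolding monomial3_def
    by (rule has_derivative_eq_rhs[OF *]) (simp add: fun_eq_iff algebra_simps)
qed

text \<open>The degree actually drops; that it does not grow is enough to use gradients of discrete
  pressures as test functions.\<close>

lemma poly_fun_derivative:
  assumes "p \<in> poly_fun l"
  shows "p differentiable (at x)" and "pderiv_at j p \<in> poly_fun l"
proof -
  let ?W = "{p. (\<forall>x. p differentiable (at x)) \<and> (\<forall>j. pderiv_at j p \<in> poly_fun l)}"
  have "subspace ?W"
    unfolding subspace_def
  proof (intro conjI ballI allI)
    have "pderiv_at j 0 = 0" for j :: 3
      by (simp add: fun_eq_iff zero_fun_def pderiv_at_eqI[OF has_derivative_const])
    then show "0 \<in> ?W"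
      using subspace_0[OF subspace_poly_fun] by (simp add: zero_fun_def)
    fix p assume p: "p \<in> ?W"
    have comb: "c *\<^sub>R p + d *\<^sub>R q \<in> ?W" if q: "q \<in> ?W" for c d q
    proof -
      have eq: "c *\<^sub>R p + d *\<^sub>R q = (\<lambda>y. c * p y + d * q y)"
        by (simp add: fun_eq_iff)
      have "pderiv_at j (c *\<^sub>R p + d *\<^sub>R q) = c *\<^sub>R pderiv_at j p + d *\<^sub>R pderiv_at j q" for j
        unfolding eq using p q by (simp add: fun_eq_iff pderiv_at_comb)
      moreover have "c *\<^sub>R pderiv_at j p + d *\<^sub>R pderiv_at j q \<in> poly_fun l" for j
        using p q subspace_poly_fun by (simp add: subspace_add subspace_scale)
      moreover have "(c *\<^sub>R p + d *\<^sub>R q) differentiable (at x)" for x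
        unfolding eq using p q by (auto intro!: derivative_intros)
      ultimately show ?thesis by simp
    qed
    show "p + q \<in> ?W" if "q \<in> ?W" for q using comb[OF that, of 1 1] by simp
    show "c *\<^sub>R p \<in> ?W" for c using comb[OF p, of c 0] by simp
  qed
  moreover have "monomial3 a b c \<in> ?W" if "a + b + c \<le> l" for a b c
  proof -
    have "pderiv_at j (monomial3 a b c) \<in> poly_fun l" for j
    proof -
      have *: "of_nat m *\<^sub>R monomial3 a' b' c' \<in> poly_fun l" if "a' + b' + c' \<le> l" for a' b' c' m
        using monomial3_in_poly_fun[OF that] subspace_poly_fun by (simp add: subspace_scale)
      have d: "pderiv_at j (monomial3 a b c) = (\<lambda>x. axis j 1 $ 1 * (a * monomial3 (a - 1) b c x) +
          axis j 1 $ 2 * (b * monomial3 a (b - 1) c x) + axis j 1 $ 3 * (c * monomial3 a b (c - 1) x))"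
        by (rule ext) (rule pderiv_at_eqI[OF monomial3_has_derivative])
      consider "j = 1" | "j = 2" | "j = 3" using exhaust_3 by blast
      then show ?thesis
        unfolding d
        using *[of "a - 1" b c a] *[of a "b - 1" c b] *[of a b "c - 1" c] that
        by cases (simp_all add: axis_def scaleR_fun_def)
    qed
    moreover have "monomial3 a b c differentiable (at x)" for x
      using monomial3_has_derivative differentiableI by blast
    ultimately show ?thesis by simp
  qed
  ultimately have "poly_fun l \<subseteq> ?W" by (rule poly_fun_subset_subspace)
  then show "p differentiable (at x)" "pderiv_at j p \<in> poly_fun l" using assms by auto
qed

lemma poly_fun_on_line:
  assumes "p \<in> poly_fun l"
  shows "\<exists>P. \<forall>t. p (a + t *\<^sub>R b) = poly P t"
proof -
  let ?W = "{p :: real^3 \<Rightarrow> real. \<exists>P. \<forall>t. p (a + t *\<^sub>R b) = poly P t}"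
  have "subspace ?W"
    unfolding subspace_def
  proof (intro conjI ballI allI)
    show "0 \<in> ?W" by (auto intro: exI[of _ 0])
    fix p assume "p \<in> ?W"
    then obtain P where P: "\<And>t. p (a + t *\<^sub>R b) = poly P t" by blast
    then show "c *\<^sub>R p \<in> ?W" for c by (auto intro: exI[of _ "smult c P"])
    fix q assume "q \<in> ?W"
    then obtain Q where "\<And>t. q (a + t *\<^sub>R b) = poly Q t" by blast
    then show "p + q \<in> ?W" using P by (auto intro: exI[of _ "P + Q"])
  qed
  moreover have "monomial3 i j k \<in> ?W" for i j k
    by (auto simp: monomial3_def
        intro!: exI[of _ "[:a $ 1, b $ 1:] ^ i * [:a $ 2, b $ 2:] ^ j * [:a $ 3, b $ 3:] ^ k"])
  ultimately have "poly_fun l \<subseteq> ?W" by (intro poly_fun_subset_subspace)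
  then show ?thesis using assms by blast
qed

text \<open>Join a point of \<open>T\<close> to \<open>y\<close> by a line. On it \<open>p\<close> is a univariate polynomial with infinitely
  many roots.\<close>

lemma poly_fun_eq_0:
  assumes p: "p \<in> poly_fun l" and T: "open T" "T \<noteq> {}" and zero: "\<And>x. x \<in> T \<Longrightarrow> p x = 0"
  shows "p y = 0"
proof -
  obtain x where "x \<in> T" using T(2) by blast
  moreover obtain e where "e > 0" "ball x e \<subseteq> T"
    using openE[OF T(1) \<open>x \<in> T\<close>] .
  ultimately have x: "x \<in> T" "e > 0" "ball x e \<subseteq> T" by auto
  obtain P where P: "\<And>t. p (x + t *\<^sub>R (y - x)) = poly P t"
    using poly_fun_on_line[OF p] by blast
  \<comment> \<open>Parameters below \<open>d\<close> stay in the ball around \<open>x\<close>; the \<open>1\<close> covers the case \<open>y = x\<close>.\<close>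
  define d where "d = e / (norm (y - x) + 1)"
  have pos: "norm (y - x) + 1 > 0" by (simp add: add_nonneg_pos)
  have d: "d > 0" using x(2) pos by (simp add: d_def)
  have "poly P t = 0" if t: "t \<in> {0<..<d}" for t
  proof -
    have "t * norm (y - x) \<le> d * norm (y - x)" using t by (intro mult_right_mono) auto
    also have "\<dots> < d * (norm (y - x) + 1)" using d by simp
    also have "\<dots> = e" using pos by (simp add: d_def)
    finally have "x + t *\<^sub>R (y - x) \<in> ball x e" using t by (simp add: dist_norm)
    then have "x + t *\<^sub>R (y - x) \<in> T" using x(3) by blast
    from zero[OF this] show ?thesis by (simp add: P)
  qed
  then have "{0<..<d} \<subseteq> {t. poly P t = 0}" by auto
  then have "infinite {t. poly P t = 0}"
    using d infinite_Ioo infinite_super by blast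
  then have "P = 0" using poly_roots_finite by blast
  then show ?thesis using P[of 1] by simp
qed

text \<open>The gradient vanishes on a ball inside \<open>T\<close>, so \<open>p\<close> is constant there, and by the identity
  theorem for polynomials it is constant everywhere.\<close>

lemma grad_eq_0_imp_constant:
  assumes p: "p \<in> poly_fun l" and T: "open T" "T \<noteq> {}" and zero: "\<And>x. x \<in> T \<Longrightarrow> grad p x = 0"
  shows "\<exists>c. \<forall>x. p x = c"
proof -
  obtain x where "x \<in> T" using T(2) by blast
  moreover obtain e where "e > 0" "ball x e \<subseteq> T"
    using openE[OF T(1) \<open>x \<in> T\<close>] .
  ultimately have x: "x \<in> T" "e > 0" "ball x e \<subseteq> T" by auto
  have "(p has_derivative (\<lambda>h. 0)) (at y within ball x e)" if y: "y \<in> ball x e" for y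
  proof -
    obtain D where D: "(p has_derivative D) (at y)"
      using poly_fun_derivative(1)[OF p] by (auto simp: differentiable_def)
    have "pderiv_at j p y = 0" for j
      using zero[of y] y x(3) by (auto simp: grad_def vec_eq_iff)
    then have ax: "D (axis j 1) = 0" for j using pderiv_at_eqI[OF D] by simp
    have "D h = 0" for h
    proof -
      have "h = (\<Sum>i\<in>UNIV. h $ i *\<^sub>R axis i 1)"
        using basis_expansion[of h] by (simp add: scalar_mult_eq_scaleR)
      then have "D h = D (\<Sum>i\<in>UNIV. h $ i *\<^sub>R axis i 1)" by simp
      also have "\<dots> = (\<Sum>i\<in>UNIV. h $ i *\<^sub>R D (axis i 1))"
        by (simp only: linear_sum[OF has_derivative_linear[OF D]] linear_scale[OF has_derivative_linear[OF D]])
      finally show ?thesis using ax by simp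
    qed
    then have "D = (\<lambda>h. 0)" by (rule ext)
    then show ?thesis using has_derivative_at_withinI[OF D] by simp
  qed
  then obtain c where c: "\<And>y. y \<in> ball x e \<Longrightarrow> p y = c"
    using has_derivative_zero_constant[OF convex_ball, of x e p] by blast
  have const: "(\<lambda>x. c) \<in> poly_fun l"
    using subspace_scale[OF subspace_poly_fun monomial3_in_poly_fun[of 0 0 0 l], of c]
    by (simp add: monomial3_def scaleR_fun_def)
  have "p - (\<lambda>x. c) \<in> poly_fun l" using subspace_diff[OF subspace_poly_fun p const] .
  then have "(p - (\<lambda>x. c)) y = 0" for y
    by (rule poly_fun_eq_0[of _ _ "ball x e"]) (use c x(2) in auto)
  then show ?thesis by auto
qed

section \<open>Vector- and matrix-valued polynomials\<close>

lemma subspace_poly_vec: "subspace (poly_vec l)"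
  and subspace_poly_mat: "subspace (poly_mat l)"
  using subspace_0[OF subspace_poly_fun, of l] subspace_add[OF subspace_poly_fun, of _ l]
    subspace_scale[OF subspace_poly_fun, of _ l]
  by (auto simp: subspace_def poly_vec_def poly_mat_def zero_fun_def plus_fun_def scaleR_fun_def)

lemma finite_dim_poly_vec: "finite_dim (poly_vec l)"
proof (rule finite_dim_sum)
  show "finite_dim ((\<lambda>p x. p x *\<^sub>R axis i 1) ` poly_fun l)" for i :: 3
    by (intro finite_dim_linear_image finite_dim_poly_fun linearI)
      (auto simp: fun_eq_iff scaleR_add_left)
  fix v assume v: "v \<in> poly_vec l"
  have "v x = (\<Sum>i\<in>UNIV. v x $ i *\<^sub>R axis i 1)" for x
    using basis_expansion[of "v x"] by (simp add: scalar_mult_eq_scaleR)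
  then have "v = (\<Sum>i\<in>UNIV. (\<lambda>x. v x $ i *\<^sub>R axis i 1))"
    by (simp add: fun_eq_iff sum_fun_apply)
  moreover have "(\<lambda>x. v x $ i *\<^sub>R axis i 1) \<in> (\<lambda>p x. p x *\<^sub>R axis i 1) ` poly_fun l" for i
    using v by (intro image_eqI[of _ _ "\<lambda>x. v x $ i"]) (auto simp: poly_vec_def)
  ultimately show "\<exists>g. v = (\<Sum>i\<in>UNIV. g i) \<and> (\<forall>i\<in>UNIV. g i \<in> (\<lambda>p x. p x *\<^sub>R axis i 1) ` poly_fun l)"
    by (intro exI[of _ "\<lambda>i x. v x $ i *\<^sub>R axis i 1"]) blast
qed simp

lemma finite_dim_poly_mat: "finite_dim (poly_mat l)"
proof (rule finite_dim_sum)
  show "finite_dim ((\<lambda>v x. axis i (v x)) ` poly_vec l)" for i :: 3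
    by (intro finite_dim_linear_image finite_dim_poly_vec linearI)
      (auto simp: fun_eq_iff axis_def vec_eq_iff)
  fix t assume t: "t \<in> poly_mat l"
  have "t = (\<Sum>i\<in>UNIV. (\<lambda>x. axis i (t x $ i)))"
    by (simp add: fun_eq_iff sum_fun_apply vec_eq_iff axis_def)
  moreover have "(\<lambda>x. axis i (t x $ i)) \<in> (\<lambda>v x. axis i (v x)) ` poly_vec l" for i
    using t by (intro image_eqI[of _ _ "\<lambda>x. t x $ i"]) (auto simp: poly_vec_def poly_mat_def)
  ultimately show "\<exists>g. t = (\<Sum>i\<in>UNIV. g i) \<and> (\<forall>i\<in>UNIV. g i \<in> (\<lambda>v x. axis i (v x)) ` poly_vec l)"
    by (intro exI[of _ "\<lambda>i x. axis i (t x $ i)"]) blast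
qed simp

lemma poly_vec_continuous: "v \<in> poly_vec l \<Longrightarrow> continuous_on UNIV v"
proof -
  assume v: "v \<in> poly_vec l"
  have "continuous_on UNIV (\<lambda>x. \<chi> i. v x $ i)"
    using v poly_fun_continuous by (intro continuous_on_vec_lambda) (auto simp: poly_vec_def)
  then show ?thesis by simp
qed

lemma poly_mat_continuous: "t \<in> poly_mat l \<Longrightarrow> continuous_on UNIV t"
proof -
  assume t: "t \<in> poly_mat l"
  have "continuous_on UNIV (\<lambda>x. \<chi> i j. t x $ i $ j)"
    using t poly_fun_continuous by (intro continuous_on_vec_lambda) (auto simp: poly_mat_def)
  then show ?thesis by simp
qed

lemma poly_vec_eq_0:
  assumes "v \<in> poly_vec l" "open T" "T \<noteq> {}" "\<And>x. x \<in> T \<Longrightarrow> v x = 0"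
  shows "v = 0"
proof -
  have "v y $ i = 0" for y i
    by (rule poly_fun_eq_0[of "\<lambda>x. v x $ i" l T]) (use assms in \<open>auto simp: poly_vec_def\<close>)
  then show ?thesis by (simp add: fun_eq_iff vec_eq_iff)
qed

lemma poly_mat_eq_0:
  assumes "t \<in> poly_mat l" "open T" "T \<noteq> {}" "\<And>x. x \<in> T \<Longrightarrow> t x = 0"
  shows "t = 0"
proof -
  have "t y $ i $ j = 0" for y i j
    by (rule poly_fun_eq_0[of "\<lambda>x. t x $ i $ j" l T]) (use assms in \<open>auto simp: poly_mat_def\<close>)
  then show ?thesis by (simp add: fun_eq_iff vec_eq_iff)
qed

lemma poly_vec_const: "(\<lambda>x. a) \<in> poly_vec l"
proof -
  have "c *\<^sub>R monomial3 0 0 0 \<in> poly_fun l" for c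
    by (intro subspace_scale[OF subspace_poly_fun] monomial3_in_poly_fun) simp
  then show ?thesis by (simp add: poly_vec_def monomial3_def scaleR_fun_def)
qed

lemma grad_poly: "p \<in> poly_fun l \<Longrightarrow> grad p \<in> poly_vec l"
  by (simp add: grad_def[abs_def] poly_vec_def poly_fun_derivative)

lemma grad_comb:
  "p \<in> poly_fun l \<Longrightarrow> q \<in> poly_fun l \<Longrightarrow> grad (c *\<^sub>R p + d *\<^sub>R q) x = c *\<^sub>R grad p x + d *\<^sub>R grad q x"
  by (simp add: grad_def vec_eq_iff plus_fun_def scaleR_fun_def
      pderiv_at_comb[OF poly_fun_derivative(1) poly_fun_derivative(1)])

lemma grad_vec_component:
  assumes v: "v \<in> poly_vec l"
  shows "grad_vec v x $ i $ j = pderiv_at j (\<lambda>y. v y $ i) x"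
proof -
  have "\<exists>D. \<forall>i. ((\<lambda>y. v y $ i) has_derivative D i) (at x)"
    using poly_fun_derivative(1)[of "\<lambda>y. v y $ _" l x] v
    by (intro choice allI) (auto simp: poly_vec_def differentiable_def)
  then obtain D where D: "\<And>i. ((\<lambda>y. v y $ i) has_derivative D i) (at x)" by blast
  have "((\<lambda>y. \<Sum>i\<in>UNIV. v y $ i *\<^sub>R axis i 1) has_derivative
      (\<lambda>h. \<Sum>i\<in>UNIV. D i h *\<^sub>R (axis i 1 :: real^3))) (at x)"
    by (intro has_derivative_sum has_derivative_scaleR_left D)
  moreover have "(\<lambda>y. \<Sum>i\<in>UNIV. v y $ i *\<^sub>R axis i 1) = v"
    using basis_expansion[of "v _"] by (simp add: scalar_mult_eq_scaleR fun_eq_iff)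
  ultimately have "(v has_derivative (\<lambda>h. \<Sum>i\<in>UNIV. D i h *\<^sub>R axis i 1)) (at x)" by simp
  from frechet_derivative_at[OF this, symmetric]
  have "grad_vec v x $ i $ j = D i (axis j 1)"
    by (simp add: grad_vec_def jacobian_def matrix_def axis_def if_distrib cong: if_cong)
  then show ?thesis by (simp add: pderiv_at_eqI[OF D])
qed

lemma grad_vec_poly:
  assumes v: "v \<in> poly_vec l"
  shows "grad_vec v \<in> poly_mat l"
proof -
  have "pderiv_at j (\<lambda>y. v y $ i) \<in> poly_fun l" for i j
    using v by (intro poly_fun_derivative) (simp add: poly_vec_def)
  then show ?thesis by (simp add: poly_mat_def grad_vec_component[OF v])
qed

lemma grad_vec_comb:
  assumes v: "v \<in> poly_vec l" and w: "w \<in> poly_vec l"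
  shows "grad_vec (c *\<^sub>R v + d *\<^sub>R w) x = c *\<^sub>R grad_vec v x + d *\<^sub>R grad_vec w x"
proof -
  have comb: "c *\<^sub>R v + d *\<^sub>R w \<in> poly_vec l"
    using v w subspace_poly_vec by (simp add: subspace_add subspace_scale)
  have "pderiv_at j (\<lambda>y. c * v y $ i + d * w y $ i) x
      = c * pderiv_at j (\<lambda>y. v y $ i) x + d * pderiv_at j (\<lambda>y. w y $ i) x" for i j
    using v w by (intro pderiv_at_comb poly_fun_derivative(1)[of _ l]) (auto simp: poly_vec_def)
  then show ?thesis
    by (simp add: vec_eq_iff grad_vec_component[OF comb] grad_vec_component[OF v] grad_vec_component[OF w])
qed

lemma grad_vec_eq_0_imp_constant:
  assumes v: "v \<in> poly_vec l" and T: "open T" "T \<noteq> {}" and zero: "\<And>x. x \<in> T \<Longrightarrow> grad_vec v x = 0"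
  shows "\<exists>a. \<forall>x. v x = a"
proof -
  have "\<exists>a. \<forall>x. v x $ i = a" for i
  proof (rule grad_eq_0_imp_constant[OF _ T])
    show "(\<lambda>x. v x $ i) \<in> poly_fun l" using v by (simp add: poly_vec_def)
    show "grad (\<lambda>x. v x $ i) x = 0" if "x \<in> T" for x
      using zero[OF that] by (simp add: grad_def vec_eq_iff grad_vec_component[OF v])
  qed
  then obtain a where "\<And>i x. v x $ i = a i" by metis
  then have "v x = (\<chi> i. a i)" for x by (simp add: vec_eq_iff)
  then show ?thesis by blast
qed

lemma div_mat_poly:
  assumes "t \<in> poly_mat l"
  shows "div_mat t \<in> poly_vec l"
proof -
  have "(\<lambda>x. \<Sum>j\<in>UNIV. pderiv_at j (\<lambda>y. t y $ i $ j) x) = (\<Sum>j\<in>UNIV. pderiv_at j (\<lambda>y. t y $ i $ j))" for i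
    by (simp add: fun_eq_iff sum_fun_apply)
  moreover have "\<dots> i \<in> poly_fun l" for i
    using assms by (intro subspace_sum[OF subspace_poly_fun] poly_fun_derivative) (simp add: poly_mat_def)
  ultimately show ?thesis by (simp add: div_mat_def[abs_def] poly_vec_def)
qed

lemma div_mat_comb:
  assumes "s \<in> poly_mat l" "t \<in> poly_mat l"
  shows "div_mat (c *\<^sub>R s + d *\<^sub>R t) x = c *\<^sub>R div_mat s x + d *\<^sub>R div_mat t x"
proof -
  have "pderiv_at j (\<lambda>y. c * s y $ i $ j + d * t y $ i $ j) x
      = c * pderiv_at j (\<lambda>y. s y $ i $ j) x + d * pderiv_at j (\<lambda>y. t y $ i $ j) x" for i j
    using assms by (intro pderiv_at_comb poly_fun_derivative(1)[of _ l]) (auto simp: poly_mat_def)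
  then show ?thesis
    by (simp add: vec_eq_iff div_mat_def sum.distrib sum_distrib_left)
qed

lemma matrix_vector_comb:
  fixes A B :: "real^3^3"
  shows "(c *\<^sub>R A + d *\<^sub>R B) *v x = c *\<^sub>R (A *v x) + d *\<^sub>R (B *v x)"
    and "A *v (c *\<^sub>R x + d *\<^sub>R y) = c *\<^sub>R (A *v x) + d *\<^sub>R (A *v y)"
  by (simp_all add: vec_eq_iff matrix_vector_mult_def sum.distrib sum_distrib_left algebra_simps)

lemma continuous_on_matrix_vector:
  fixes A :: "real^3 \<Rightarrow> real^3^3"
  assumes "continuous_on UNIV A" "continuous_on UNIV v"
  shows "continuous_on UNIV (\<lambda>x. A x *v v x)"
  unfolding matrix_vector_mult_def by (intro continuous_intros assms)

lemma subspace_poly_faces: "subspace (poly_faces l G)"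
  unfolding subspace_def poly_faces_def
proof (safe)
  fix F assume "F \<in> G"
  show "\<exists>p\<in>poly_vec l. \<forall>x\<in>F. (0 :: real^3 \<Rightarrow> real^3) x = p x"
    using poly_vec_const[of 0 l] by auto
next
  fix v w F
  assume "\<forall>F\<in>G. \<exists>p\<in>poly_vec l. \<forall>x\<in>F. v x = p x" "\<forall>F\<in>G. \<exists>p\<in>poly_vec l. \<forall>x\<in>F. w x = p x"
    and "F \<in> G"
  then obtain p q where "p \<in> poly_vec l" "q \<in> poly_vec l" "\<forall>x\<in>F. v x = p x" "\<forall>x\<in>F. w x = q x"
    by blast
  then show "\<exists>p\<in>poly_vec l. \<forall>x\<in>F. (v + w) x = p x"
    using subspace_add[OF subspace_poly_vec] by (intro bexI[of _ "p + q"]) auto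
next
  fix c v F
  assume "\<forall>F\<in>G. \<exists>p\<in>poly_vec l. \<forall>x\<in>F. v x = p x" and "F \<in> G"
  then obtain p where "p \<in> poly_vec l" "\<forall>x\<in>F. v x = p x"
    by blast
  then show "\<exists>p\<in>poly_vec l. \<forall>x\<in>F. (c *\<^sub>R v) x = p x"
    using subspace_scale[OF subspace_poly_vec] by (intro bexI[of _ "c *\<^sub>R p"]) auto
qed auto

lemma finite_dim_poly_faces_single: "finite_dim (poly_faces l {F})"
proof (rule finite_dim_mono)
  show "finite_dim ((\<lambda>p x. if x \<in> F then p x else 0) ` poly_vec l)"
    by (intro finite_dim_linear_image finite_dim_poly_vec linearI) (auto simp: fun_eq_iff)
  show "poly_faces l {F} \<subseteq> (\<lambda>p x. if x \<in> F then p x else 0) ` poly_vec l"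
  proof
    fix v assume v: "v \<in> poly_faces l {F}"
    then obtain p where "p \<in> poly_vec l" "\<forall>x\<in>F. v x = p x" "\<forall>x. x \<notin> F \<longrightarrow> v x = 0"
      by (auto simp: poly_faces_def)
    then show "v \<in> (\<lambda>p x. if x \<in> F then p x else 0) ` poly_vec l"
      by (intro image_eqI[of _ _ p]) (auto simp: fun_eq_iff)
  qed
qed

lemma subspace_U_loc: "subspace (U_loc k \<F> T)"
  unfolding U_loc_def by (intro subspace_Times subspace_poly_vec subspace_poly_faces)

section \<open>Local operators\<close>

text \<open>Relates the linearity assumed for the stabilisation to the vector space structure.\<close>

lemma lin_comb_eq: "lin_comb c u d v = c *\<^sub>R u + d *\<^sub>R v"
  by (simp add: lin_comb_def prod_eq_iff fun_eq_iff)

text \<open>What the local operators need from an element. Constancy of the outer normal on the faces makes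
  the boundary integrands integrable.\<close>

locale mesh_element =
  fixes \<F> :: "(real^3) set set" and T :: "(real^3) set"
  assumes T: "open T" "T \<noteq> {}" "bounded T"
    and faces: "finite (faces_of_elt \<F> T)"
      "\<And>F. F \<in> faces_of_elt \<F> T \<Longrightarrow> planar_face F" "\<And>F. F \<in> faces_of_elt \<F> T \<Longrightarrow> bounded F"
    and normal: "\<And>F. F \<in> faces_of_elt \<F> T \<Longrightarrow> \<exists>n. \<forall>x\<in>F. outer_normal T x = n"
begin

lemma integrable_continuous:
  fixes f :: "real^3 \<Rightarrow> 'b::euclidean_space"
  shows "continuous_on UNIV f \<Longrightarrow> integrable (lebesgue_on T) f"
  by (rule integrable_continuous_bounded_open[OF T(1,3)])

lemma lin_on_L2_inner:
  fixes G :: "'v::real_vector \<Rightarrow> real^3 \<Rightarrow> 'b::euclidean_space"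
  assumes "\<And>v. v \<in> V \<Longrightarrow> continuous_on UNIV (G v)" "continuous_on UNIV u"
    and lin: "\<And>v w c d x. v \<in> V \<Longrightarrow> w \<in> V \<Longrightarrow> G (c *\<^sub>R v + d *\<^sub>R w) x = c *\<^sub>R G v x + d *\<^sub>R G w x"
  shows "lin_on V (\<lambda>v. L2_inner T (G v) u)" and "lin_on V (\<lambda>v. L2_inner T u (G v))"
proof -
  show left: "lin_on V (\<lambda>v. L2_inner T (G v) u)"
    unfolding L2_inner_def
  proof (rule lin_on_integral)
    show "integrable (lebesgue_on T) (\<lambda>x. G v x \<bullet> u x)" if "v \<in> V" for v
      by (intro integrable_continuous continuous_on_inner assms that)
  qed (simp add: lin inner_add_left)
  then show "lin_on V (\<lambda>v. L2_inner T u (G v))"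
    by (simp add: L2_inner_def inner_commute)
qed

lemma poly_face_cont:
  "p \<in> poly_fun l \<Longrightarrow> face_cont F p" "t \<in> poly_mat l \<Longrightarrow> face_cont F t"
  by (simp_all add: face_cont_continuous poly_fun_continuous poly_mat_continuous)

lemma L2_inner_commute: "L2_inner T u v = L2_inner T v u"
  by (simp add: L2_inner_def inner_commute)

lemma L2_inner_eq_0:
  fixes u :: "real^3 \<Rightarrow> 'b::euclidean_space"
  assumes "continuous_on UNIV u" "L2_inner T u u = 0" "x \<in> T"
  shows "u x = 0"
proof -
  have "u x \<bullet> u x = 0"
    by (rule integral_continuous_eq_0[OF T(1,3), of "\<lambda>x. u x \<bullet> u x"])
      (use assms in \<open>auto simp: L2_inner_def intro: continuous_intros\<close>)
  then show ?thesis by simp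
qed

lemma L2_inner_cong:
  "(\<And>x. x \<in> T \<Longrightarrow> u x = u' x) \<Longrightarrow> (\<And>x. x \<in> T \<Longrightarrow> v x = v' x) \<Longrightarrow> L2_inner T u v = L2_inner T u' v'"
  unfolding L2_inner_def by (intro Bochner_Integration.integral_cong) auto

lemma lin_on_bdry_integral:
  assumes "\<And>v F. v \<in> V \<Longrightarrow> F \<in> faces_of_elt \<F> T \<Longrightarrow> face_cont F (G v)"
    and "\<And>v w c d x. v \<in> V \<Longrightarrow> w \<in> V \<Longrightarrow> G (c *\<^sub>R v + d *\<^sub>R w) x = c * G v x + d * G w x"
  shows "lin_on V (\<lambda>v. bdry_integral \<F> T (G v))"
  unfolding bdry_integral_def
  by (intro lin_on_sum lin_on_face_integral faces assms)

lemma U_loc_parts: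
  assumes "v \<in> U_loc k \<F> T"
  shows "fst v \<in> poly_vec k" "continuous_on UNIV (fst v)"
    "F \<in> faces_of_elt \<F> T \<Longrightarrow> face_cont F (snd v)"
proof -
  show p: "fst v \<in> poly_vec k" using assms by (auto simp: U_loc_def)
  show "continuous_on UNIV (fst v)" by (rule poly_vec_continuous[OF p])
  assume "F \<in> faces_of_elt \<F> T"
  then obtain q where "q \<in> poly_vec k" "\<forall>x\<in>F. snd v x = q x"
    using assms by (auto simp: U_loc_def poly_faces_def)
  then show "face_cont F (snd v)"
    unfolding face_cont_def using poly_vec_continuous by blast
qed

lemma normal_face_cont: "F \<in> faces_of_elt \<F> T \<Longrightarrow> face_cont F (outer_normal T)"
  using normal face_cont_const_on by metis

lemma L2_inner_bilinear:
  fixes V :: "(real^3 \<Rightarrow> 'b::euclidean_space) set"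
  assumes "\<And>v. v \<in> V \<Longrightarrow> continuous_on UNIV v"
  shows "bilinear_on V V (L2_inner T)"
  unfolding bilinear_on_def by (intro conjI ballI lin_on_L2_inner assms) simp_all

lemma poly_fun_L2_bilinear: "bilinear_on (poly_fun l) (poly_fun l) (L2_inner T)"
  and poly_mat_L2_bilinear: "bilinear_on (poly_mat l) (poly_mat l) (L2_inner T)"
  by (intro L2_inner_bilinear poly_fun_continuous poly_mat_continuous, assumption)+

lemma disc_div_functional_bilinear:
  "bilinear_on (U_loc k \<F> T) (poly_fun k)
     (\<lambda>v q. - L2_inner T (fst v) (grad q)
            + bdry_integral \<F> T (\<lambda>x. (snd v x \<bullet> outer_normal T x) * q x))"
  unfolding bilinear_on_def
proof (intro conjI ballI lin_on_plus lin_on_uminus)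
  fix q assume q: "q \<in> poly_fun k"
  show "lin_on (U_loc k \<F> T) (\<lambda>v. L2_inner T (fst v) (grad q))"
    by (rule lin_on_L2_inner) (simp_all add: U_loc_parts poly_vec_continuous[OF grad_poly[OF q]])
  show "lin_on (U_loc k \<F> T) (\<lambda>v. bdry_integral \<F> T (\<lambda>x. (snd v x \<bullet> outer_normal T x) * q x))"
    by (rule lin_on_bdry_integral,
        rule face_cont_mult[OF face_cont_inner[OF U_loc_parts(3) normal_face_cont] poly_face_cont(1)[OF q]])
      (simp_all add: inner_add_left algebra_simps)
next
  fix v assume v: "v \<in> U_loc k \<F> T"
  show "lin_on (poly_fun k) (\<lambda>q. L2_inner T (fst v) (grad q))"
    by (rule lin_on_L2_inner)
      (simp_all add: U_loc_parts[OF v] poly_vec_continuous[OF grad_poly] grad_comb[unfolded plus_fun_def scaleR_fun_def] grad_comb)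
  show "lin_on (poly_fun k) (\<lambda>q. bdry_integral \<F> T (\<lambda>x. (snd v x \<bullet> outer_normal T x) * q x))"
    by (rule lin_on_bdry_integral,
        rule face_cont_mult[OF face_cont_inner[OF U_loc_parts(3)[OF v] normal_face_cont] poly_face_cont(1)])
      (simp_all add: algebra_simps)
qed

lemma poly_fun_L2_aniso:
  assumes "p \<in> poly_fun l" "L2_inner T p p = 0"
  shows "p = 0"
  using poly_fun_eq_0[OF assms(1) T(1,2)] L2_inner_eq_0[OF poly_fun_continuous[OF assms(1)] assms(2)]
  by (simp add: fun_eq_iff)

lemmas disc_div_solution = solution_operator_linear[OF subspace_poly_fun finite_dim_poly_fun
    poly_fun_L2_bilinear poly_fun_L2_aniso subspace_U_loc disc_div_functional_bilinear disc_div_def]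

lemma disc_div:
  shows "v \<in> U_loc k \<F> T \<Longrightarrow> disc_div k \<F> T v \<in> poly_fun k"
    and "v \<in> U_loc k \<F> T \<Longrightarrow> q \<in> poly_fun k \<Longrightarrow>
      L2_inner T (disc_div k \<F> T v) q = - L2_inner T (fst v) (grad q)
        + bdry_integral \<F> T (\<lambda>x. (snd v x \<bullet> outer_normal T x) * q x)"
    and "v \<in> U_loc k \<F> T \<Longrightarrow> w \<in> U_loc k \<F> T \<Longrightarrow>
      disc_div k \<F> T (c *\<^sub>R v + d *\<^sub>R w) = c *\<^sub>R disc_div k \<F> T v + d *\<^sub>R disc_div k \<F> T w"
  by ((rule disc_div_solution(1); assumption), (rule disc_div_solution(2); assumption), (rule disc_div_solution(3); assumption))

lemma disc_grad_functional_bilinear: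
  "bilinear_on (U_loc k \<F> T) (poly_mat l)
     (\<lambda>v \<tau>. - L2_inner T (fst v) (div_mat \<tau>)
            + bdry_integral \<F> T (\<lambda>x. snd v x \<bullet> (\<tau> x *v outer_normal T x)))"
  unfolding bilinear_on_def
proof (intro conjI ballI lin_on_plus lin_on_uminus)
  fix \<tau> :: "real^3 \<Rightarrow> real^3^3" assume t: "\<tau> \<in> poly_mat l"
  show "lin_on (U_loc k \<F> T) (\<lambda>v. L2_inner T (fst v) (div_mat \<tau>))"
    by (rule lin_on_L2_inner) (simp_all add: U_loc_parts poly_vec_continuous[OF div_mat_poly[OF t]])
  show "lin_on (U_loc k \<F> T) (\<lambda>v. bdry_integral \<F> T (\<lambda>x. snd v x \<bullet> (\<tau> x *v outer_normal T x)))"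
    by (rule lin_on_bdry_integral,
        rule face_cont_inner[OF U_loc_parts(3) face_cont_matrix_vector[OF poly_face_cont(2)[OF t] normal_face_cont]])
      (simp_all add: inner_add_left)
next
  fix v assume v: "v \<in> U_loc k \<F> T"
  show "lin_on (poly_mat l) (\<lambda>\<tau>. L2_inner T (fst v) (div_mat \<tau>))"
    by (rule lin_on_L2_inner)
      (simp_all add: U_loc_parts[OF v] poly_vec_continuous[OF div_mat_poly] div_mat_comb)
  show "lin_on (poly_mat l) (\<lambda>\<tau>. bdry_integral \<F> T (\<lambda>x. snd v x \<bullet> (\<tau> x *v outer_normal T x)))"
    by (rule lin_on_bdry_integral,
        rule face_cont_inner[OF U_loc_parts(3)[OF v] face_cont_matrix_vector[OF poly_face_cont(2) normal_face_cont]])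
      (simp_all add: matrix_vector_comb inner_add_right)
qed

lemma poly_mat_L2_aniso:
  assumes "p \<in> poly_mat l" "L2_inner T p p = 0"
  shows "p = 0"
  using poly_mat_eq_0[OF assms(1) T(1,2)] L2_inner_eq_0[OF poly_mat_continuous[OF assms(1)] assms(2)]
  by simp

lemmas disc_grad_solution = solution_operator_linear[OF subspace_poly_mat finite_dim_poly_mat
    poly_mat_L2_bilinear poly_mat_L2_aniso subspace_U_loc disc_grad_functional_bilinear disc_grad_def]

lemma disc_grad:
  shows "v \<in> U_loc k \<F> T \<Longrightarrow> disc_grad k \<F> T v \<in> poly_mat (2 * k)"
    and "v \<in> U_loc k \<F> T \<Longrightarrow> w \<in> U_loc k \<F> T \<Longrightarrow>
      disc_grad k \<F> T (c *\<^sub>R v + d *\<^sub>R w) = c *\<^sub>R disc_grad k \<F> T v + d *\<^sub>R disc_grad k \<F> T w"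
  by ((rule disc_grad_solution(1); assumption), (rule disc_grad_solution(3); assumption))

text \<open>A form of rank three that controls the constants, on which the energy of the gradient
  degenerates.\<close>

definition mean_form :: "(real^3 \<Rightarrow> real^3) \<Rightarrow> (real^3 \<Rightarrow> real^3) \<Rightarrow> real" where
  "mean_form v w = (LINT x|lebesgue_on T. v x) \<bullet> (LINT x|lebesgue_on T. w x)"

lemma lin_on_mean_form:
  assumes "\<And>v. v \<in> V \<Longrightarrow> continuous_on UNIV (G v)"
    and lin: "\<And>v w c d x. v \<in> V \<Longrightarrow> w \<in> V \<Longrightarrow> G (c *\<^sub>R v + d *\<^sub>R w) x = c *\<^sub>R G v x + d *\<^sub>R G w x"
  shows "lin_on V (\<lambda>v. mean_form (G v) u)" "lin_on V (\<lambda>v. mean_form u (G v))"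
proof -
  have "(LINT x|lebesgue_on T. G (c *\<^sub>R v + d *\<^sub>R w) x)
      = c *\<^sub>R (LINT x|lebesgue_on T. G v x) + d *\<^sub>R (LINT x|lebesgue_on T. G w x)"
    if "v \<in> V" "w \<in> V" for v w c d
    using that by (simp add: lin integrable_continuous assms(1))
  then show "lin_on V (\<lambda>v. mean_form (G v) u)" "lin_on V (\<lambda>v. mean_form u (G v))"
    by (simp_all add: lin_on_def mean_form_def inner_add_left inner_add_right)
qed

text \<open>The reconstruction is defined by an equation for gradients together with a condition on the
  mean. Adding \<open>mean_form\<close> on both sides merges them into one equation with a definite form.\<close>

definition recon_form :: "(real^3 \<Rightarrow> real^3) \<Rightarrow> (real^3 \<Rightarrow> real^3) \<Rightarrow> real" where
  "recon_form r w = L2_inner T (grad_vec r) (grad_vec w) + mean_form r w"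

definition recon_functional :: "local_dofs \<Rightarrow> (real^3 \<Rightarrow> real^3) \<Rightarrow> real" where
  "recon_functional v w = L2_inner T (grad_vec (fst v)) (grad_vec w)
     + bdry_integral \<F> T (\<lambda>x. (snd v x - fst v x) \<bullet> (grad_vec w x *v outer_normal T x))
     + mean_form (fst v) w"

lemma measure_pos: "measure (lebesgue_on T) T > 0"
proof -
  have "T \<in> lmeasurable" using T by (simp add: lmeasurable_open)
  moreover have "\<not> negligible T" using T open_not_negligible by blast
  ultimately have "measure lebesgue T > 0"
    using negligible_iff_measure zero_less_measure_iff by blast
  then show ?thesis using T by (simp add: measure_restrict_space)
qed

text \<open>Testing with a constant separates the mean condition again: the gradient terms vanish, and what
  is left says that the difference of the means is orthogonal to every constant.\<close>

lemma recon_eq_the: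
  assumes v: "v \<in> U_loc k \<F> T"
  shows "recon k \<F> T v =
    (THE r. r \<in> poly_vec (k + 1) \<and> (\<forall>w\<in>poly_vec (k + 1). recon_form r w = recon_functional v w))"
  unfolding recon_def
proof (rule arg_cong[where f = The], rule ext, rule conj_cong[OF refl])
  fix r assume r: "r \<in> poly_vec (k + 1)"
  let ?grad_eq = "\<lambda>w. L2_inner T (grad_vec r) (grad_vec w) = L2_inner T (grad_vec (fst v)) (grad_vec w)
     + bdry_integral \<F> T (\<lambda>x. (snd v x - fst v x) \<bullet> (grad_vec w x *v outer_normal T x))"
  have diff: "(LINT x|lebesgue_on T. r x - fst v x) = (LINT x|lebesgue_on T. r x) - (LINT x|lebesgue_on T. fst v x)"
    by (intro Bochner_Integration.integral_diff integrable_continuous poly_vec_continuous[OF r] U_loc_parts[OF v])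
  show "((\<forall>w\<in>poly_vec (k + 1). ?grad_eq w) \<and> (LINT x|lebesgue_on T. r x - fst v x) = 0)
      = (\<forall>w\<in>poly_vec (k + 1). recon_form r w = recon_functional v w)"
  proof
    assume "(\<forall>w\<in>poly_vec (k + 1). ?grad_eq w) \<and> (LINT x|lebesgue_on T. r x - fst v x) = 0"
    then show "\<forall>w\<in>poly_vec (k + 1). recon_form r w = recon_functional v w"
      unfolding diff by (simp add: recon_form_def recon_functional_def mean_form_def)
  next
    assume *: "\<forall>w\<in>poly_vec (k + 1). recon_form r w = recon_functional v w"
    define a where "a = (LINT x|lebesgue_on T. r x) - (LINT x|lebesgue_on T. fst v x)"
    have "grad_vec (\<lambda>x. a) x = 0" for x
      by (simp add: vec_eq_iff grad_vec_component[OF poly_vec_const] pderiv_at_eqI[OF has_derivative_const])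
    then have "mean_form r (\<lambda>x. a) = mean_form (fst v) (\<lambda>x. a)"
      using *[rule_format, OF poly_vec_const[of a]]
      by (simp add: recon_form_def recon_functional_def L2_inner_def bdry_integral_def face_integral_def)
    then have "measure (lebesgue_on T) T * (a \<bullet> a) = 0"
      by (simp add: mean_form_def a_def inner_diff_left algebra_simps)
    then have "a = 0" using measure_pos by simp
    then have "(LINT x|lebesgue_on T. r x) = (LINT x|lebesgue_on T. fst v x)" by (simp add: a_def)
    then show "(\<forall>w\<in>poly_vec (k + 1). ?grad_eq w) \<and> (LINT x|lebesgue_on T. r x - fst v x) = 0"
      unfolding diff using * by (simp add: recon_form_def recon_functional_def mean_form_def)
  qed
qed

lemma recon_form_bilinear: "bilinear_on (poly_vec l) (poly_vec l) recon_form"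
  unfolding bilinear_on_def recon_form_def
  by (intro conjI ballI lin_on_plus lin_on_L2_inner lin_on_mean_form;
      (simp add: grad_vec_comb poly_vec_continuous poly_mat_continuous[OF grad_vec_poly]))

text \<open>A vanishing gradient leaves a constant, and a vanishing mean leaves \<open>0\<close>.\<close>

lemma recon_form_aniso:
  assumes r: "r \<in> poly_vec l" and zero: "recon_form r r = 0"
  shows "r = 0"
proof -
  have nn: "L2_inner T (grad_vec r) (grad_vec r) \<ge> 0" "mean_form r r \<ge> 0"
    by (auto simp: L2_inner_def mean_form_def intro!: Bochner_Integration.integral_nonneg)
  then have z: "L2_inner T (grad_vec r) (grad_vec r) = 0" "mean_form r r = 0"
    using zero by (auto simp: recon_form_def)
  obtain a where a: "\<And>x. r x = a"
    using grad_vec_eq_0_imp_constant[OF r T(1,2)]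
      L2_inner_eq_0[OF poly_mat_continuous[OF grad_vec_poly[OF r]] z(1)] by blast
  then have "r = (\<lambda>x. a)" by (simp add: fun_eq_iff)
  then have "a = 0" using z(2) measure_pos by (simp add: mean_form_def)
  then show ?thesis using a by (simp add: fun_eq_iff)
qed

lemma recon_functional_bilinear: "bilinear_on (U_loc k \<F> T) (poly_vec l) recon_functional"
  unfolding bilinear_on_def recon_functional_def
proof (intro conjI ballI lin_on_plus)
  fix w :: "real^3 \<Rightarrow> real^3" assume w: "w \<in> poly_vec l"
  note gw = poly_mat_continuous[OF grad_vec_poly[OF w]]
  show "lin_on (U_loc k \<F> T) (\<lambda>v. L2_inner T (grad_vec (fst v)) (grad_vec w))"
    by (rule lin_on_L2_inner)
      (simp_all add: gw poly_mat_continuous[OF grad_vec_poly[OF U_loc_parts(1)]]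
        grad_vec_comb[OF U_loc_parts(1) U_loc_parts(1)])
  show "lin_on (U_loc k \<F> T) (\<lambda>v. bdry_integral \<F> T (\<lambda>x. (snd v x - fst v x) \<bullet> (grad_vec w x *v outer_normal T x)))"
    by (rule lin_on_bdry_integral,
        rule face_cont_inner[OF face_cont_diff[OF U_loc_parts(3) face_cont_continuous[OF U_loc_parts(2)]]
          face_cont_matrix_vector[OF face_cont_continuous[OF gw] normal_face_cont]])
      (simp_all add: inner_add_left inner_diff_left algebra_simps)
  show "lin_on (U_loc k \<F> T) (\<lambda>v. mean_form (fst v) w)"
    by (rule lin_on_mean_form) (simp_all add: U_loc_parts)
next
  fix v assume v: "v \<in> U_loc k \<F> T"
  note gv = poly_mat_continuous[OF grad_vec_poly[OF U_loc_parts(1)[OF v]]]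
  show "lin_on (poly_vec l) (\<lambda>w. L2_inner T (grad_vec (fst v)) (grad_vec w))"
    by (rule lin_on_L2_inner) (simp_all add: gv poly_mat_continuous[OF grad_vec_poly] grad_vec_comb)
  show "lin_on (poly_vec l) (\<lambda>w. bdry_integral \<F> T (\<lambda>x. (snd v x - fst v x) \<bullet> (grad_vec w x *v outer_normal T x)))"
    by (rule lin_on_bdry_integral,
        rule face_cont_inner[OF face_cont_diff[OF U_loc_parts(3)[OF v] face_cont_continuous[OF U_loc_parts(2)[OF v]]]
          face_cont_matrix_vector[OF poly_face_cont(2)[OF grad_vec_poly] normal_face_cont]])
      (simp_all add: grad_vec_comb matrix_vector_comb inner_add_right)
  show "lin_on (poly_vec l) (\<lambda>w. mean_form (fst v) w)"
    by (rule lin_on_mean_form) (simp_all add: poly_vec_continuous)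
qed

lemmas recon_solution = solution_operator_linear[OF subspace_poly_vec finite_dim_poly_vec
    recon_form_bilinear recon_form_aniso subspace_U_loc recon_functional_bilinear recon_eq_the]

lemma recon:
  shows "v \<in> U_loc k \<F> T \<Longrightarrow> recon k \<F> T v \<in> poly_vec (k + 1)"
    and "v \<in> U_loc k \<F> T \<Longrightarrow> w \<in> U_loc k \<F> T \<Longrightarrow>
      recon k \<F> T (c *\<^sub>R v + d *\<^sub>R w) = c *\<^sub>R recon k \<F> T v + d *\<^sub>R recon k \<F> T w"
  by ((rule recon_solution(1); assumption), (rule recon_solution(3); assumption))

lemma a_loc_bilinear:
  assumes s: "sym_psd_bilinear (U_loc k \<F> T) s"
  shows "bilinear_on (U_loc k \<F> T) (U_loc k \<F> T) (a_loc k \<F> s T)"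
    and "u \<in> U_loc k \<F> T \<Longrightarrow> v \<in> U_loc k \<F> T \<Longrightarrow> a_loc k \<F> s T u v = a_loc k \<F> s T v u"
proof -
  let ?U = "U_loc k \<F> T"
  have s1: "lin_on ?U (\<lambda>u. s u v)" and sym: "s u v = s v u" if "u \<in> ?U" "v \<in> ?U" for u v
    using s that by (auto simp: sym_psd_bilinear_def lin_on_def lin_comb_eq)
  have s2: "lin_on ?U (s u)" if "u \<in> ?U" for u
    using s1[OF that that] sym[OF that] subspace_U_loc[of k \<F> T]
    by (simp add: lin_on_def subspace_add subspace_scale)
  show "bilinear_on ?U ?U (a_loc k \<F> s T)"
    unfolding bilinear_on_def a_loc_def
    by (intro conjI ballI lin_on_plus lin_on_L2_inner s1 s2; assumption?)
      (simp_all add: poly_mat_continuous[OF grad_vec_poly[OF recon(1)]] recon(2) grad_vec_comb[OF recon(1) recon(1)])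
  show "u \<in> ?U \<Longrightarrow> v \<in> ?U \<Longrightarrow> a_loc k \<F> s T u v = a_loc k \<F> s T v u"
    unfolding a_loc_def using sym L2_inner_commute by metis
qed

lemma t_loc_trilinear:
  fixes k
  defines "U \<equiv> U_loc k \<F> T"
  shows "w \<in> U \<Longrightarrow> z \<in> U \<Longrightarrow> lin_on U (\<lambda>v. t_loc k \<F> T v w z)"
    and "v \<in> U \<Longrightarrow> bilinear_on U U (t_loc k \<F> T v)"
proof -
  have cG: "continuous_on UNIV (disc_grad k \<F> T w)" if "w \<in> U" for w
    using poly_mat_continuous[OF disc_grad(1)] that by (simp add: U_def)
  have lG: "disc_grad k \<F> T (c *\<^sub>R w + d *\<^sub>R z) = c *\<^sub>R disc_grad k \<F> T w + d *\<^sub>R disc_grad k \<F> T z"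
    if "w \<in> U" "z \<in> U" for w z c d
    using disc_grad(2) that by (simp add: U_def)
  have c1: "continuous_on UNIV (fst v)" if "v \<in> U" for v
    using U_loc_parts(2) that by (simp add: U_def)
  note cs = cG c1 continuous_on_matrix_vector
  show "lin_on U (\<lambda>v. t_loc k \<F> T v w z)" if "w \<in> U" "z \<in> U" for w z
    unfolding t_loc_def using that
    by (intro lin_on_cmult lin_on_minus lin_on_L2_inner) (auto intro!: cs simp: matrix_vector_comb)
  show "bilinear_on U U (t_loc k \<F> T v)" if "v \<in> U" for v
    unfolding t_loc_def bilinear_on_def using that
    by (intro conjI ballI lin_on_cmult lin_on_minus lin_on_L2_inner)
      (auto intro!: cs simp: matrix_vector_comb lG)
qed

lemma t_loc_skew: "t_loc k \<F> T v w z = - t_loc k \<F> T v z w"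
  unfolding t_loc_def by argo

text \<open>Pressures are polynomial on each element but not globally, and only their values on \<open>T\<close>
  enter the local form.\<close>

definition elt_poly :: "nat \<Rightarrow> (real^3 \<Rightarrow> real) set" where
  "elt_poly k = {q. \<exists>p\<in>poly_fun k. \<forall>x\<in>T. q x = p x}"

lemma d_loc_bilinear: "bilinear_on (U_loc k \<F> T) (elt_poly k) (d_loc k \<F> T)"
  unfolding bilinear_on_def
proof (intro conjI ballI)
  fix q assume "q \<in> elt_poly k"
  then obtain p where p: "p \<in> poly_fun k" "\<forall>x\<in>T. q x = p x" by (auto simp: elt_poly_def)
  have "d_loc k \<F> T v q = - L2_inner T (disc_div k \<F> T v) p" for v
    unfolding d_loc_def using L2_inner_cong[OF refl, of q p] p(2) by auto
  moreover have "lin_on (U_loc k \<F> T) (\<lambda>v. - L2_inner T (disc_div k \<F> T v) p)"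
    by (intro lin_on_uminus lin_on_L2_inner)
      (simp_all add: poly_fun_continuous[OF disc_div(1)] poly_fun_continuous[OF p(1)] disc_div(3))
  ultimately show "lin_on (U_loc k \<F> T) (\<lambda>v. d_loc k \<F> T v q)" by simp
next
  fix v assume v: "v \<in> U_loc k \<F> T"
  show "lin_on (elt_poly k) (d_loc k \<F> T v)"
    unfolding lin_on_def
  proof (intro ballI allI)
    fix q q' c d assume "q \<in> elt_poly k" "q' \<in> elt_poly k"
    then obtain p p' where p: "p \<in> poly_fun k" "\<forall>x\<in>T. q x = p x" "p' \<in> poly_fun k" "\<forall>x\<in>T. q' x = p' x"
      by (auto simp: elt_poly_def)
    have "d_loc k \<F> T v q = d_loc k \<F> T v p" "d_loc k \<F> T v q' = d_loc k \<F> T v p'"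
      "d_loc k \<F> T v (c *\<^sub>R q + d *\<^sub>R q') = d_loc k \<F> T v (c *\<^sub>R p + d *\<^sub>R p')"
      unfolding d_loc_def
      using L2_inner_cong[OF refl, of q p] L2_inner_cong[OF refl, of q' p']
        L2_inner_cong[OF refl, of "c *\<^sub>R q + d *\<^sub>R q'" "c *\<^sub>R p + d *\<^sub>R p'"] p by auto
    moreover have "lin_on (poly_fun k) (d_loc k \<F> T v)"
      unfolding d_loc_def
      by (intro lin_on_uminus lin_on_L2_inner)
        (simp_all add: poly_fun_continuous[OF disc_div(1)[OF v]] poly_fun_continuous)
    ultimately show "d_loc k \<F> T v (c *\<^sub>R q + d *\<^sub>R q') = c * d_loc k \<F> T v q + d * d_loc k \<F> T v q'"
      using lin_on_comb[of "poly_fun k" "d_loc k \<F> T v" p p'] p by simp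
  qed
qed

lemma d_loc_eq:
  assumes v: "v \<in> U_loc k \<F> T" and p: "p \<in> poly_fun k" "\<And>x. x \<in> T \<Longrightarrow> q x = p x"
  shows "d_loc k \<F> T v q = L2_inner T (fst v) (grad p)
    - bdry_integral \<F> T (\<lambda>x. (snd v x \<bullet> outer_normal T x) * p x)"
proof -
  have "d_loc k \<F> T v q = - L2_inner T (disc_div k \<F> T v) p"
    unfolding d_loc_def using L2_inner_cong[OF refl, of q p] p(2) by auto
  then show ?thesis using disc_div(2)[OF v p(1)] by simp
qed

end

section \<open>Square-integrable functions\<close>

lemma L2_inner_integrable:
  fixes f u :: "real^3 \<Rightarrow> 'b::euclidean_space"
  assumes "f \<in> L2 X" "u \<in> L2 X"
  shows "integrable (lebesgue_on X) (\<lambda>x. f x \<bullet> u x)"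
proof (rule Bochner_Integration.integrable_bound)
  show "integrable (lebesgue_on X) (\<lambda>x. (norm (f x))\<^sup>2 + (norm (u x))\<^sup>2)"
    using assms by (simp add: L2_def)
  show "(\<lambda>x. f x \<bullet> u x) \<in> borel_measurable (lebesgue_on X)"
    using assms by (intro borel_measurable_inner) (auto simp: L2_def)
  have "\<bar>f x \<bullet> u x\<bar> \<le> (norm (f x))\<^sup>2 + (norm (u x))\<^sup>2" for x
  proof -
    have "\<bar>f x \<bullet> u x\<bar> \<le> norm (f x) * norm (u x)" by (rule Cauchy_Schwarz_ineq2)
    moreover have "2 * (norm (f x) * norm (u x)) \<le> (norm (f x))\<^sup>2 + (norm (u x))\<^sup>2"
      using sum_squares_bound[of "norm (f x)" "norm (u x)"] by simp
    moreover have "0 \<le> norm (f x) * norm (u x)" by simp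
    ultimately show ?thesis by linarith
  qed
  then show "AE x in lebesgue_on X. norm (f x \<bullet> u x) \<le> norm ((norm (f x))\<^sup>2 + (norm (u x))\<^sup>2)"
    by (intro AE_I2) simp
qed

text \<open>The inner product on \<open>L2 X\<close> is only semidefinite, functions not being identified almost
  everywhere; hence the direct argument with the nonnegative quadratic polynomial
  \<open>t \<mapsto> \<parallel>f + t u\<parallel>\<^sup>2\<close>.\<close>

lemma L2_inner_Cauchy_Schwarz:
  fixes f u :: "real^3 \<Rightarrow> 'b::euclidean_space"
  assumes f: "f \<in> L2 X" and u: "u \<in> L2 X"
  shows "\<bar>L2_inner X f u\<bar> \<le> L2_norm X f * L2_norm X u"
proof -
  define A where "A = (LINT x|lebesgue_on X. (norm (f x))\<^sup>2)"
  define B where "B = L2_inner X f u"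
  define C where "C = (LINT x|lebesgue_on X. (norm (u x))\<^sup>2)"
  have int: "integrable (lebesgue_on X) (\<lambda>x. (norm (f x))\<^sup>2)" "integrable (lebesgue_on X) (\<lambda>x. (norm (u x))\<^sup>2)"
    "integrable (lebesgue_on X) (\<lambda>x. f x \<bullet> u x)"
    using f u L2_inner_integrable[OF f u] by (auto simp: L2_def)
  have quad: "0 \<le> A + 2 * t * B + t\<^sup>2 * C" for t
  proof -
    have "0 \<le> (LINT x|lebesgue_on X. (norm (f x + t *\<^sub>R u x))\<^sup>2)"
      by (rule Bochner_Integration.integral_nonneg) simp
    also have "\<dots> = (LINT x|lebesgue_on X. (norm (f x))\<^sup>2 + 2 * t * (f x \<bullet> u x) + t\<^sup>2 * (norm (u x))\<^sup>2)"
      by (simp only: power2_norm_eq_inner)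
        (simp add: inner_add_left inner_add_right inner_commute algebra_simps power2_eq_square)
    also have "\<dots> = A + 2 * t * B + t\<^sup>2 * C"
      using int by (simp add: A_def B_def C_def L2_inner_def)
    finally show ?thesis .
  qed
  have C0: "C \<ge> 0" unfolding C_def by (rule Bochner_Integration.integral_nonneg) simp
  have "B\<^sup>2 \<le> A * C"
  proof (cases "C = 0")
    case True
    have "B = 0"
    proof (rule ccontr)
      assume "B \<noteq> 0"
      then have "A + 2 * (- (A + 1) / (2 * B)) * B = -1" by (simp add: field_simps)
      then show False using quad[of "- (A + 1) / (2 * B)"] True by simp
    qed
    then show ?thesis using True by simp
  next
    case False
    then have C: "C > 0" using C0 by simp
    have "A + 2 * (- B / C) * B + (- B / C)\<^sup>2 * C = A - B\<^sup>2 / C"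
      using C by (simp add: field_simps power2_eq_square)
    then have "B\<^sup>2 / C \<le> A" using quad[of "- B / C"] by simp
    then show ?thesis using C by (simp add: field_simps)
  qed
  then have "sqrt (B\<^sup>2) \<le> sqrt (A * C)" using real_sqrt_le_iff by blast
  then show ?thesis by (simp add: A_def B_def C_def L2_norm_def real_sqrt_mult)
qed

text \<open>Applied to the pair of energy norms of velocity and magnetic field; this is where the factor
  \<open>sqrt 2\<close> in the smallness condition originates.\<close>

lemma Cauchy_Schwarz_pair:
  fixes p q r s :: real
  shows "p * q + r * s \<le> sqrt (p\<^sup>2 + r\<^sup>2) * sqrt (q\<^sup>2 + s\<^sup>2)"
proof -
  have "(p * q + r * s)\<^sup>2 \<le> (p\<^sup>2 + r\<^sup>2) * (q\<^sup>2 + s\<^sup>2)"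
    using zero_le_power2[of "p * s - r * q"] by (simp add: power2_eq_square algebra_simps)
  then show ?thesis
    by (metis real_le_rsqrt real_sqrt_mult)
qed

section \<open>Global spaces and forms\<close>

text \<open>A single mesh of the family. Regularity enters in the qualitative form that makes each element
  a half space near its faces.\<close>

locale regular_mesh =
  fixes \<Omega> :: "(real^3) set" and \<T> \<F> :: "(real^3) set set" and k :: nat
  assumes domain: "polyhedral_lipschitz_domain \<Omega>"
    and mesh: "polyhedral_mesh \<Omega> \<T> \<F>"
    and star: "\<And>T. T \<in> \<T> \<Longrightarrow> \<exists>c r. r > 0 \<and> star_shaped_wrt_ball T c r"
begin

lemma domain_facts: "open \<Omega>" "bounded \<Omega>"
  using domain by (auto simp: polyhedral_lipschitz_domain_def)

lemma mesh_facts: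
  "finite \<T>" "finite \<F>" "pairwise disjnt \<T>" "pairwise disjnt \<F>"
  "T \<in> \<T> \<Longrightarrow> open T" "T \<in> \<T> \<Longrightarrow> T \<noteq> {}" "F \<in> \<F> \<Longrightarrow> planar_face F"
  using mesh by (auto simp: polyhedral_mesh_def open_polyhedron_open open_polyhedron_nonempty)

lemma element_subset: "T \<in> \<T> \<Longrightarrow> T \<subseteq> \<Omega>"
  by (rule mesh_element_subset[OF domain mesh])

lemma element_bounded: "T \<in> \<T> \<Longrightarrow> bounded T"
  using element_subset domain_facts(2) bounded_subset by blast

lemma face_half_space:
  assumes "T \<in> \<T>" "F \<in> faces_of_elt \<F> T"
  shows "\<exists>n. \<forall>x\<in>F. half_space_near T x n"
proof -
  obtain c r where "r > 0" "star_shaped_wrt_ball T c r" using star[OF assms(1)] by blast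
  from star_shaped_face_normal[OF mesh_facts(5)[OF assms(1)] this(2,1), of F] assms(2) mesh_facts(7)
  show ?thesis by (auto simp: faces_of_elt_def)
qed

lemma element:
  assumes "T \<in> \<T>"
  shows "mesh_element \<F> T"
proof
  show "open T" "T \<noteq> {}" "bounded T"
    using assms mesh_facts element_bounded by auto
  show "finite (faces_of_elt \<F> T)"
    using mesh_facts(2) by (simp add: faces_of_elt_def)
  fix F assume F: "F \<in> faces_of_elt \<F> T"
  then show "planar_face F" using mesh_facts(7) by (simp add: faces_of_elt_def)
  have "F \<subseteq> closure T" using F by (auto simp: faces_of_elt_def frontier_def)
  then show "bounded F" using element_bounded[OF assms] bounded_closure bounded_subset by blast
  obtain n where "\<And>x. x \<in> F \<Longrightarrow> half_space_near T x n" using face_half_space[OF assms F] by blast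
  then show "\<exists>n. \<forall>x\<in>F. outer_normal T x = n" by (intro exI[of _ n] ballI outer_normal_eqI)
qed

lemma face_of_some_element:
  assumes "F \<in> \<F>"
  obtains T where "T \<in> \<T>" "F \<in> faces_of_elt \<F> T"
proof -
  have "card {T\<in>\<T>. F \<subseteq> frontier T} = 2 \<or> card {T\<in>\<T>. F \<subseteq> frontier T} = 1"
    using mesh assms by (auto simp: polyhedral_mesh_def)
  then have "{T\<in>\<T>. F \<subseteq> frontier T} \<noteq> {}" by (intro notI) simp
  then show ?thesis using that assms by (auto simp: faces_of_elt_def)
qed

abbreviation U where "U \<equiv> U_glob k \<T> \<F>"
abbreviation U0 where "U0 \<equiv> U_glob_0 k \<Omega> \<T> \<F>"
abbreviation Ut where "Ut \<equiv> U_glob_n k \<Omega> \<T> \<F>"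
abbreviation Q where "Q \<equiv> P_0 k \<Omega> \<T>"

lemma U_glob_eq:
  "U = {a. (\<forall>T\<in>\<T>. a T \<in> poly_vec k) \<and> (\<forall>T. T \<notin> \<T> \<longrightarrow> a T = 0)} \<times>
       {b. (\<forall>F\<in>\<F>. b F \<in> poly_faces k {F}) \<and> (\<forall>F. F \<notin> \<F> \<longrightarrow> b F = 0)}"
  by (auto simp: U_glob_def zero_fun_def)

lemma U_subspaces: "subspace U" "subspace U0" "subspace Ut" "U0 \<subseteq> Ut" "Ut \<subseteq> U"
proof -
  show U: "subspace U"
    unfolding U_glob_eq
    by (intro subspace_Times)
      (auto simp: subspace_def subspace_0[OF subspace_poly_vec] subspace_add[OF subspace_poly_vec]
        subspace_scale[OF subspace_poly_vec] subspace_0[OF subspace_poly_faces]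
        subspace_add[OF subspace_poly_faces] subspace_scale[OF subspace_poly_faces])
  show "subspace U0" "subspace Ut"
    using U by (auto simp: subspace_def U_glob_0_def U_glob_n_def inner_add_left)
  show "U0 \<subseteq> Ut" "Ut \<subseteq> U" by (auto simp: U_glob_0_def U_glob_n_def)
qed

lemma finite_dim_U: "finite_dim U"
  unfolding U_glob_eq
  by (intro finite_dim_Times finite_dim_family mesh_facts finite_dim_poly_vec finite_dim_poly_faces_single)

lemma restr_linear: "restr \<F> (c *\<^sub>R v + d *\<^sub>R w) T = c *\<^sub>R restr \<F> v T + d *\<^sub>R restr \<F> w T"
  by (simp add: restr_def prod_eq_iff fun_eq_iff sum.distrib scaleR_sum_right)

lemma U_face_zero: "v \<in> U \<Longrightarrow> F \<in> \<F> \<Longrightarrow> x \<notin> F \<Longrightarrow> snd v F x = 0"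
  by (auto simp: U_glob_def poly_faces_def)

text \<open>Faces are disjoint and the face unknowns are extended by \<open>0\<close>, so one summand is left.\<close>

lemma restr_face:
  assumes v: "v \<in> U" and T: "T \<in> \<T>" and F: "F \<in> faces_of_elt \<F> T" and x: "x \<in> F"
  shows "snd (restr \<F> v T) x = snd v F x"
proof -
  interpret mesh_element \<F> T by (rule element[OF T])
  have "snd v F' x = 0" if "F' \<in> faces_of_elt \<F> T" "F' \<noteq> F" for F'
  proof -
    have "F' \<in> \<F>" "F \<in> \<F>" using that F by (auto simp: faces_of_elt_def)
    then have "x \<notin> F'" using pairwiseD[OF mesh_facts(4), of F' F] that(2) x by (auto simp: disjnt_iff)
    then show ?thesis using U_face_zero[OF v \<open>F' \<in> \<F>\<close>] by simp
  qed
  then have "(\<Sum>F'\<in>faces_of_elt \<F> T. snd v F' x) = (\<Sum>F'\<in>{F}. snd v F' x)"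
    using F faces(1) by (intro sum.mono_neutral_right) auto
  then show ?thesis by (simp add: restr_def)
qed

lemma restr_U_loc:
  assumes v: "v \<in> U" and T: "T \<in> \<T>"
  shows "restr \<F> v T \<in> U_loc k \<F> T"
proof -
  have "snd (restr \<F> v T) \<in> poly_faces k (faces_of_elt \<F> T)"
    unfolding poly_faces_def
  proof (intro CollectI conjI ballI allI impI)
    fix F assume F: "F \<in> faces_of_elt \<F> T"
    then have "snd v F \<in> poly_faces k {F}" using v by (auto simp: U_glob_def faces_of_elt_def)
    then obtain p where "p \<in> poly_vec k" "\<forall>x\<in>F. snd v F x = p x" by (auto simp: poly_faces_def)
    then show "\<exists>p\<in>poly_vec k. \<forall>x\<in>F. snd (restr \<F> v T) x = p x"
      using restr_face[OF v T F] by auto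
  next
    fix x assume "x \<notin> \<Union>(faces_of_elt \<F> T)"
    then show "snd (restr \<F> v T) x = 0"
      using U_face_zero[OF v] by (auto simp: restr_def faces_of_elt_def intro!: sum.neutral)
  qed
  then show ?thesis
    using v T by (auto simp: U_loc_def U_glob_def restr_def)
qed

lemma lin_on_restr:
  assumes "T \<in> \<T>" "lin_on (U_loc k \<F> T) L"
  shows "lin_on U (\<lambda>v. L (restr \<F> v T))"
  using assms(2) restr_U_loc[OF _ assms(1)] by (simp add: lin_on_def restr_linear)

lemma a_form_bilinear:
  assumes s: "\<And>T. T \<in> \<T> \<Longrightarrow> sym_psd_bilinear (U_loc k \<F> T) (s T)"
  shows "bilinear_on U U (a_form k \<T> \<F> s)"
    and "u \<in> U \<Longrightarrow> v \<in> U \<Longrightarrow> a_form k \<T> \<F> s u v = a_form k \<T> \<F> s v u"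
proof -
  have bil: "bilinear_on (U_loc k \<F> T) (U_loc k \<F> T) (a_loc k \<F> (s T) T)" if "T \<in> \<T>" for T
    by (rule mesh_element.a_loc_bilinear[OF element[OF that] s[OF that]])
  show "bilinear_on U U (a_form k \<T> \<F> s)"
    unfolding bilinear_on_def a_form_def
    by (intro conjI ballI lin_on_sum lin_on_restr bilinear_onD1[OF bil] bilinear_onD2[OF bil] restr_U_loc)
  show "u \<in> U \<Longrightarrow> v \<in> U \<Longrightarrow> a_form k \<T> \<F> s u v = a_form k \<T> \<F> s v u"
    unfolding a_form_def
    by (intro sum.cong refl mesh_element.a_loc_bilinear(2)[OF element s] restr_U_loc)
qed

lemma t_form_trilinear:
  "w \<in> U \<Longrightarrow> z \<in> U \<Longrightarrow> lin_on U (\<lambda>v. t_form k \<T> \<F> v w z)"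
  "v \<in> U \<Longrightarrow> bilinear_on U U (t_form k \<T> \<F> v)"
proof -
  note tri = mesh_element.t_loc_trilinear[OF element]
  show "w \<in> U \<Longrightarrow> z \<in> U \<Longrightarrow> lin_on U (\<lambda>v. t_form k \<T> \<F> v w z)"
    unfolding t_form_def by (intro lin_on_sum lin_on_restr tri(1) restr_U_loc)
  show "v \<in> U \<Longrightarrow> bilinear_on U U (t_form k \<T> \<F> v)"
    unfolding t_form_def bilinear_on_def
    by (intro conjI ballI lin_on_sum lin_on_restr bilinear_onD1[OF tri(2)] bilinear_onD2[OF tri(2)] restr_U_loc)
qed

lemma t_form_skew: "t_form k \<T> \<F> v w z = - t_form k \<T> \<F> v z w"
  unfolding t_form_def sum_negf[symmetric]
  by (intro sum.cong refl mesh_element.t_loc_skew[OF element])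

lemma t_form_diag: "t_form k \<T> \<F> v w w = 0"
  using t_form_skew[of v w w] by simp

lemma P_0_elt_poly: "q \<in> Q \<Longrightarrow> T \<in> \<T> \<Longrightarrow> q \<in> mesh_element.elt_poly T k"
  using mesh_element.elt_poly_def[OF element] by (simp add: P_0_def)

lemma d_form_bilinear: "bilinear_on U Q (d_form k \<T> \<F>)"
proof -
  have bil: "bilinear_on (U_loc k \<F> T) Q (d_loc k \<F> T)" if "T \<in> \<T>" for T
    using P_0_elt_poly[OF _ that]
    by (intro bilinear_on_mono[OF mesh_element.d_loc_bilinear[OF element[OF that]]]) auto
  show ?thesis
    unfolding bilinear_on_def d_form_def
    by (intro conjI ballI lin_on_sum lin_on_restr bilinear_onD1[OF bil] bilinear_onD2[OF bil] restr_U_loc)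
qed

section \<open>Piecewise functions\<close>

lemma integral_indicator:
  fixes g :: "real^3 \<Rightarrow> 'b::euclidean_space"
  assumes T: "T \<in> \<T>"
  shows "(LINT x|lebesgue_on \<Omega>. indicator T x *\<^sub>R g x) = (LINT x|lebesgue_on T. g x)"
proof -
  have O: "\<Omega> \<in> sets lebesgue" "T \<in> sets lebesgue"
    using domain_facts(1) mesh_facts(5)[OF T] by auto
  have "(LINT x|lebesgue_on \<Omega>. indicator T x *\<^sub>R g x) = (LINT x|lebesgue. indicator \<Omega> x *\<^sub>R (indicator T x *\<^sub>R g x))"
    using O by (simp add: integral_restrict_space)
  also have "\<dots> = (LINT x|lebesgue. indicator T x *\<^sub>R g x)"
    using element_subset[OF T] by (intro Bochner_Integration.integral_cong) (auto simp: indicator_def)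
  also have "\<dots> = (LINT x|lebesgue_on T. g x)"
    using O by (simp add: integral_restrict_space)
  finally show ?thesis .
qed

lemma integrable_indicator:
  fixes g :: "real^3 \<Rightarrow> 'b::euclidean_space"
  assumes T: "T \<in> \<T>" and g: "continuous_on UNIV g"
  shows "integrable (lebesgue_on \<Omega>) (\<lambda>x. indicator T x *\<^sub>R g x)"
proof (rule integrable_mult_indicator)
  show "T \<in> sets (lebesgue_on \<Omega>)"
    using element_subset[OF T] mesh_facts(5)[OF T] domain_facts(1)
    by (auto simp: sets_restrict_space_iff)
  show "integrable (lebesgue_on \<Omega>) g"
    by (rule integrable_continuous_bounded_open[OF domain_facts g])
qed

lemma piecewise_at:
  fixes p :: "(real^3) set \<Rightarrow> real^3 \<Rightarrow> 'b::real_vector"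
  assumes "T \<in> \<T>" "x \<in> T"
  shows "(\<Sum>S\<in>\<T>. indicator S x *\<^sub>R p S x) = p T x"
proof -
  have "indicator S x = (0::real)" if "S \<in> \<T>" "S \<noteq> T" for S
    using pairwiseD[OF mesh_facts(3) that(1) assms(1) that(2)] assms(2)
    by (auto simp: disjnt_iff indicator_def)
  then have "(\<Sum>S\<in>\<T>. indicator S x *\<^sub>R p S x) = (\<Sum>S\<in>{T}. indicator S x *\<^sub>R p S x)"
    by (intro sum.mono_neutral_right ballI; use assms mesh_facts(1) in force)
  then show ?thesis using assms(2) by simp
qed

lemma piecewise_outside:
  fixes p :: "(real^3) set \<Rightarrow> real^3 \<Rightarrow> 'b::real_vector"
  shows "x \<notin> \<Union>\<T> \<Longrightarrow> (\<Sum>S\<in>\<T>. indicator S x *\<^sub>R p S x) = 0"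
  by (intro sum.neutral) (auto simp: indicator_def)

text \<open>The elements are disjoint, so at most one summand is nonzero at each point.\<close>

lemma piecewise_sum_norm:
  fixes p :: "(real^3) set \<Rightarrow> real^3 \<Rightarrow> 'b::euclidean_space"
  shows "(norm (\<Sum>T\<in>\<T>. indicator T x *\<^sub>R p T x))\<^sup>2 = (\<Sum>T\<in>\<T>. indicator T x *\<^sub>R (norm (p T x))\<^sup>2)"
proof (cases "\<exists>T\<in>\<T>. x \<in> T")
  case True
  then obtain T where T: "T \<in> \<T>" "x \<in> T" by blast
  show ?thesis
    using piecewise_at[OF T, of p] piecewise_at[OF T, of "\<lambda>S x. (norm (p S x))\<^sup>2"] by simp
next
  case False
  then have "x \<notin> \<Union>\<T>" by blast
  then show ?thesis
    using piecewise_outside[of x p] piecewise_outside[of x "\<lambda>S x. (norm (p S x))\<^sup>2"] by simp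
qed

lemma piecewise_L2:
  fixes p :: "(real^3) set \<Rightarrow> real^3 \<Rightarrow> 'b::euclidean_space"
  assumes p: "\<And>T. T \<in> \<T> \<Longrightarrow> continuous_on UNIV (p T)"
  shows "(\<lambda>x. \<Sum>T\<in>\<T>. indicator T x *\<^sub>R p T x) \<in> L2 \<Omega>"
    and "integrable (lebesgue_on \<Omega>) (\<lambda>x. \<Sum>T\<in>\<T>. indicator T x *\<^sub>R p T x)"
    and "(LINT x|lebesgue_on \<Omega>. (\<Sum>T\<in>\<T>. indicator T x *\<^sub>R p T x)) = (\<Sum>T\<in>\<T>. LINT x|lebesgue_on T. p T x)"
    and "(L2_norm \<Omega> (\<lambda>x. \<Sum>T\<in>\<T>. indicator T x *\<^sub>R p T x))\<^sup>2 = (\<Sum>T\<in>\<T>. L2_inner T (p T) (p T))"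
proof -
  have int: "integrable (lebesgue_on \<Omega>) (\<lambda>x. indicator T x *\<^sub>R p T x)" if "T \<in> \<T>" for T
    using that by (intro integrable_indicator p)
  have int2: "integrable (lebesgue_on \<Omega>) (\<lambda>x. indicator T x *\<^sub>R (norm (p T x))\<^sup>2)" if "T \<in> \<T>" for T
    using that by (intro integrable_indicator continuous_intros p)
  show i: "integrable (lebesgue_on \<Omega>) (\<lambda>x. \<Sum>T\<in>\<T>. indicator T x *\<^sub>R p T x)"
    by (rule Bochner_Integration.integrable_sum[OF int])
  show "(LINT x|lebesgue_on \<Omega>. (\<Sum>T\<in>\<T>. indicator T x *\<^sub>R p T x)) = (\<Sum>T\<in>\<T>. LINT x|lebesgue_on T. p T x)"
    by (subst Bochner_Integration.integral_sum[OF int]) (auto simp: integral_indicator)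
  have i2: "integrable (lebesgue_on \<Omega>) (\<lambda>x. (norm (\<Sum>T\<in>\<T>. indicator T x *\<^sub>R p T x))\<^sup>2)"
    unfolding piecewise_sum_norm by (rule Bochner_Integration.integrable_sum[OF int2])
  then show "(\<lambda>x. \<Sum>T\<in>\<T>. indicator T x *\<^sub>R p T x) \<in> L2 \<Omega>"
    using i by (simp add: L2_def borel_measurable_integrable)
  have "(L2_norm \<Omega> (\<lambda>x. \<Sum>T\<in>\<T>. indicator T x *\<^sub>R p T x))\<^sup>2
      = (LINT x|lebesgue_on \<Omega>. (norm (\<Sum>T\<in>\<T>. indicator T x *\<^sub>R p T x))\<^sup>2)"
    unfolding L2_norm_def by (intro real_sqrt_pow2 Bochner_Integration.integral_nonneg) simp
  also have "\<dots> = (\<Sum>T\<in>\<T>. LINT x|lebesgue_on T. (norm (p T x))\<^sup>2)"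
    unfolding piecewise_sum_norm
    by (rule trans[OF Bochner_Integration.integral_sum[OF int2]])
      (auto intro!: sum.cong integral_indicator simp del: real_scaleR_def)
  finally show "(L2_norm \<Omega> (\<lambda>x. \<Sum>T\<in>\<T>. indicator T x *\<^sub>R p T x))\<^sup>2 = (\<Sum>T\<in>\<T>. L2_inner T (p T) (p T))"
    by (simp add: L2_inner_def power2_norm_eq_inner)
qed

lemma piecewise_alt:
  "piecewise \<T> v = (\<lambda>x. \<Sum>T\<in>\<T>. indicator T x *\<^sub>R fst v T x)"
  by (simp add: fun_eq_iff piecewise_def)

lemma U_elt_continuous: "v \<in> U \<Longrightarrow> T \<in> \<T> \<Longrightarrow> continuous_on UNIV (fst v T)"
  using poly_vec_continuous by (auto simp: U_glob_def)

lemma load_lin_on: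
  assumes f: "f \<in> L2 \<Omega>"
  shows "lin_on U (\<lambda>v. L2_inner \<Omega> f (piecewise \<T> v))"
  unfolding L2_inner_def
proof (rule lin_on_integral)
  show "integrable (lebesgue_on \<Omega>) (\<lambda>x. f x \<bullet> piecewise \<T> v x)" if "v \<in> U" for v
    unfolding piecewise_alt using that
    by (intro L2_inner_integrable f piecewise_L2(1) U_elt_continuous)
  have "piecewise \<T> (c *\<^sub>R v + d *\<^sub>R w) x = c *\<^sub>R piecewise \<T> v x + d *\<^sub>R piecewise \<T> w x" for c d v w x
    unfolding piecewise_alt scaleR_sum_right sum.distrib[symmetric]
    by (intro sum.cong refl) (simp add: scaleR_add_right mult.commute)
  then show "f x \<bullet> piecewise \<T> (c *\<^sub>R v + d *\<^sub>R w) x = c * (f x \<bullet> piecewise \<T> v x) + d * (f x \<bullet> piecewise \<T> w x)"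
    for c d v w x by (simp add: inner_add_right)
qed

lemma norm1_loc_square:
  assumes T: "T \<in> \<T>" and v: "v \<in> U"
  shows "(norm1_loc \<F> T (restr \<F> v T))\<^sup>2 = (L2_norm T (grad_vec (fst (restr \<F> v T))))\<^sup>2
     + inverse (diameter T) * bdry_integral \<F> T (\<lambda>x. (norm (snd (restr \<F> v T) x - fst (restr \<F> v T) x))\<^sup>2)"
    and "bdry_integral \<F> T (\<lambda>x. (norm (snd (restr \<F> v T) x - fst (restr \<F> v T) x))\<^sup>2) \<ge> 0"
    and "diameter T > 0"
proof -
  show b: "bdry_integral \<F> T (\<lambda>x. (norm (snd (restr \<F> v T) x - fst (restr \<F> v T) x))\<^sup>2) \<ge> 0"
    unfolding bdry_integral_def by (intro sum_nonneg face_integral_nonneg) simp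
  show d: "diameter T > 0"
    using diameter_open_pos mesh_facts(5,6)[OF T] element_bounded[OF T] by blast
  show "(norm1_loc \<F> T (restr \<F> v T))\<^sup>2 = (L2_norm T (grad_vec (fst (restr \<F> v T))))\<^sup>2
     + inverse (diameter T) * bdry_integral \<F> T (\<lambda>x. (norm (snd (restr \<F> v T) x - fst (restr \<F> v T) x))\<^sup>2)"
    unfolding norm1_loc_def by (rule real_sqrt_pow2) (use b d in simp)
qed

lemma norm1_nonneg: "norm1 \<T> \<F> v \<ge> 0"
  by (simp add: norm1_def sum_nonneg)

text \<open>The discrete Poincare inequality makes the element unknowns vanish, and the boundary terms of
  the norm then force the face unknowns to vanish, since every face belongs to some element.
  The vanishing of \<open>L2_norm\<close> is a hypothesis because that inequality is only assumed on the
  subspace with vanishing normal components.\<close>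

lemma norm1_eq_0:
  assumes v: "v \<in> U" and zero: "norm1 \<T> \<F> v = 0" and L2: "L2_norm \<Omega> (piecewise \<T> v) = 0"
  shows "v = 0"
proof -
  have cells: "fst v T = 0" for T
  proof (cases "T \<in> \<T>")
    case True
    interpret mesh_element \<F> T by (rule element[OF True])
    have "(\<Sum>T\<in>\<T>. L2_inner T (fst v T) (fst v T)) = 0"
      using piecewise_L2(4)[of "fst v"] U_elt_continuous[OF v] L2 by (simp add: piecewise_alt)
    moreover have "L2_inner S (fst v S) (fst v S) \<ge> 0" for S
      by (auto simp: L2_inner_def intro: Bochner_Integration.integral_nonneg)
    ultimately have "L2_inner T (fst v T) (fst v T) = 0"
      using sum_nonneg_eq_0_iff[OF mesh_facts(1), of "\<lambda>T. L2_inner T (fst v T) (fst v T)"] True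
      by simp
    then have "fst v T x = 0" if "x \<in> T" for x
      by (rule L2_inner_eq_0[OF U_elt_continuous[OF v True] _ that])
    then show ?thesis
      using v True by (intro poly_vec_eq_0[of _ k T] mesh_facts(5,6)) (auto simp: U_glob_def)
  next
    case False
    then show ?thesis using v by (simp add: U_glob_eq mem_Times_iff)
  qed
  have faces: "snd v F = 0" for F
  proof (cases "F \<in> \<F>")
    case True
    obtain T where TF: "T \<in> \<T>" "F \<in> faces_of_elt \<F> T" using face_of_some_element[OF True] .
    interpret mesh_element \<F> T by (rule element[OF TF(1)])
    let ?g = "\<lambda>x. (norm (snd (restr \<F> v T) x - fst (restr \<F> v T) x))\<^sup>2"
    note sq = norm1_loc_square[OF TF(1) v]
    have "(\<Sum>T\<in>\<T>. (norm1_loc \<F> T (restr \<F> v T))\<^sup>2) = 0"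
      using zero by (simp add: norm1_def)
    then have "(norm1_loc \<F> T (restr \<F> v T))\<^sup>2 = 0"
      using sum_nonneg_eq_0_iff[OF mesh_facts(1), of "\<lambda>T. (norm1_loc \<F> T (restr \<F> v T))\<^sup>2"] TF(1) by simp
    then have "inverse (diameter T) * bdry_integral \<F> T ?g = 0"
      using sq(1) mult_nonneg_nonneg[OF _ sq(2), of "inverse (diameter T)"] sq(3)
        zero_le_power2[of "L2_norm T (grad_vec (fst (restr \<F> v T)))"]
      by (simp add: add_nonneg_eq_0_iff)
    then have "(\<Sum>F\<in>faces_of_elt \<F> T. face_integral F ?g) = 0"
      using sq(3) by (simp add: bdry_integral_def)
    moreover have "face_integral F ?g \<ge> 0" for F by (rule face_integral_nonneg) simp
    ultimately have z: "face_integral F ?g = 0"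
      using sum_nonneg_eq_0_iff[OF faces(1), of "\<lambda>F. face_integral F ?g"] TF(2) by simp
    note parts = U_loc_parts[OF restr_U_loc[OF v TF(1)]]
    have "face_cont F (\<lambda>x. (snd (restr \<F> v T) x - fst (restr \<F> v T) x) \<bullet> (snd (restr \<F> v T) x - fst (restr \<F> v T) x))"
      by (intro face_cont_inner face_cont_diff parts(3)[OF TF(2)] face_cont_continuous[OF parts(2)])
    then have "face_cont F ?g" by (simp add: power2_norm_eq_inner)
    then have "?g x = 0" if "x \<in> F" for x
      using face_integral_eq_0[OF faces(2,3)[OF TF(2)] _ _ z that] by simp
    then have "snd v F x = 0" if "x \<in> F" for x
      using restr_face[OF v TF that] that cells[of T] by (simp add: restr_def)
    then show ?thesis using U_face_zero[OF v True] by (auto simp: fun_eq_iff)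
  next
    case False
    then show ?thesis using v by (simp add: U_glob_eq mem_Times_iff)
  qed
  show ?thesis using cells faces by (simp add: prod_eq_iff fun_eq_iff)
qed

section \<open>Pressures\<close>

text \<open>Piecewise polynomials on a bounded domain are square-integrable, so the pressures are the
  mean-free ones among them. This form is the one in which sums and spanning sets are visible.\<close>

lemma P_0_iff:
  "q \<in> Q \<longleftrightarrow> (\<exists>p. (\<forall>T\<in>\<T>. p T \<in> poly_fun k) \<and> q = (\<lambda>x. \<Sum>T\<in>\<T>. indicator T x *\<^sub>R p T x)) \<and>
     (LINT x|lebesgue_on \<Omega>. q x) = 0"
proof
  assume q: "q \<in> Q"
  then obtain p where p: "\<And>T. T \<in> \<T> \<Longrightarrow> p T \<in> poly_fun k" "\<And>T x. T \<in> \<T> \<Longrightarrow> x \<in> T \<Longrightarrow> q x = p T x"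
    by (auto simp: P_0_def) metis
  have q_eq: "q x = (\<Sum>T\<in>\<T>. indicator T x *\<^sub>R p T x)" for x
  proof (cases "x \<in> \<Union>\<T>")
    case True
    then obtain T where T: "T \<in> \<T>" "x \<in> T" by blast
    then show ?thesis using piecewise_at[OF T, of p] p(2)[OF T] by simp
  next
    case False
    then show ?thesis using piecewise_outside[OF False, of p] q by (simp add: P_0_def)
  qed
  show "(\<exists>p. (\<forall>T\<in>\<T>. p T \<in> poly_fun k) \<and> q = (\<lambda>x. \<Sum>T\<in>\<T>. indicator T x *\<^sub>R p T x)) \<and>
      (LINT x|lebesgue_on \<Omega>. q x) = 0"
    by (intro conjI exI[of _ p] ballI ext p(1) q_eq, assumption) (use q in \<open>simp add: P_0_def\<close>)
next
  assume "(\<exists>p. (\<forall>T\<in>\<T>. p T \<in> poly_fun k) \<and> q = (\<lambda>x. \<Sum>T\<in>\<T>. indicator T x *\<^sub>R p T x)) \<and>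
      (LINT x|lebesgue_on \<Omega>. q x) = 0"
  then obtain p where p: "\<And>T. T \<in> \<T> \<Longrightarrow> p T \<in> poly_fun k"
    and q: "q = (\<lambda>x. \<Sum>T\<in>\<T>. indicator T x *\<^sub>R p T x)" "(LINT x|lebesgue_on \<Omega>. q x) = 0" by blast
  have "q \<in> L2 \<Omega>" unfolding q(1) using p poly_fun_continuous by (intro piecewise_L2(1)) blast
  moreover have "\<exists>p\<in>poly_fun k. \<forall>x\<in>T. q x = p x" if "T \<in> \<T>" for T
    using p[OF that] piecewise_at[OF that, of _ p] q(1) by auto
  moreover have "q x = 0" if "x \<notin> \<Union>\<T>" for x using piecewise_outside[OF that, of p] q(1) by simp
  ultimately show "q \<in> Q" using q(2) by (simp add: P_0_def)
qed

lemma subspace_P_0: "subspace Q"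
proof -
  have comb: "c *\<^sub>R q + d *\<^sub>R r \<in> Q" if "q \<in> Q" "r \<in> Q" for c d q r
  proof -
    obtain p p' where p: "\<And>T. T \<in> \<T> \<Longrightarrow> p T \<in> poly_fun k" "q = (\<lambda>x. \<Sum>T\<in>\<T>. indicator T x *\<^sub>R p T x)"
      and p': "\<And>T. T \<in> \<T> \<Longrightarrow> p' T \<in> poly_fun k" "r = (\<lambda>x. \<Sum>T\<in>\<T>. indicator T x *\<^sub>R p' T x)"
      and z: "(LINT x|lebesgue_on \<Omega>. q x) = 0" "(LINT x|lebesgue_on \<Omega>. r x) = 0"
      using \<open>q \<in> Q\<close> \<open>r \<in> Q\<close> unfolding P_0_iff by blast
    have int: "integrable (lebesgue_on \<Omega>) q" "integrable (lebesgue_on \<Omega>) r"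
      unfolding p(2) p'(2) using p(1) p'(1) poly_fun_continuous by (auto intro!: piecewise_L2(2) simp del: real_scaleR_def)
    have "c *\<^sub>R p T + d *\<^sub>R p' T \<in> poly_fun k" if "T \<in> \<T>" for T
      using p(1) p'(1) that subspace_poly_fun by (simp add: subspace_add subspace_scale)
    moreover have "c *\<^sub>R q + d *\<^sub>R r = (\<lambda>x. \<Sum>T\<in>\<T>. indicator T x *\<^sub>R (c *\<^sub>R p T + d *\<^sub>R p' T) x)"
      by (simp add: p(2) p'(2) fun_eq_iff sum_distrib_left sum.distrib algebra_simps)
    moreover have "(LINT x|lebesgue_on \<Omega>. (c *\<^sub>R q + d *\<^sub>R r) x) = 0"
      using int z by simp
    ultimately show ?thesis unfolding P_0_iff by (intro conjI exI[of _ "\<lambda>T. c *\<^sub>R p T + d *\<^sub>R p' T"]) auto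
  qed
  have "0 \<in> Q"
    unfolding P_0_iff
    by (intro conjI exI[of _ "\<lambda>T. 0"]) (auto simp: zero_fun_def subspace_0[OF subspace_poly_fun, unfolded zero_fun_def])
  then show ?thesis
    using comb[of _ _ 1 1] comb[of _ _ _ 0] by (auto simp: subspace_def)
qed

lemma finite_dim_P_0: "finite_dim Q"
proof (rule finite_dim_sum[OF mesh_facts(1)])
  show "finite_dim ((\<lambda>p x. indicator T x *\<^sub>R p x) ` poly_fun k)" for T
    by (intro finite_dim_linear_image finite_dim_poly_fun linearI) (auto simp: fun_eq_iff algebra_simps)
  fix q assume "q \<in> Q"
  then obtain p where p: "\<forall>T\<in>\<T>. p T \<in> poly_fun k" "q = (\<lambda>x. \<Sum>T\<in>\<T>. indicator T x *\<^sub>R p T x)"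
    unfolding P_0_iff by blast
  have "q = (\<Sum>T\<in>\<T>. (\<lambda>x. indicator T x *\<^sub>R p T x))"
    unfolding p(2) by (simp add: fun_eq_iff sum_fun_apply)
  then show "\<exists>g. q = (\<Sum>T\<in>\<T>. g T) \<and> (\<forall>T\<in>\<T>. g T \<in> (\<lambda>p x. indicator T x *\<^sub>R p x) ` poly_fun k)"
    using p(1) by (intro exI[of _ "\<lambda>T x. indicator T x *\<^sub>R p T x"]) blast
qed

lemma d_loc_zero: "T \<in> \<T> \<Longrightarrow> q \<in> Q \<Longrightarrow> restr \<F> v T = 0 \<Longrightarrow> d_loc k \<F> T (restr \<F> v T) q = 0"
proof -
  assume cell: "T \<in> \<T>" and q: "q \<in> Q" and z: "restr \<F> v T = 0"
  interpret mesh_element \<F> T by (rule element[OF cell])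
  show ?thesis unfolding z
    by (rule lin_on_zero[OF bilinear_onD1[OF d_loc_bilinear P_0_elt_poly[OF q cell]] subspace_0[OF subspace_U_loc]])
qed

text \<open>The test function is \<open>grad q\<close> in the element \<open>T\<close> and \<open>0\<close> in all others and on all faces; it
  turns \<open>d\<close> into the squared norm of the gradient over \<open>T\<close>.\<close>

lemma pressure_gradient_zero:
  assumes q: "q \<in> Q" and ker: "\<And>v. v \<in> U0 \<Longrightarrow> d_form k \<T> \<F> v q = 0"
    and cell: "T \<in> \<T>" and p: "p \<in> poly_fun k" "\<And>x. x \<in> T \<Longrightarrow> q x = p x"
  shows "\<exists>c. \<forall>x. p x = c"
proof -
  interpret mesh_element \<F> T by (rule element[OF cell])
  define v :: global_dofs where "v = ((\<lambda>S. if S = T then grad p else 0), 0)"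
  have gp: "grad p \<in> poly_vec k" by (rule grad_poly[OF p(1)])
  have v: "v \<in> U0"
    using cell gp subspace_0[OF subspace_poly_vec] subspace_0[OF subspace_poly_faces]
    by (auto simp: v_def U_glob_0_def U_glob_eq)
  have restr: "restr \<F> v S = (if S = T then (grad p, 0) else 0)" for S
    by (auto simp: restr_def v_def fun_eq_iff prod_eq_iff)
  have "d_form k \<T> \<F> v q = (\<Sum>S\<in>\<T>. if S = T then d_loc k \<F> T (restr \<F> v T) q else 0)"
    unfolding d_form_def
  proof (rule sum.cong[OF refl])
    show "d_loc k \<F> S (restr \<F> v S) q = (if S = T then d_loc k \<F> T (restr \<F> v T) q else 0)"
      if "S \<in> \<T>" for S
      using d_loc_zero[OF that q, of v] restr[of S] by (cases "S = T") simp_all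
  qed
  also have "\<dots> = d_loc k \<F> T (restr \<F> v T) q"
    using cell mesh_facts(1) by simp
  also have "\<dots> = L2_inner T (grad p) (grad p)"
    using d_loc_eq[OF restr_U_loc[OF _ cell] p(1) p(2), of v] v U_subspaces(4,5)
    by (auto simp: restr bdry_integral_def face_integral_def)
  finally have "L2_inner T (grad p) (grad p) = 0" using ker[OF v] by simp
  then show ?thesis
    using grad_eq_0_imp_constant[OF p(1)] mesh_facts(5,6)[OF cell] L2_inner_eq_0[OF poly_vec_continuous[OF gp]]
    by blast
qed

lemma face_integral_const: "face_integral F (\<lambda>x. a) = a * face_integral F (\<lambda>x. 1)"
  by (simp add: face_integral_def)

lemma face_integral_cong: "(\<And>x. x \<in> F \<Longrightarrow> g x = h x) \<Longrightarrow> face_integral F g = face_integral F h"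
  unfolding face_integral_def by (intro Bochner_Integration.integral_cong) auto

text \<open>The test function is the unit normal on the face \<open>F\<close> and \<open>0\<close> elsewhere. It is admissible
  because \<open>F\<close> is not in the boundary of \<open>\<Omega>\<close>. As the outer normals of the two elements are
  opposite, \<open>d\<close> becomes the jump times the area of \<open>F\<close>.\<close>

lemma no_pressure_jump:
  assumes q: "q \<in> Q" and ker: "\<And>v. v \<in> U0 \<Longrightarrow> d_form k \<T> \<F> v q = 0"
    and const: "\<And>T x. T \<in> \<T> \<Longrightarrow> x \<in> T \<Longrightarrow> q x = c T"
    and F: "F \<in> \<F>" "\<not> F \<subseteq> frontier \<Omega>" and T: "T1 \<in> \<T>" "T2 \<in> \<T>" "T1 \<noteq> T2"
    and F12: "{S\<in>\<T>. F \<subseteq> frontier S} = {T1, T2}"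
  shows "c T1 = c T2"
proof -
  have faces12: "F \<in> faces_of_elt \<F> T1" "F \<in> faces_of_elt \<F> T2"
    using F12 F(1) by (auto simp: faces_of_elt_def)
  obtain n1 n2 where n: "\<And>x. x \<in> F \<Longrightarrow> half_space_near T1 x n1" "\<And>x. x \<in> F \<Longrightarrow> half_space_near T2 x n2"
    using face_half_space[OF T(1) faces12(1)] face_half_space[OF T(2) faces12(2)] by blast
  obtain x0 where x0: "x0 \<in> F" using planar_face_nonempty mesh_facts(7)[OF F(1)] by blast
  have "disjnt T1 T2" using pairwiseD[OF mesh_facts(3) T] .
  then have n2: "n2 = - n1"
    using half_space_near_disjoint[OF n(1)[OF x0] n(2)[OF x0]] by (simp add: disjnt_def)
  have n1: "n1 \<bullet> n1 = 1" using n(1)[OF x0] by (simp add: half_space_near_def dot_square_norm)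
  have N: "outer_normal T1 x = n1" "outer_normal T2 x = - n1" if "x \<in> F" for x
    using outer_normal_eqI n that n2 by auto
  define b :: "real^3 \<Rightarrow> real^3" where "b = (\<lambda>x. if x \<in> F then n1 else 0)"
  define v :: global_dofs where "v = (0, \<lambda>G. if G = F then b else 0)"
  have b: "b \<in> poly_faces k {F}"
    using poly_vec_const[of n1 k] by (force simp: poly_faces_def b_def)
  have v: "v \<in> U0"
    using F b subspace_0[OF subspace_poly_vec] subspace_0[OF subspace_poly_faces]
    by (auto simp: v_def U_glob_0_def U_glob_eq)
  then have vU: "v \<in> U" using U_subspaces(4,5) by blast
  have restr: "restr \<F> v S = (0, if F \<in> faces_of_elt \<F> S then b else 0)" if S: "S \<in> \<T>" for S
  proof -
    have "finite (faces_of_elt \<F> S)" by (rule mesh_element.faces(1)[OF element[OF S]])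
    then show ?thesis
      by (auto simp: restr_def v_def fun_eq_iff if_distrib[of "\<lambda>h. h _"] cong: if_cong)
  qed
  have loc: "d_loc k \<F> S (restr \<F> v S) q = - (n1 \<bullet> m) * c S * face_integral F (\<lambda>x. 1)"
    if S: "S \<in> \<T>" "F \<in> faces_of_elt \<F> S" and m: "\<And>x. x \<in> F \<Longrightarrow> outer_normal S x = m" for S m
  proof -
    interpret mesh_element \<F> S by (rule element[OF S(1)])
    have p: "(\<lambda>x. c S) \<in> poly_fun k"
      using poly_vec_const[of "c S *\<^sub>R axis 1 1" k] by (auto simp: poly_vec_def dest!: spec[of _ 1])
    have "d_loc k \<F> S (restr \<F> v S) q = - bdry_integral \<F> S (\<lambda>x. (b x \<bullet> outer_normal S x) * c S)"
      using d_loc_eq[OF restr_U_loc[OF vU S(1)] p const[OF S(1)]] S(2)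
      by (simp add: restr[OF S(1)] L2_inner_def)
    also have "bdry_integral \<F> S (\<lambda>x. (b x \<bullet> outer_normal S x) * c S)
        = (\<Sum>G\<in>faces_of_elt \<F> S. if G = F then face_integral F (\<lambda>x. (n1 \<bullet> m) * c S) else 0)"
      unfolding bdry_integral_def
    proof (intro sum.cong refl)
      fix G assume G: "G \<in> faces_of_elt \<F> S"
      show "face_integral G (\<lambda>x. (b x \<bullet> outer_normal S x) * c S)
          = (if G = F then face_integral F (\<lambda>x. (n1 \<bullet> m) * c S) else 0)"
      proof (cases "G = F")
        case True
        then show ?thesis using m by (auto simp: b_def intro!: face_integral_cong)
      next
        case False
        then have "disjnt G F"
          using pairwiseD[OF mesh_facts(4)] G F(1) by (auto simp: faces_of_elt_def)
        then have "face_integral G (\<lambda>x. (b x \<bullet> outer_normal S x) * c S) = face_integral G (\<lambda>x. 0)"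
          by (intro face_integral_cong) (auto simp: b_def disjnt_iff)
        then show ?thesis using False by (simp add: face_integral_def)
      qed
    qed
    also have "\<dots> = face_integral F (\<lambda>x. (n1 \<bullet> m) * c S)"
      using S(2) faces(1) by simp
    also have "\<dots> = (n1 \<bullet> m) * c S * face_integral F (\<lambda>x. 1)"
      by (rule face_integral_const)
    finally show ?thesis by simp
  qed
  have zero: "d_loc k \<F> S (restr \<F> v S) q = 0" if "S \<in> \<T>" "S \<notin> {T1, T2}" for S
  proof -
    have "F \<notin> faces_of_elt \<F> S" using that F12 by (auto simp: faces_of_elt_def)
    then show ?thesis using restr[OF that(1)] by (intro d_loc_zero[OF that(1) q]) (simp add: zero_prod_def)
  qed
  have "d_form k \<T> \<F> v q = (\<Sum>S\<in>{T1, T2}. d_loc k \<F> S (restr \<F> v S) q)"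
    unfolding d_form_def using T zero mesh_facts(1) by (intro sum.mono_neutral_right) auto
  also have "\<dots> = (c T2 - c T1) * face_integral F (\<lambda>x. 1)"
    using T(3) loc[OF T(1) faces12(1) N(1)] loc[OF T(2) faces12(2) N(2)] n1
    by (simp add: algebra_simps)
  finally have "(c T2 - c T1) * face_integral F (\<lambda>x. 1) = 0" using ker[OF v] by simp
  moreover have "face_integral F (\<lambda>x. 1) \<noteq> 0"
  proof
    assume z: "face_integral F (\<lambda>x. 1) = 0"
    interpret mesh_element \<F> T1 by (rule element[OF T(1)])
    have "(1::real) = 0"
      by (rule face_integral_eq_0[OF faces(2,3)[OF faces12(1)] _ _ z x0])
        (auto intro: face_cont_continuous)
    then show False by simp
  qed
  ultimately show ?thesis by simp
qed

theorem pressure_determined: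
  assumes q: "q \<in> Q" and ker: "\<And>v. v \<in> U0 \<Longrightarrow> d_form k \<T> \<F> v q = 0"
  shows "q = 0"
proof -
  obtain p where p: "\<And>T. T \<in> \<T> \<Longrightarrow> p T \<in> poly_fun k" and qp: "q = (\<lambda>x. \<Sum>T\<in>\<T>. indicator T x *\<^sub>R p T x)"
    and mean: "(LINT x|lebesgue_on \<Omega>. q x) = 0"
    using q unfolding P_0_iff by blast
  have "\<exists>c. \<forall>x\<in>T. q x = c" if T: "T \<in> \<T>" for T
  proof -
    obtain p' where "p' \<in> poly_fun k" "\<forall>x\<in>T. q x = p' x" using q T by (auto simp: P_0_def)
    then show ?thesis using pressure_gradient_zero[OF q ker T, of p'] by auto
  qed
  then obtain c where c: "\<And>T x. T \<in> \<T> \<Longrightarrow> x \<in> T \<Longrightarrow> q x = c T" by metis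
  have same: "c T = c T'" if "T \<in> \<T>" "T' \<in> \<T>" for T T'
    by (rule mesh_face_connected[OF domain mesh star _ that], assumption)
      (rule no_pressure_jump[OF q ker c])
  have zero: "c T = 0" if T: "T \<in> \<T>" for T
  proof -
    have "0 = (\<Sum>S\<in>\<T>. LINT x|lebesgue_on S. p S x)"
      using mean piecewise_L2(3)[of p] p poly_fun_continuous unfolding qp by metis
    also have "\<dots> = (\<Sum>S\<in>\<T>. c T * measure (lebesgue_on S) S)"
    proof (rule sum.cong[OF refl])
      fix S assume S: "S \<in> \<T>"
      have "q x = p S x" if "x \<in> S" for x
        unfolding qp by (rule piecewise_at[OF S that])
      then have "(LINT x|lebesgue_on S. p S x) = (LINT x|lebesgue_on S. c T)"
        using c[OF S] same[OF T S] by (intro Bochner_Integration.integral_cong) auto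
      then show "(LINT x|lebesgue_on S. p S x) = c T * measure (lebesgue_on S) S" by simp
    qed
    also have "\<dots> = c T * (\<Sum>S\<in>\<T>. measure (lebesgue_on S) S)"
      by (simp add: sum_distrib_left)
    finally have "c T * (\<Sum>S\<in>\<T>. measure (lebesgue_on S) S) = 0" by simp
    moreover have "(\<Sum>S\<in>\<T>. measure (lebesgue_on S) S) > 0"
      using T mesh_facts(1) mesh_element.measure_pos[OF element] by (intro sum_pos) auto
    ultimately show ?thesis by simp
  qed
  have "q x = 0" for x
  proof (cases "x \<in> \<Union>\<T>")
    case True
    then show ?thesis using c zero by auto
  next
    case False
    then show ?thesis using q by (simp add: P_0_def)
  qed
  then show ?thesis by (simp add: fun_eq_iff)
qed

section \<open>Well-posedness of the discrete problem\<close>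

text \<open>The abstract theorem is applied to \<open>V = U0 \<times> Ut\<close> and the pairs of pressures, with the sum
  of the two viscous forms without viscosities as inner product. Multipliers for both
  constraints are determined because test functions with zero boundary values are admissible in
  both momentum equations.\<close>

theorem discrete_problem_unique_solution:
  assumes nu: "\<nu>\<^sub>k > 0" "\<nu>\<^sub>m > 0" and f: "f \<in> L2 \<Omega>" and g: "g \<in> L2 \<Omega>"
    and stab: "\<And>T. T \<in> \<T> \<Longrightarrow> sym_psd_bilinear (U_loc k \<F> T) (s T)"
    and C: "C\<^sub>a > 0" "C\<^sub>t > 0" "C\<^sub>p > 0"
    and a_coercive: "\<And>v. v \<in> U \<Longrightarrow> inverse C\<^sub>a * (norm1 \<T> \<F> v)\<^sup>2 \<le> a_form k \<T> \<F> s v v"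
    and t_bound: "\<And>v w z. v \<in> Ut \<Longrightarrow> w \<in> Ut \<Longrightarrow> z \<in> Ut \<Longrightarrow>
         \<bar>t_form k \<T> \<F> v w z\<bar> \<le> C\<^sub>t * norm1 \<T> \<F> v * norm1 \<T> \<F> w * norm1 \<T> \<F> z"
    and poincare: "\<And>v. v \<in> Ut \<Longrightarrow> L2_norm \<Omega> (piecewise \<T> v) \<le> C\<^sub>p * norm1 \<T> \<F> v"
    and chi: "0 \<le> c" "c < 1"
    and small: "sqrt ((L2_norm \<Omega> f)\<^sup>2 + (L2_norm \<Omega> g)\<^sup>2)
         \<le> c * ((min \<nu>\<^sub>k \<nu>\<^sub>m)\<^sup>2 / (sqrt 2 * C\<^sub>a\<^sup>2 * C\<^sub>t * C\<^sub>p))"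
  shows "\<exists>!x. x \<in> X_space k \<Omega> \<T> \<F> \<and> solves_DP k \<Omega> \<T> \<F> s \<nu>\<^sub>k \<nu>\<^sub>m f g x"
proof -
  let ?a = "a_form k \<T> \<F> s" and ?t = "t_form k \<T> \<F>" and ?d = "d_form k \<T> \<F>"
  let ?n = "norm1 \<T> \<F>" and ?load = "\<lambda>f v. L2_inner \<Omega> f (piecewise \<T> v)"
  define V where "V = U0 \<times> Ut"
  define P where "P x y = ?a (fst x) (fst y) + ?a (snd x) (snd y)" for x y
  define B where "B x y = \<nu>\<^sub>k * ?a (fst x) (fst y) + \<nu>\<^sub>m * ?a (snd x) (snd y)" for x y
  define \<tau> where "\<tau> x y z = ?t (fst x) (fst y) (fst z) - ?t (snd x) (snd y) (fst z)
      + ?t (fst x) (snd y) (snd z) - ?t (snd x) (fst y) (snd z)" for x y z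
  define L where "L z = ?load f (fst z) + ?load g (snd z)" for z
  define D where "D x q = ?d (fst x) (fst q) + ?d (snd x) (snd q)" for x q
  define \<nu> where "\<nu> = min \<nu>\<^sub>k \<nu>\<^sub>m"
  have spaces: "U0 \<subseteq> Ut" "Ut \<subseteq> U" "U0 \<subseteq> U" using U_subspaces by auto
  have in_U: "fst x \<in> U" "snd x \<in> U" "fst x \<in> Ut" "snd x \<in> Ut" if "x \<in> V" for x
    using that spaces by (auto simp: V_def)
  have V: "subspace V" "finite_dim V"
    unfolding V_def using U_subspaces spaces finite_dim_mono[OF finite_dim_U]
    by (auto intro: subspace_Times finite_dim_Times)
  note a_bil = a_form_bilinear(1)[OF stab] and a_sym = a_form_bilinear(2)[OF stab]
  have on_V: "lin_on V (\<lambda>x. M (fst x))" "lin_on V (\<lambda>x. M (snd x))" if "lin_on U M" for M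
    unfolding V_def using that spaces by (auto intro: lin_on_fst lin_on_snd lin_on_mono)
  have P_bil: "bilinear_on V V P" and B_bil: "bilinear_on V V B"
    unfolding bilinear_on_def P_def B_def
    by (intro conjI ballI lin_on_plus lin_on_cmult on_V bilinear_onD1[OF a_bil] bilinear_onD2[OF a_bil] in_U;
        assumption)+
  have a_pos: "?a v v > 0" if v: "v \<in> Ut" "v \<noteq> 0" for v
  proof -
    have "?n v \<noteq> 0"
    proof
      assume z: "?n v = 0"
      have "L2_norm \<Omega> (piecewise \<T> v) \<ge> 0"
        by (simp add: L2_norm_def Bochner_Integration.integral_nonneg)
      then have "L2_norm \<Omega> (piecewise \<T> v) = 0" using poincare[OF v(1)] z by simp
      then show False using norm1_eq_0[OF _ z] v spaces by blast
    qed
    then have "0 < inverse C\<^sub>a * (?n v)\<^sup>2" using C by simp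
    then show ?thesis using a_coercive[of v] v spaces by force
  qed
  have a_nonneg: "?a v v \<ge> 0" if "v \<in> U" for v
    using a_coercive[OF that] C by (meson inverse_nonnegative_iff_nonnegative less_imp_le mult_nonneg_nonneg order_trans zero_le_power2)
  interpret inner_product_on V P
  proof
    show "P x y = P y x" if "x \<in> V" "y \<in> V" for x y
      using a_sym in_U that by (simp add: P_def)
    show "P x x > 0" if x: "x \<in> V" "x \<noteq> 0" for x
    proof -
      have "fst x \<noteq> 0 \<or> snd x \<noteq> 0" using x(2) by (simp add: prod_eq_iff)
      then show ?thesis
        using a_pos[OF in_U(3)[OF x(1)]] a_pos[OF in_U(4)[OF x(1)]]
          a_nonneg[OF in_U(1)[OF x(1)]] a_nonneg[OF in_U(2)[OF x(1)]]
        by (auto simp: P_def intro: add_pos_nonneg add_nonneg_pos)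
    qed
  qed (fact V P_bil)+
  define \<alpha> where "\<alpha> v = sqrt (?a v v)" for v
  have N_eq: "N x = sqrt ((\<alpha> (fst x))\<^sup>2 + (\<alpha> (snd x))\<^sup>2)" if "x \<in> V" for x
    using a_nonneg in_U that by (simp add: N_def P_def \<alpha>_def)
  have \<alpha>0: "\<alpha> v \<ge> 0" if "v \<in> U" for v using a_nonneg[OF that] by (simp add: \<alpha>_def)
  have n_le: "?n v \<le> sqrt C\<^sub>a * \<alpha> v" if "v \<in> U" for v
  proof -
    have "(?n v)\<^sup>2 \<le> C\<^sub>a * ?a v v"
      using a_coercive[OF that] C(1) by (simp add: field_simps)
    then show ?thesis
      unfolding \<alpha>_def real_sqrt_mult[symmetric] by (rule real_le_rsqrt)
  qed
  \<comment> \<open>Each of the three norms in the bound on \<open>t\<close> costs a factor \<open>sqrt C\<^sub>a\<close> in the energy norm \<open>\<alpha>\<close>.\<close>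
  define K where "K = C\<^sub>t * (sqrt C\<^sub>a) ^ 3"
  have K: "K \<ge> 0" using C by (simp add: K_def)
  have t_le: "\<bar>?t v w z\<bar> \<le> K * \<alpha> v * \<alpha> w * \<alpha> z" if "v \<in> Ut" "w \<in> Ut" "z \<in> Ut" for v w z
  proof -
    have U: "v \<in> U" "w \<in> U" "z \<in> U" using that spaces by auto
    have "\<bar>?t v w z\<bar> \<le> C\<^sub>t * ?n v * ?n w * ?n z" by (rule t_bound[OF that])
    also have "\<dots> \<le> C\<^sub>t * (sqrt C\<^sub>a * \<alpha> v) * (sqrt C\<^sub>a * \<alpha> w) * (sqrt C\<^sub>a * \<alpha> z)"
      using C norm1_nonneg n_le[OF U(1)] n_le[OF U(2)] n_le[OF U(3)] \<alpha>0 U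
      by (intro mult_mono mult_nonneg_nonneg) auto
    also have "\<dots> = K * \<alpha> v * \<alpha> w * \<alpha> z" by (simp add: K_def power3_eq_cube)
    finally show ?thesis .
  qed
  have tau_bound: "\<bar>\<tau> x y z\<bar> \<le> sqrt 2 * K * N x * N y * N z" if x: "x \<in> V" "y \<in> V" "z \<in> V" for x y z
  proof -
    let ?\<alpha>1 = "\<lambda>x. \<alpha> (fst x)" and ?\<alpha>2 = "\<lambda>x. \<alpha> (snd x)"
    have nn: "?\<alpha>1 w \<ge> 0" "?\<alpha>2 w \<ge> 0" if "w \<in> V" for w using \<alpha>0 in_U that by auto
    have "\<bar>\<tau> x y z\<bar> \<le> K * ?\<alpha>1 x * ?\<alpha>1 y * ?\<alpha>1 z + K * ?\<alpha>2 x * ?\<alpha>2 y * ?\<alpha>1 z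
        + K * ?\<alpha>1 x * ?\<alpha>2 y * ?\<alpha>2 z + K * ?\<alpha>2 x * ?\<alpha>1 y * ?\<alpha>2 z"
      unfolding \<tau>_def
      using t_le[OF in_U(3)[OF x(1)] in_U(3)[OF x(2)] in_U(3)[OF x(3)]]
        t_le[OF in_U(4)[OF x(1)] in_U(4)[OF x(2)] in_U(3)[OF x(3)]]
        t_le[OF in_U(3)[OF x(1)] in_U(4)[OF x(2)] in_U(4)[OF x(3)]]
        t_le[OF in_U(4)[OF x(1)] in_U(3)[OF x(2)] in_U(4)[OF x(3)]]
      by linarith
    also have "\<dots> = K * (?\<alpha>1 x * (?\<alpha>1 y * ?\<alpha>1 z + ?\<alpha>2 y * ?\<alpha>2 z) + ?\<alpha>2 x * (?\<alpha>2 y * ?\<alpha>1 z + ?\<alpha>1 y * ?\<alpha>2 z))"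
      by (simp add: algebra_simps)
    also have "\<dots> \<le> K * (?\<alpha>1 x * (N y * N z) + ?\<alpha>2 x * (N y * N z))"
    proof -
      have 1: "?\<alpha>1 y * ?\<alpha>1 z + ?\<alpha>2 y * ?\<alpha>2 z \<le> N y * N z"
        unfolding N_eq[OF x(2)] N_eq[OF x(3)] by (rule Cauchy_Schwarz_pair)
      have 2: "?\<alpha>2 y * ?\<alpha>1 z + ?\<alpha>1 y * ?\<alpha>2 z \<le> N y * N z"
        using Cauchy_Schwarz_pair[of "?\<alpha>2 y" "?\<alpha>1 z" "?\<alpha>1 y" "?\<alpha>2 z"]
        unfolding N_eq[OF x(2)] N_eq[OF x(3)] by (simp add: add.commute)
      show ?thesis
        using K nn[OF x(1)] 1 2 by (intro mult_left_mono add_mono) auto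
    qed
    also have "\<dots> = K * (?\<alpha>1 x + ?\<alpha>2 x) * (N y * N z)" by (simp add: algebra_simps)
    also have "\<dots> \<le> K * (N x * sqrt 2) * (N y * N z)"
    proof -
      have "?\<alpha>1 x + ?\<alpha>2 x \<le> N x * sqrt 2"
        using Cauchy_Schwarz_pair[of "?\<alpha>1 x" 1 "?\<alpha>2 x" 1] unfolding N_eq[OF x(1)] by simp
      then show ?thesis
        using K N_nonneg[OF x(2)] N_nonneg[OF x(3)] by (intro mult_right_mono mult_left_mono) auto
    qed
    finally show ?thesis by (simp add: algebra_simps)
  qed
  define \<Lambda> where "\<Lambda> = C\<^sub>p * sqrt C\<^sub>a * sqrt ((L2_norm \<Omega> f)\<^sup>2 + (L2_norm \<Omega> g)\<^sup>2)"
  have load_le: "\<bar>?load e v\<bar> \<le> C\<^sub>p * sqrt C\<^sub>a * (L2_norm \<Omega> e * \<alpha> v)" if e: "e \<in> L2 \<Omega>" and v: "v \<in> Ut" for e v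
  proof -
    have vU: "v \<in> U" using v spaces by blast
    have e0: "L2_norm \<Omega> e \<ge> 0" by (simp add: L2_norm_def Bochner_Integration.integral_nonneg)
    have "\<bar>?load e v\<bar> \<le> L2_norm \<Omega> e * L2_norm \<Omega> (piecewise \<T> v)"
      unfolding piecewise_alt
      by (intro L2_inner_Cauchy_Schwarz e piecewise_L2(1) U_elt_continuous vU)
    also have "\<dots> \<le> L2_norm \<Omega> e * (C\<^sub>p * (sqrt C\<^sub>a * \<alpha> v))"
      using poincare[OF v] n_le[OF vU] C(3) e0
      by (intro mult_left_mono) (auto intro: order_trans[OF _ mult_left_mono])
    finally show ?thesis by (simp add: mult_ac)
  qed
  have L_bound: "\<bar>L z\<bar> \<le> \<Lambda> * N z" if z: "z \<in> V" for z
  proof -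
    have "\<bar>L z\<bar> \<le> C\<^sub>p * sqrt C\<^sub>a * (L2_norm \<Omega> f * \<alpha> (fst z)) + C\<^sub>p * sqrt C\<^sub>a * (L2_norm \<Omega> g * \<alpha> (snd z))"
      using load_le[OF f in_U(3)[OF z]] load_le[OF g in_U(4)[OF z]] by (simp add: L_def)
    also have "\<dots> = C\<^sub>p * sqrt C\<^sub>a * (L2_norm \<Omega> f * \<alpha> (fst z) + L2_norm \<Omega> g * \<alpha> (snd z))"
      by (simp add: distrib_left)
    also have "\<dots> \<le> C\<^sub>p * sqrt C\<^sub>a * (sqrt ((L2_norm \<Omega> f)\<^sup>2 + (L2_norm \<Omega> g)\<^sup>2) * N z)"
      unfolding N_eq[OF z] using C by (intro mult_left_mono Cauchy_Schwarz_pair) auto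
    finally show ?thesis by (simp add: \<Lambda>_def mult.assoc)
  qed
  have smallness: "(sqrt 2 * K) * \<Lambda> \<le> c * \<nu>\<^sup>2"
  proof -
    have "sqrt C\<^sub>a ^ 3 * sqrt C\<^sub>a = C\<^sub>a\<^sup>2"
      using C by (simp add: power3_eq_cube power2_eq_square)
    then have "(sqrt 2 * K) * \<Lambda> = (sqrt 2 * C\<^sub>a\<^sup>2 * C\<^sub>t * C\<^sub>p) * sqrt ((L2_norm \<Omega> f)\<^sup>2 + (L2_norm \<Omega> g)\<^sup>2)"
      by (simp add: K_def \<Lambda>_def mult_ac)
    also have "\<dots> \<le> (sqrt 2 * C\<^sub>a\<^sup>2 * C\<^sub>t * C\<^sub>p) * (c * (\<nu>\<^sup>2 / (sqrt 2 * C\<^sub>a\<^sup>2 * C\<^sub>t * C\<^sub>p)))"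
      using small C unfolding \<nu>_def by (intro mult_left_mono) auto
    also have "\<dots> = c * \<nu>\<^sup>2" using C by simp
    finally show ?thesis .
  qed
  have d_bil: "bilinear_on V (Q \<times> Q) D"
    unfolding bilinear_on_def D_def
    by (intro conjI ballI lin_on_plus on_V lin_on_fst lin_on_snd
        bilinear_onD1[OF d_form_bilinear] bilinear_onD2[OF d_form_bilinear] in_U;
        (assumption | erule SigmaE2 | auto)?)
  have zero: "0 \<in> U0" "0 \<in> Ut" "0 \<in> U" "0 \<in> Q"
    using U_subspaces subspace_P_0 by (auto simp: subspace_0)
  have d0: "?d 0 q = 0" if "q \<in> Q" for q
    by (rule lin_on_zero[OF bilinear_onD1[OF d_form_bilinear that] zero(3)])
  have solution: "\<exists>!(x, q). x \<in> V \<and> q \<in> Q \<times> Q \<and> (\<forall>v\<in>V. B x v + \<tau> x x v + D v q = L v) \<and> (\<forall>p\<in>Q \<times> Q. D x p = 0)"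
  proof (rule mixed_skew_quadratic_solution[where \<tau> = \<tau> and \<nu> = \<nu> and M = "sqrt 2 * K" and \<Lambda> = \<Lambda> and c = c])
    show "\<nu> > 0" using nu by (simp add: \<nu>_def)
    show "\<nu> * P x x \<le> B x x" if "x \<in> V" for x
      using a_nonneg[OF in_U(1)[OF that]] a_nonneg[OF in_U(2)[OF that]]
      unfolding P_def B_def distrib_left by (intro add_mono mult_right_mono) (auto simp: \<nu>_def)
    show "bilinear_on V V (\<tau> x)" if "x \<in> V" for x
      unfolding bilinear_on_def \<tau>_def
      by (intro conjI ballI lin_on_plus lin_on_minus on_V bilinear_onD1[OF t_form_trilinear(2)]
          bilinear_onD2[OF t_form_trilinear(2)] in_U that; assumption)
    show "lin_on V (\<lambda>x. \<tau> x y z)" if "y \<in> V" "z \<in> V" for y z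
      unfolding \<tau>_def by (intro lin_on_plus lin_on_minus on_V t_form_trilinear(1) in_U that)
    show "\<tau> x y y = 0" if "x \<in> V" "y \<in> V" for x y
      \<comment> \<open>The terms with the convecting field \<open>u\<close> vanish, and the two with \<open>b\<close> cancel each other.\<close>
      using t_form_skew[of "snd x" "snd y" "fst y"] by (simp add: \<tau>_def t_form_diag)
    show "lin_on V L"
      unfolding L_def by (intro lin_on_plus on_V load_lin_on f g)
    show "0 \<le> \<Lambda>" using C by (simp add: \<Lambda>_def)
    show "0 \<le> sqrt 2 * K" using K by simp
    show "subspace (Q \<times> Q)" "finite_dim (Q \<times> Q)"
      by (intro subspace_Times finite_dim_Times subspace_P_0 finite_dim_P_0)+
    show "q = 0" if q: "q \<in> Q \<times> Q" and ker: "\<And>v. v \<in> V \<Longrightarrow> D v q = 0" for q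
    proof -
      have "fst q = 0"
      proof (rule pressure_determined)
        show "?d v (fst q) = 0" if "v \<in> U0" for v
          using ker[of "(v, 0)"] that zero q d0 by (auto simp: D_def V_def)
      qed (use q in auto)
      moreover have "snd q = 0"
      proof (rule pressure_determined)
        show "?d v (snd q) = 0" if "v \<in> U0" for v
          using ker[of "(0, v)"] that zero q d0 spaces by (auto simp: D_def V_def)
      qed (use q in auto)
      ultimately show ?thesis by (simp add: prod_eq_iff)
    qed
  qed (fact B_bil tau_bound L_bound chi smallness d_bil)+
  have equiv: "(u, b, q, r) \<in> X_space k \<Omega> \<T> \<F> \<and> solves_DP k \<Omega> \<T> \<F> s \<nu>\<^sub>k \<nu>\<^sub>m f g (u, b, q, r) \<longleftrightarrow>
      (u, b) \<in> V \<and> (q, r) \<in> Q \<times> Q \<and> (\<forall>v\<in>V. B (u, b) v + \<tau> (u, b) (u, b) v + D v (q, r) = L v) \<and>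
      (\<forall>p\<in>Q \<times> Q. D (u, b) p = 0)" (is "?lhs \<longleftrightarrow> ?rhs") for u b q r
  proof
    assume ?lhs
    then show ?rhs
      unfolding X_space_def solves_DP_def V_def B_def \<tau>_def D_def L_def
      by (auto simp: algebra_simps) (smt (verit))
  next
    assume r: ?rhs
    then have mem: "u \<in> U0" "b \<in> Ut" "u \<in> U" "b \<in> U" "q \<in> Q" "r \<in> Q" using spaces by (auto simp: V_def)
    have z1: "?a x 0 = 0" "?t x y 0 = 0" if "x \<in> U" "y \<in> U" for x y
      using lin_on_zero[OF bilinear_onD2[OF a_bil that(1)] zero(3)]
        lin_on_zero[OF bilinear_onD2[OF t_form_trilinear(2)[OF that(1)] that(2)] zero(3)] by auto
    have z2: "?load f 0 = 0" "?load g 0 = 0"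
      using lin_on_zero[OF load_lin_on zero(3)] f g by auto
    have z3: "?d x 0 = 0" if "x \<in> U" for x
      by (rule lin_on_zero[OF bilinear_onD2[OF d_form_bilinear that] zero(4)])
    have eq: "B (u, b) v + \<tau> (u, b) (u, b) v + D v (q, r) = L v" if "v \<in> V" for v
      using r that by blast
    have "\<nu>\<^sub>k * ?a u v + ?t u u v - ?t b b v + ?d v q = ?load f v" if "v \<in> U0" for v
      using eq[of "(v, 0)"] that zero z1 z2 d0 mem by (simp add: V_def B_def \<tau>_def D_def L_def)
    moreover have "\<nu>\<^sub>m * ?a b w + ?t u b w - ?t b u w + ?d w r = ?load g w" if "w \<in> Ut" for w
      using eq[of "(0, w)"] that zero z1 z2 d0 mem by (simp add: V_def B_def \<tau>_def D_def L_def)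
    moreover have "?d u p = 0" "?d b p = 0" if "p \<in> Q" for p
    proof -
      have "D (u, b) (p, 0) = 0" "D (u, b) (0, p) = 0" using r that zero by blast+
      then show "?d u p = 0" "?d b p = 0" using z3 mem by (simp_all add: D_def)
    qed
    ultimately show ?lhs
      using mem by (simp add: X_space_def solves_DP_def)
  qed
  define Sol where "Sol x q \<longleftrightarrow> x \<in> V \<and> q \<in> Q \<times> Q \<and>
      (\<forall>v\<in>V. B x v + \<tau> x x v + D v q = L v) \<and> (\<forall>p\<in>Q \<times> Q. D x p = 0)" for x q
  have "\<exists>!z. Sol (fst z) (snd z)"
    using solution by (simp add: Sol_def case_prod_unfold)
  then obtain z where z: "Sol (fst z) (snd z)" and uniq: "\<And>z'. Sol (fst z') (snd z') \<Longrightarrow> z' = z"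
    by blast
  obtain u b q r where z_eq: "z = ((u, b), (q, r))" by (metis prod.collapse)
  show ?thesis
  proof (rule ex1I[of _ "(u, b, q, r)"])
    show "(u, b, q, r) \<in> X_space k \<Omega> \<T> \<F> \<and> solves_DP k \<Omega> \<T> \<F> s \<nu>\<^sub>k \<nu>\<^sub>m f g (u, b, q, r)"
      unfolding equiv by (rule z[unfolded z_eq fst_conv snd_conv Sol_def])
    fix y assume y: "y \<in> X_space k \<Omega> \<T> \<F> \<and> solves_DP k \<Omega> \<T> \<F> s \<nu>\<^sub>k \<nu>\<^sub>m f g y"
    obtain u' b' q' r' where y_eq: "y = (u', b', q', r')" by (metis prod.collapse)
    have "((u', b'), (q', r')) = z"
      by (rule uniq, unfold fst_conv snd_conv Sol_def) (rule y[unfolded y_eq equiv])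
    then show "y = (u, b, q, r)" by (simp add: y_eq z_eq)
  qed
qed

end

theorem theorem4:
  fixes \<Omega> :: "(real^3) set"
    and k :: nat
    and \<nu>\<^sub>k \<nu>\<^sub>m :: real
    and f g :: "real^3 \<Rightarrow> real^3"
    and \<H> :: "real set"
    and \<T> \<F> :: "real \<Rightarrow> (real^3) set set"
    and s :: "real \<Rightarrow> (real^3) set \<Rightarrow> local_dofs \<Rightarrow> local_dofs \<Rightarrow> real"
    and C\<^sub>a C\<^sub>t C\<^sub>p chi :: real
  assumes domain: "polyhedral_lipschitz_domain \<Omega>"
    and viscosities: "\<nu>\<^sub>k > 0" "\<nu>\<^sub>m > 0"
    and sources: "f \<in> L2 \<Omega>" "g \<in> L2 \<Omega>" "weakly_div_free \<Omega> g"
    and mesh_sizes: "countable \<H>" "\<H> \<subseteq> {0<..}" "\<And>x. x islimpt \<H> \<longleftrightarrow> x = 0"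
    and mesh: "\<And>h. h \<in> \<H> \<Longrightarrow> polyhedral_mesh \<Omega> (\<T> h) (\<F> h)"
    and mesh_size: "\<And>h. h \<in> \<H> \<Longrightarrow> h = Max (diameter ` \<T> h)"
    and mesh_regularity:
      "\<exists>\<rho>>0. \<forall>h\<in>\<H>. \<forall>T\<in>\<T> h. \<exists>c r. r \<ge> inverse \<rho> * diameter T \<and> star_shaped_wrt_ball T c r"
    and stab_form:
      "\<And>h T. h \<in> \<H> \<Longrightarrow> T \<in> \<T> h \<Longrightarrow> sym_psd_bilinear (U_loc k (\<F> h) T) (s h T)"
    and stab_equiv:
      "\<exists>C>0. \<forall>h\<in>\<H>. \<forall>T\<in>\<T> h. \<forall>v\<in>U_loc k (\<F> h) T.
         (norm1_loc (\<F> h) T v)\<^sup>2 \<le> C * a_loc k (\<F> h) (s h T) T v v \<and>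
         a_loc k (\<F> h) (s h T) T v v \<le> C * (norm1_loc (\<F> h) T v)\<^sup>2"
    and stab_consistency:
      "\<exists>C>0. \<forall>h\<in>\<H>. \<forall>T\<in>\<T> h. \<forall>v\<in>sobolev_vec (k + 2) T. continuous_on (closure T) v \<longrightarrow>
         s h T (interp k (\<F> h) T v) (interp k (\<F> h) T v)
           \<le> C * (diameter T ^ (k + 1) * sobolev_seminorm (k + 2) T v)\<^sup>2"
    and constants: "C\<^sub>a > 0" "C\<^sub>t > 0" "C\<^sub>p > 0"
    and a_bounds: "\<And>h v. h \<in> \<H> \<Longrightarrow> v \<in> U_glob k (\<T> h) (\<F> h) \<Longrightarrow>
         inverse C\<^sub>a * (norm1 (\<T> h) (\<F> h) v)\<^sup>2 \<le> a_form k (\<T> h) (\<F> h) (s h) v v \<and>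
         a_form k (\<T> h) (\<F> h) (s h) v v \<le> C\<^sub>a * (norm1 (\<T> h) (\<F> h) v)\<^sup>2"
    and t_bound: "\<And>h v w z. h \<in> \<H> \<Longrightarrow> v \<in> U_glob_n k \<Omega> (\<T> h) (\<F> h) \<Longrightarrow>
         w \<in> U_glob_n k \<Omega> (\<T> h) (\<F> h) \<Longrightarrow> z \<in> U_glob_n k \<Omega> (\<T> h) (\<F> h) \<Longrightarrow>
         \<bar>t_form k (\<T> h) (\<F> h) v w z\<bar>
           \<le> C\<^sub>t * norm1 (\<T> h) (\<F> h) v * norm1 (\<T> h) (\<F> h) w * norm1 (\<T> h) (\<F> h) z"
    and poincare: "\<And>h v. h \<in> \<H> \<Longrightarrow> v \<in> U_glob_n k \<Omega> (\<T> h) (\<F> h) \<Longrightarrow>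
         L2_norm \<Omega> (piecewise (\<T> h) v) \<le> C\<^sub>p * norm1 (\<T> h) (\<F> h) v"
    and chi_range: "0 \<le> chi" "chi < 1"
    and small_data:
      "sqrt ((L2_norm \<Omega> f)\<^sup>2 + (L2_norm \<Omega> g)\<^sup>2)
         \<le> chi * ((min \<nu>\<^sub>k \<nu>\<^sub>m)\<^sup>2 / (sqrt 2 * C\<^sub>a\<^sup>2 * C\<^sub>t * C\<^sub>p))"
  shows "\<forall>h\<in>\<H>. \<exists>!x. x \<in> X_space k \<Omega> (\<T> h) (\<F> h) \<and>
           solves_DP k \<Omega> (\<T> h) (\<F> h) (s h) \<nu>\<^sub>k \<nu>\<^sub>m f g x"
proof
  fix h assume h: "h \<in> \<H>"
  obtain \<rho> where rho: "\<rho> > 0"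
    "\<And>T. T \<in> \<T> h \<Longrightarrow> \<exists>c r. r \<ge> inverse \<rho> * diameter T \<and> star_shaped_wrt_ball T c r"
    using mesh_regularity h by blast
  interpret regular_mesh \<Omega> "\<T> h" "\<F> h" k
  proof
    show "polyhedral_lipschitz_domain \<Omega>" by (rule domain)
    show "polyhedral_mesh \<Omega> (\<T> h) (\<F> h)" by (rule mesh[OF h])
    fix T assume T: "T \<in> \<T> h"
    obtain c r where cr: "r \<ge> inverse \<rho> * diameter T" "star_shaped_wrt_ball T c r"
      using rho(2)[OF T] by blast
    have "open_polyhedron T" using mesh[OF h] T by (simp add: polyhedral_mesh_def)
    moreover have "bounded T"
      using mesh_element_subset[OF domain mesh[OF h] T] domain bounded_subset
      by (auto simp: polyhedral_lipschitz_domain_def)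
    ultimately have "diameter T > 0"
      by (intro diameter_open_pos open_polyhedron_open open_polyhedron_nonempty)
    then have "0 < inverse \<rho> * diameter T" using rho(1) by simp
    then have "r > 0" using cr(1) by linarith
    then show "\<exists>c r. r > 0 \<and> star_shaped_wrt_ball T c r" using cr(2) by blast
  qed
  show "\<exists>!x. x \<in> X_space k \<Omega> (\<T> h) (\<F> h) \<and>
      solves_DP k \<Omega> (\<T> h) (\<F> h) (s h) \<nu>\<^sub>k \<nu>\<^sub>m f g x"
    by (rule discrete_problem_unique_solution[OF viscosities sources(1,2) stab_form[OF h] constants
        conjunct1[OF a_bounds[OF h]] t_bound[OF h] poincare[OF h] chi_range small_data])
qed

end
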